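(* Let $p$ be a prime, $\Bbbk$ an infinite field of characteristic $p$, $V$ a finite-dimensional $\Bbbk$-vector space, and $G\leq\mathrm{GL}(V)$ a cyclic group of order $p^r$ ($r\ge 1$) with generator $\sigma$. Let $0\le a\le r$ and let $K$ be the subgroup of $G$ generated by $\sigma^{p^a}$. If there is an integer $b$ with $0<b\leq a$ such that $\Bbbk[V]$ has an indecomposable $\Bbbk G$-module direct summand isomorphic to $V_n$ for some $n$ with $p^a-p^b+1\leq n\leq p^a-1$, then $$\operatorname{depth}(R^G_K)\leq\dim\big(V^{\sigma^{p^{b-1}}}\big)\leq p^{b-1}\dim(V^G).$$
   Context: For $1\le n\le p^r$, $V_n$ denotes the indecomposable $\Bbbk G$-module of dimension $n$ on which $\sigma$ acts by a single Jordan block: it has a basis $e_1,\dots,e_n$ with $\sigma(e_1)=e_1$ and $\sigma(e_i)=e_i+e_{i-1}$ for $2\leq i\leq n$. $\Bbbk[V]=S(V^* )$ is the symmetric algebra of $V^*$, with $G$ acting via $g(f)=f\circ g^{-1}$; for $H\le G$, $\Bbbk[V]^H$ is the subring of $H$-invariants. $V^G$ is the subspace of $G$-fixed vectors, and $V^{g}$ is the subspace of vectors fixed by the element $g\in G$. For $K\leq G$, $\mathrm{Tr}^G_K:\Bbbk[V]^K\to\Bbbk[V]^G$ is $f\mapsto\sum_{\tau\in G/K}\tau f$ (sum over left coset representatives), $I^G_K$ is its image (an ideal of $\Bbbk[V]^G$), and $R^G_K=\Bbbk[V]^G/I^G_K$. The depth of a Noetherian commutative graded $\Bbbk$-algebra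 $A=\bigoplus_{i\ge0}A_i$ with $A_0=\Bbbk$ is the length of a maximal $A$-regular sequence contained in $A_+=\bigoplus_{i\ge1}A_i$. *)

theory Defs
  imports
    "HOL-Library.Poly_Mapping"
    "HOL-Library.Extended_Nat"
    "HOL-Computational_Algebra.Primes"
    "HOL-Algebra.QuotRing"
    "HOL-Algebra.Generated_Groups"
    "HOL-Algebra.Left_Coset"
begin

section \<open>Regular sequences and depth\<close>

definition regular_sequence :: "('a, 'm) ring_scheme \<Rightarrow> 'a list \<Rightarrow> bool" where
  "regular_sequence A xs \<longleftrightarrow>
     set xs \<subseteq> carrier A \<and>
     (\<forall>i<length xs. \<forall>y\<in>carrier A.
        xs ! i \<otimes>\<^bsub>A\<^esub> y \<in> genideal A (set (take i xs)) \<longrightarrow> y \<in> genideal A (set (take i xs))) \<and>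
     genideal A (set xs) \<noteq> carrier A"

definition positive_part :: "('a, 'm) ring_scheme \<Rightarrow> (nat \<Rightarrow> 'a set) \<Rightarrow> 'a set" where
  "positive_part A \<A> =
     {finsum A x {1..n} | n x. x \<in> Pi {1..n} \<A>}"

text \<open>
  In a Noetherian ring all regular sequences in a given proper ideal that cannot be prolonged within
  that ideal have the same length, which is therefore the supremum of the lengths of all regular
  sequences in the ideal.  Taking the supremum in \<^typ>\<open>enat\<close> avoids an arbitrary value for
  unbounded sets.
\<close>

definition depth :: "('a, 'm) ring_scheme \<Rightarrow> (nat \<Rightarrow> 'a set) \<Rightarrow> enat" where
  "depth A \<A> =
     (SUP xs \<in> {xs. regular_sequence A xs \<and> set xs \<subseteq> positive_part A \<A>}. enat (length xs))"

section \<open>The general linear group and fixed points\<close>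

definition GL :: "('k::field \<Rightarrow> 'v::ab_group_add \<Rightarrow> 'v) \<Rightarrow> ('v \<Rightarrow> 'v) monoid" where
  "GL s = \<lparr>carrier = {g. Vector_Spaces.linear s s g \<and> bij g}, mult = (\<circ>), one = id\<rparr>"

definition fixed_space :: "('v \<Rightarrow> 'v) set \<Rightarrow> 'v set" where
  "fixed_space H = {v. \<forall>h\<in>H. h v = v}"

section \<open>The symmetric algebra of the dual space\<close>

text \<open>
  Let \<open>B\<close> be a basis of \<open>V\<close>.  The symmetric algebra of the dual space is the polynomial algebra over
  the dual basis: \<open>var b\<close> stands for the coordinate functional belonging to \<open>b \<in> B\<close>, a monomial is a
  finitely supported exponent function, and \<open>linear_form B \<phi>\<close> is the element of degree one given by
  the linear functional \<open>\<phi>\<close>.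
\<close>

type_synonym ('v, 'k) mpoly = "('v \<Rightarrow>\<^sub>0 nat) \<Rightarrow>\<^sub>0 'k"

definition const :: "'k::field \<Rightarrow> ('v, 'k) mpoly" where
  "const c = Poly_Mapping.single 0 c"

definition var :: "'v \<Rightarrow> ('v, 'k::field) mpoly" where
  "var b = Poly_Mapping.single (Poly_Mapping.single b 1) 1"

definition linear_form :: "'v set \<Rightarrow> ('v \<Rightarrow> 'k::field) \<Rightarrow> ('v, 'k) mpoly" where
  "linear_form B \<phi> = (\<Sum>b\<in>B. const (\<phi> b) * var b)"

definition peval :: "('k::field \<Rightarrow> 'c::comm_ring_1) \<Rightarrow> ('v \<Rightarrow> 'c) \<Rightarrow> ('v, 'k) mpoly \<Rightarrow> 'c" where
  "peval \<iota> x f =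
     (\<Sum>m\<in>Poly_Mapping.keys f.
        \<iota> (Poly_Mapping.lookup f m) * (\<Prod>i\<in>Poly_Mapping.keys m. x i ^ Poly_Mapping.lookup m i))"

definition sym_dual :: "'v set \<Rightarrow> ('v, 'k::field) mpoly ring" where
  "sym_dual B =
     \<lparr>carrier = {f. \<forall>m\<in>Poly_Mapping.keys f. Poly_Mapping.keys m \<subseteq> B},
      mult = (*), one = 1, zero = 0, add = (+)\<rparr>"

definition homogeneous :: "nat \<Rightarrow> ('v, 'k::field) mpoly set" where
  "homogeneous d =
     {f. \<forall>m\<in>Poly_Mapping.keys f. (\<Sum>i\<in>Poly_Mapping.keys m. Poly_Mapping.lookup m i) = d}"

text \<open>
  The action \<open>g(f) = f \<circ> g\<^sup>-\<^sup>1\<close>: the algebra endomorphism extending \<open>\<phi> \<mapsto> \<phi> \<circ> g\<^sup>-\<^sup>1\<close> on the dual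
  basis, see \<open>act_linear_form\<close> and \<open>poly_fun_act\<close> below.
\<close>

definition coordinate :: "('k::field \<Rightarrow> 'v::ab_group_add \<Rightarrow> 'v) \<Rightarrow> 'v set \<Rightarrow> 'v \<Rightarrow> 'v \<Rightarrow> 'k" where
  "coordinate s B b = (\<lambda>v. module.representation s B v b)"

definition act :: "('k::field \<Rightarrow> 'v::ab_group_add \<Rightarrow> 'v) \<Rightarrow> 'v set \<Rightarrow> ('v \<Rightarrow> 'v)
    \<Rightarrow> ('v, 'k) mpoly \<Rightarrow> ('v, 'k) mpoly" where
  "act s B g = peval const (\<lambda>b. linear_form B (coordinate s B b \<circ> inv_into UNIV g))"

definition poly_fun :: "('k::field \<Rightarrow> 'v::ab_group_add \<Rightarrow> 'v) \<Rightarrow> 'v set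
    \<Rightarrow> ('v, 'k) mpoly \<Rightarrow> 'v \<Rightarrow> 'k" where
  "poly_fun s B f v = peval id (\<lambda>b. coordinate s B b v) f"

lemma peval_superset:
  assumes "finite S" "Poly_Mapping.keys f \<subseteq> S" "\<iota> 0 = 0"
  shows "peval \<iota> x f = (\<Sum>m\<in>S. \<iota> (Poly_Mapping.lookup f m) *
           (\<Prod>i\<in>Poly_Mapping.keys m. x i ^ Poly_Mapping.lookup m i))"
  unfolding peval_def using assms
  by (intro sum.mono_neutral_left) (auto simp: in_keys_iff)

lemma peval_zero: "peval \<iota> x 0 = 0"
  by (simp add: peval_def)

lemma peval_add:
  assumes "\<iota> 0 = 0" "\<And>c d. \<iota> (c + d) = \<iota> c + \<iota> d"
  shows "peval \<iota> x (f + g) = peval \<iota> x f + peval \<iota> x g"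
proof -
  let ?S = "Poly_Mapping.keys f \<union> Poly_Mapping.keys g"
  have "Poly_Mapping.keys (f + g) \<subseteq> ?S" by (rule keys_add)
  then show ?thesis
    using assms by (simp add: peval_superset[of ?S] lookup_add distrib_right sum.distrib)
qed

lemma peval_sum:
  assumes "\<iota> 0 = 0" "\<And>c d. \<iota> (c + d) = \<iota> c + \<iota> d"
  shows "peval \<iota> x (\<Sum>j\<in>J. f j) = (\<Sum>j\<in>J. peval \<iota> x (f j))"
  by (induction J rule: infinite_finite_induct) (simp_all add: peval_zero peval_add[where \<iota>=\<iota>, OF assms])

lemma peval_single:
  assumes "\<iota> 0 = 0"
  shows "peval \<iota> x (Poly_Mapping.single m c) =
           \<iota> c * (\<Prod>i\<in>Poly_Mapping.keys m. x i ^ Poly_Mapping.lookup m i)"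
  using assms by (simp add: peval_superset[of "{m}"])

lemma prod_keys_add:
  fixes x :: "'v \<Rightarrow> 'c::comm_ring_1" and m m' :: "'v \<Rightarrow>\<^sub>0 nat"
  shows "(\<Prod>i\<in>Poly_Mapping.keys (m + m'). x i ^ Poly_Mapping.lookup (m + m') i) =
    (\<Prod>i\<in>Poly_Mapping.keys m. x i ^ Poly_Mapping.lookup m i) *
    (\<Prod>i\<in>Poly_Mapping.keys m'. x i ^ Poly_Mapping.lookup m' i)"
proof -
  let ?S = "Poly_Mapping.keys m \<union> Poly_Mapping.keys m'"
  have *: "(\<Prod>i\<in>Poly_Mapping.keys u. x i ^ Poly_Mapping.lookup u i) = (\<Prod>i\<in>?S. x i ^ Poly_Mapping.lookup u i)"
    if "Poly_Mapping.keys u \<subseteq> ?S" for u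
    using that by (intro prod.mono_neutral_left) (auto simp: in_keys_iff)
  have "Poly_Mapping.keys (m + m') \<subseteq> ?S" by (rule keys_add)
  then have "(\<Prod>i\<in>Poly_Mapping.keys (m + m'). x i ^ Poly_Mapping.lookup (m + m') i) =
      (\<Prod>i\<in>?S. x i ^ Poly_Mapping.lookup (m + m') i)"
    by (rule *)
  also have "\<dots> = (\<Prod>i\<in>?S. x i ^ Poly_Mapping.lookup m i) * (\<Prod>i\<in>?S. x i ^ Poly_Mapping.lookup m' i)"
    by (simp add: lookup_add power_add prod.distrib)
  finally show ?thesis by (simp add: *)
qed

lemma mpoly_expand:
  fixes f :: "('v, 'k::field) mpoly"
  shows "f = (\<Sum>m\<in>Poly_Mapping.keys f. Poly_Mapping.single m (Poly_Mapping.lookup f m))"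
  by (rule poly_mapping_eqI) (simp add: lookup_sum lookup_single when_def in_keys_iff)

lemma peval_mult:
  assumes \<iota>: "\<iota> 0 = 0" "\<And>c d. \<iota> (c + d) = \<iota> c + \<iota> d" "\<And>c d. \<iota> (c * d) = \<iota> c * \<iota> d"
  shows "peval \<iota> x (f * g) = peval \<iota> x f * peval \<iota> x g"
proof -
  let ?s = "\<lambda>f m. Poly_Mapping.single m (Poly_Mapping.lookup f m)"
  have "peval \<iota> x (f * g) = peval \<iota> x
      ((\<Sum>m\<in>Poly_Mapping.keys f. ?s f m) * (\<Sum>m\<in>Poly_Mapping.keys g. ?s g m))"
    by (simp flip: mpoly_expand)
  also have "\<dots> = (\<Sum>m\<in>Poly_Mapping.keys f. peval \<iota> x (?s f m)) *
      (\<Sum>m\<in>Poly_Mapping.keys g. peval \<iota> x (?s g m))"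
    by (simp add: sum_product peval_sum[where \<iota>=\<iota>, OF \<iota>(1,2)] mult_single peval_single \<iota> prod_keys_add
        mult_ac)
  also have "\<dots> = peval \<iota> x f * peval \<iota> x g"
    by (simp only: peval_single[where \<iota>=\<iota>, OF \<iota>(1)] peval_def[where f=f] peval_def[where f=g])
  finally show ?thesis .
qed

lemma peval_const: "\<iota> 0 = 0 \<Longrightarrow> peval \<iota> x (const c) = \<iota> c"
  by (simp add: const_def peval_single)

lemma peval_var: "\<iota> 0 = 0 \<Longrightarrow> \<iota> 1 = 1 \<Longrightarrow> peval \<iota> x (var b) = x b"
  by (simp add: var_def peval_single)

lemma const_0: "const 0 = 0"
  and const_1: "const 1 = 1"
  and const_add: "const (c + d) = const c + const d"
  and const_mult: "const (c * d) = const c * const d"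
  by (simp_all add: const_def single_add mult_single)

lemma linear_form_expansion:
  fixes s :: "'k::field \<Rightarrow> 'v::ab_group_add \<Rightarrow> 'v"
  assumes "finite_dimensional_vector_space s B" "Vector_Spaces.linear s (*) \<phi>"
  shows "(\<Sum>b\<in>B. \<phi> b * coordinate s B b v) = \<phi> v"
proof -
  interpret finite_dimensional_vector_space s B by fact
  interpret l: Vector_Spaces.linear s "(*)" \<phi> by fact
  have "\<phi> v = \<phi> (\<Sum>b\<in>B. s (representation B v b) b)"
    by (simp add: sum_representation_eq independent_Basis span_Basis finite_Basis)
  also have "\<dots> = (\<Sum>b\<in>B. \<phi> b * coordinate s B b v)"
    by (simp add: l.sum l.scale coordinate_def mult.commute)
  finally show ?thesis by simp
qed

lemma poly_fun_linear_form:
  fixes s :: "'k::field \<Rightarrow> 'v::ab_group_add \<Rightarrow> 'v"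
  assumes "finite_dimensional_vector_space s B" "Vector_Spaces.linear s (*) \<phi>"
  shows "poly_fun s B (linear_form B \<phi>) v = \<phi> v"
  using linear_form_expansion[OF assms]
  by (simp add: poly_fun_def linear_form_def peval_sum peval_mult peval_const peval_var)

lemma linear_coordinate:
  fixes s :: "'k::field \<Rightarrow> 'v::ab_group_add \<Rightarrow> 'v"
  assumes "finite_dimensional_vector_space s B"
  shows "Vector_Spaces.linear s (*) (coordinate s B b)"
proof -
  interpret finite_dimensional_vector_space s B by fact
  have "vector_space ((*) :: 'k \<Rightarrow> 'k \<Rightarrow> 'k)"
    by unfold_locales (auto simp: algebra_simps)
  then show ?thesis
    using vector_space_axioms
    by (simp add: coordinate_def Vector_Spaces.linear_iff representation_add representation_scale
        independent_Basis span_Basis)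
qed

lemma linear_inv_GL:
  assumes "g \<in> carrier (GL s)"
  shows "Vector_Spaces.linear s s (inv_into UNIV g)"
proof -
  have lin: "Vector_Spaces.linear s s g" and bij: "bij g"
    using assms by (auto simp: GL_def)
  interpret g: Vector_Spaces.linear s s g by fact
  have surj: "g (inv_into UNIV g v) = v" for v
    using bij by (simp add: bij_is_surj surj_f_inv_f)
  have inj: "inv_into UNIV g v = w" if "v = g w" for v w
    using bij that by (simp add: bij_is_inj inv_f_f)
  show ?thesis
    using g.vs1.vector_space_axioms
    by (auto simp: Vector_Spaces.linear_iff g.add g.scale surj intro!: inj)
qed

lemma linear_coordinate_inv:
  fixes s :: "'k::field \<Rightarrow> 'v::ab_group_add \<Rightarrow> 'v"
  assumes "finite_dimensional_vector_space s B" "g \<in> carrier (GL s)"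
  shows "Vector_Spaces.linear s (*) (coordinate s B b \<circ> inv_into UNIV g)"
  by (rule Vector_Spaces.linear_compose[OF linear_inv_GL[OF assms(2)] linear_coordinate[OF assms(1)]])

lemma poly_fun_act:
  fixes s :: "'k::field \<Rightarrow> 'v::ab_group_add \<Rightarrow> 'v"
  assumes "finite_dimensional_vector_space s B" "g \<in> carrier (GL s)"
  shows "poly_fun s B (act s B g f) v = poly_fun s B f (inv_into UNIV g v)"
proof -
  let ?e = "peval id (\<lambda>b. coordinate s B b v)"
  have e_lin: "?e (linear_form B (coordinate s B b \<circ> inv_into UNIV g)) =
      coordinate s B b (inv_into UNIV g v)" for b
    using poly_fun_linear_form[OF assms(1) linear_coordinate_inv[OF assms]]
    by (simp add: poly_fun_def)
  have e_1: "?e 1 = 1"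
    using peval_const[of id "\<lambda>b. coordinate s B b v" 1] by (simp add: const_def)
  have e_pow: "?e (h ^ k) = ?e h ^ k" for h k
    by (induction k) (simp_all add: peval_mult e_1[unfolded id_def] id_def)
  have e_prod: "?e (\<Prod>i\<in>I. h i) = (\<Prod>i\<in>I. ?e (h i))" for h and I :: "'v set"
    by (induction I rule: infinite_finite_induct)
      (simp_all add: peval_mult e_1[unfolded id_def] id_def)
  show ?thesis
    unfolding poly_fun_def act_def
    by (subst (2) peval_def)
      (simp add: peval_sum peval_mult peval_const e_prod e_pow e_lin, simp add: peval_def)
qed

lemma act_linear_form:
  fixes s :: "'k::field \<Rightarrow> 'v::ab_group_add \<Rightarrow> 'v"
  assumes V: "finite_dimensional_vector_space s B" and g: "g \<in> carrier (GL s)"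
    and \<phi>: "Vector_Spaces.linear s (*) \<phi>"
  shows "act s B g (linear_form B \<phi>) = linear_form B (\<phi> \<circ> inv_into UNIV g)"
proof -
  have "act s B g (linear_form B \<phi>) =
      (\<Sum>b\<in>B. const (\<phi> b) * linear_form B (coordinate s B b \<circ> inv_into UNIV g))"
    by (simp add: act_def linear_form_def peval_sum peval_mult peval_const peval_var
        const_0 const_1 const_add const_mult)
  also have "\<dots> = (\<Sum>c\<in>B. const (\<Sum>b\<in>B. \<phi> b * coordinate s B b (inv_into UNIV g c)) * var c)"
  proof -
    have const_sum: "const (\<Sum>b\<in>B. h b) = (\<Sum>b\<in>B. const (h b) :: ('v, 'k) mpoly)" for h
      by (induction B rule: infinite_finite_induct) (simp_all add: const_0 const_add)
    show ?thesis
      unfolding linear_form_def sum_distrib_left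
      by (subst sum.swap) (simp add: const_sum const_mult sum_distrib_right mult.assoc)
  qed
  also have "\<dots> = linear_form B (\<phi> \<circ> inv_into UNIV g)"
    by (simp add: linear_form_expansion[OF V \<phi>] linear_form_def)
  finally show ?thesis .
qed

section \<open>Invariants and the relative transfer\<close>

definition invariants :: "('k::field \<Rightarrow> 'v::ab_group_add \<Rightarrow> 'v) \<Rightarrow> 'v set \<Rightarrow> ('v \<Rightarrow> 'v) set
    \<Rightarrow> ('v, 'k) mpoly set" where
  "invariants s B H = {f \<in> carrier (sym_dual B). \<forall>h\<in>H. act s B h f = f}"

definition invariant_ring :: "('k::field \<Rightarrow> 'v::ab_group_add \<Rightarrow> 'v) \<Rightarrow> 'v set \<Rightarrow> ('v \<Rightarrow> 'v) set
    \<Rightarrow> ('v, 'k) mpoly ring" where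
  "invariant_ring s B H = (sym_dual B)\<lparr>carrier := invariants s B H\<rparr>"

definition transfer :: "('k::field \<Rightarrow> 'v::ab_group_add \<Rightarrow> 'v) \<Rightarrow> 'v set
    \<Rightarrow> ('v \<Rightarrow> 'v) set \<Rightarrow> ('v \<Rightarrow> 'v) set \<Rightarrow> ('v, 'k) mpoly \<Rightarrow> ('v, 'k) mpoly" where
  "transfer s B G K f =
     (\<Sum>C\<in>lcosets\<^bsub>(GL s)\<lparr>carrier := G\<rparr>\<^esub> K. act s B (SOME \<tau>. \<tau> \<in> C) f)"

definition transfer_ideal :: "('k::field \<Rightarrow> 'v::ab_group_add \<Rightarrow> 'v) \<Rightarrow> 'v set
    \<Rightarrow> ('v \<Rightarrow> 'v) set \<Rightarrow> ('v \<Rightarrow> 'v) set \<Rightarrow> ('v, 'k) mpoly set" where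
  "transfer_ideal s B G K = transfer s B G K ` invariants s B K"

definition transfer_quotient :: "('k::field \<Rightarrow> 'v::ab_group_add \<Rightarrow> 'v) \<Rightarrow> 'v set
    \<Rightarrow> ('v \<Rightarrow> 'v) set \<Rightarrow> ('v \<Rightarrow> 'v) set \<Rightarrow> ('v, 'k) mpoly set ring" where
  "transfer_quotient s B G K = invariant_ring s B G Quot transfer_ideal s B G K"

definition transfer_quotient_grading :: "('k::field \<Rightarrow> 'v::ab_group_add \<Rightarrow> 'v) \<Rightarrow> 'v set
    \<Rightarrow> ('v \<Rightarrow> 'v) set \<Rightarrow> ('v \<Rightarrow> 'v) set \<Rightarrow> nat \<Rightarrow> ('v, 'k) mpoly set set" where
  "transfer_quotient_grading s B G K d =
     (\<lambda>f. transfer_ideal s B G K +>\<^bsub>invariant_ring s B G\<^esub> f) ` (invariants s B G \<inter> homogeneous d)"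

section \<open>Module summands\<close>

definition submodule_of_sym :: "('k::field \<Rightarrow> 'v::ab_group_add \<Rightarrow> 'v) \<Rightarrow> 'v set \<Rightarrow> ('v \<Rightarrow> 'v) set
    \<Rightarrow> ('v, 'k) mpoly set \<Rightarrow> bool" where
  "submodule_of_sym s B G M \<longleftrightarrow>
     M \<subseteq> carrier (sym_dual B) \<and> 0 \<in> M \<and>
     (\<forall>f\<in>M. \<forall>h\<in>M. f + h \<in> M) \<and>
     (\<forall>c. \<forall>f\<in>M. const c * f \<in> M) \<and>
     (\<forall>g\<in>G. \<forall>f\<in>M. act s B g f \<in> M)"

definition direct_decomposition :: "('k::field \<Rightarrow> 'v::ab_group_add \<Rightarrow> 'v) \<Rightarrow> 'v set \<Rightarrow> ('v \<Rightarrow> 'v) set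
    \<Rightarrow> ('v, 'k) mpoly set \<Rightarrow> ('v, 'k) mpoly set \<Rightarrow> ('v, 'k) mpoly set \<Rightarrow> bool" where
  "direct_decomposition s B G U M N \<longleftrightarrow>
     submodule_of_sym s B G M \<and> submodule_of_sym s B G N \<and>
     {f + h | f h. f \<in> M \<and> h \<in> N} = U \<and> M \<inter> N = {0}"

definition direct_summand :: "('k::field \<Rightarrow> 'v::ab_group_add \<Rightarrow> 'v) \<Rightarrow> 'v set \<Rightarrow> ('v \<Rightarrow> 'v) set
    \<Rightarrow> ('v, 'k) mpoly set \<Rightarrow> bool" where
  "direct_summand s B G M \<longleftrightarrow> (\<exists>N. direct_decomposition s B G (carrier (sym_dual B)) M N)"

definition indecomposable :: "('k::field \<Rightarrow> 'v::ab_group_add \<Rightarrow> 'v) \<Rightarrow> 'v set \<Rightarrow> ('v \<Rightarrow> 'v) set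
    \<Rightarrow> ('v, 'k) mpoly set \<Rightarrow> bool" where
  "indecomposable s B G M \<longleftrightarrow>
     M \<noteq> {0} \<and> (\<forall>M1 M2. direct_decomposition s B G M M1 M2 \<longrightarrow> M1 = {0} \<or> M2 = {0})"

text \<open>
  The module \<open>V\<^sub>n\<close> consists of coordinate vectors indexed by \<open>0, \<dots>, n - 1\<close>; the \<open>i\<close>-th unit vector is
  the basis vector \<open>e\<^sub>i\<^sub>+\<^sub>1\<close>.  From \<open>\<sigma> e\<^sub>1 = e\<^sub>1\<close> and \<open>\<sigma> e\<^sub>i = e\<^sub>i + e\<^sub>i\<^sub>-\<^sub>1\<close> the \<open>i\<close>-th coordinate of \<open>\<sigma> v\<close> is
  \<open>v i + v (i + 1)\<close>.
\<close>

definition jordan_module :: "nat \<Rightarrow> (nat \<Rightarrow> 'k::field) set" where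
  "jordan_module n = {v. \<forall>i\<ge>n. v i = 0}"

definition jordan_gen :: "(nat \<Rightarrow> 'k::field) \<Rightarrow> nat \<Rightarrow> 'k" where
  "jordan_gen v = (\<lambda>i. v i + v (Suc i))"

text \<open>As \<open>\<sigma>\<close> generates the group, a linear map is equivariant if it commutes with \<open>\<sigma>\<close>.\<close>

definition isomorphic_to_jordan :: "('k::field \<Rightarrow> 'v::ab_group_add \<Rightarrow> 'v) \<Rightarrow> 'v set \<Rightarrow> ('v \<Rightarrow> 'v)
    \<Rightarrow> ('v, 'k) mpoly set \<Rightarrow> nat \<Rightarrow> bool" where
  "isomorphic_to_jordan s B \<sigma> M n \<longleftrightarrow>
     (\<exists>\<psi>. bij_betw \<psi> (jordan_module n) M \<and>
        (\<forall>v\<in>jordan_module n. \<forall>w\<in>jordan_module n. \<psi> (\<lambda>i. v i + w i) = \<psi> v + \<psi> w) \<and>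
        (\<forall>c. \<forall>v\<in>jordan_module n. \<psi> (\<lambda>i. c * v i) = const c * \<psi> v) \<and>
        (\<forall>v\<in>jordan_module n. \<psi> (jordan_gen v) = act s B \<sigma> (\<psi> v)))"

end

theory Submission
  imports
    Defs
    "HOL-Algebra.Multiplicative_Group"
    "HOL-Computational_Algebra.Polynomial"
    "HOL-Number_Theory.Cong"
begin

text \<open>
  Write \<open>A\<close> for the invariants of \<open>G\<close>, \<open>I\<close> for the image of the transfer from \<open>K\<close>, \<open>H\<close> for the
  subgroup generated by \<open>\<sigma>\<close> to the power \<open>p ^ b\<close> and \<open>\<tau>\<close> for \<open>\<sigma>\<close> to the power \<open>p ^ (b - 1)\<close>.  The
  socle of the summand \<open>V\<^sub>n\<close> is spanned by an invariant \<open>y\<close>.  As \<open>n < p ^ a\<close>, the transfer kills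
  \<open>V\<^sub>n\<close> and \<open>y\<close> is not in \<open>I\<close>; as \<open>n > p ^ a - p ^ b\<close>, \<open>y\<close> is a transfer from \<open>K\<close> to \<open>H\<close>, so the
  image \<open>J\<close> of the transfer from \<open>H\<close> to \<open>G\<close> annihilates \<open>y\<close> modulo \<open>I\<close>.

  If \<open>f\<^sub>1, \<dots>, f\<^sub>d\<close> is a regular sequence modulo \<open>I\<close>, then a nonzero polynomial in the \<open>f\<^sub>i\<close> cannot
  annihilate an element outside the intersection of the ideals \<open>I + (f\<^sub>1, \<dots>, f\<^sub>d)\<^sup>N\<close>, and by
  degree reasons \<open>y\<close> is such an element.  Hence the nonzero polynomials in the \<open>f\<^sub>i\<close> do not meet \<open>J\<close>,
  nor the ideal generated by \<open>J\<close> in the polynomial ring (take norms), and some prime ideal \<open>P\<close>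
  contains \<open>J\<close> and avoids them.  Independence of characters modulo \<open>P\<close> shows that \<open>\<tau>\<close> acts trivially
  modulo \<open>P\<close>.  So the polynomial ring modulo \<open>P\<close> is generated by as many linear forms as the fixed
  space of \<open>\<tau>\<close> has dimension, while the \<open>f\<^sub>i\<close> stay algebraically independent; counting monomials
  bounds \<open>d\<close>.
\<close>

section \<open>Quasi-regularity, and cancellation of nonzero polynomials in a regular
  sequence\<close>

section \<open>Regular sequences modulo an ideal of a subring\<close>

text \<open>Rings are subsets of one ring type, so the polynomial ring and its rings of invariants
  share their operations and their ideals can be compared as plain sets.\<close>

locale subring_set =
  fixes A :: "'a::comm_ring_1 set"
  assumes zero_mem: "0 \<in> A" and one_mem: "1 \<in> A"
    and add_mem: "x \<in> A \<Longrightarrow> y \<in> A \<Longrightarrow> x + y \<in> A"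
    and mult_mem: "x \<in> A \<Longrightarrow> y \<in> A \<Longrightarrow> x * y \<in> A"
    and uminus_mem: "x \<in> A \<Longrightarrow> - x \<in> A"
begin

lemma diff_mem: "x \<in> A \<Longrightarrow> y \<in> A \<Longrightarrow> x - y \<in> A"
  using add_mem[of x "- y"] uminus_mem by simp

lemma sum_mem: "(\<And>i. i \<in> J \<Longrightarrow> f i \<in> A) \<Longrightarrow> sum f J \<in> A"
  by (induction J rule: infinite_finite_induct) (auto simp: zero_mem add_mem)

lemma prod_mem: "(\<And>i. i \<in> J \<Longrightarrow> f i \<in> A) \<Longrightarrow> prod f J \<in> A"
  by (induction J rule: infinite_finite_induct) (auto simp: one_mem mult_mem)

lemma power_mem: "x \<in> A \<Longrightarrow> x ^ n \<in> A"
  by (induction n) (auto simp: one_mem mult_mem)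

definition ideal_of :: "'a set \<Rightarrow> bool" where
  "ideal_of I \<longleftrightarrow> I \<subseteq> A \<and> 0 \<in> I \<and> (\<forall>x\<in>I. \<forall>y\<in>I. x + y \<in> I) \<and> (\<forall>x\<in>A. \<forall>y\<in>I. x * y \<in> I)"

lemma ideal_ofD:
  assumes "ideal_of I"
  shows "\<And>x. x \<in> I \<Longrightarrow> x \<in> A" "0 \<in> I" "\<And>x y. x \<in> I \<Longrightarrow> y \<in> I \<Longrightarrow> x + y \<in> I"
    "\<And>x y. x \<in> A \<Longrightarrow> y \<in> I \<Longrightarrow> x * y \<in> I" "\<And>x y. x \<in> A \<Longrightarrow> y \<in> I \<Longrightarrow> y * x \<in> I"
  using assms by (auto simp: ideal_of_def mult.commute)

lemma ideal_of_uminus: "ideal_of I \<Longrightarrow> x \<in> I \<Longrightarrow> - x \<in> I"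
  using ideal_ofD(4)[of I "- 1" x] by (simp add: one_mem uminus_mem)

lemma ideal_of_diff: "ideal_of I \<Longrightarrow> x \<in> I \<Longrightarrow> y \<in> I \<Longrightarrow> x - y \<in> I"
  using ideal_ofD(3)[of I x "- y"] ideal_of_uminus by simp

lemma ideal_of_sum: "ideal_of I \<Longrightarrow> (\<And>i. i \<in> J \<Longrightarrow> f i \<in> I) \<Longrightarrow> sum f J \<in> I"
  by (induction J rule: infinite_finite_induct) (auto simp: ideal_ofD)

definition adjoin :: "'a set \<Rightarrow> 'a \<Rightarrow> 'a set" where
  "adjoin I x = {i + x * z | i z. i \<in> I \<and> z \<in> A}"

lemma adjoin_cases:
  assumes "u \<in> adjoin I x"
  obtains i z where "u = i + x * z" "i \<in> I" "z \<in> A"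
  using assms by (auto simp: adjoin_def)

lemma adjoinI: "i \<in> I \<Longrightarrow> z \<in> A \<Longrightarrow> i + x * z \<in> adjoin I x"
  by (auto simp: adjoin_def)

lemma subset_adjoin: "I \<subseteq> adjoin I x"
  using adjoinI[of _ I 0 x] by (auto simp: zero_mem)

lemma mem_adjoin: "ideal_of I \<Longrightarrow> x \<in> adjoin I x"
  using adjoinI[of 0 I 1 x] by (auto simp: one_mem ideal_ofD)

lemma ideal_of_adjoin:
  assumes I: "ideal_of I" and x: "x \<in> A"
  shows "ideal_of (adjoin I x)"
  unfolding ideal_of_def
proof (intro conjI ballI)
  show "adjoin I x \<subseteq> A"
    using x ideal_ofD(1)[OF I] by (auto simp: adjoin_def intro!: add_mem mult_mem)
  show "0 \<in> adjoin I x" using adjoinI[of 0 I 0 x] by (simp add: ideal_ofD[OF I] zero_mem)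
  fix u v assume "u \<in> adjoin I x" "v \<in> adjoin I x"
  then obtain i z j w where "u = i + x * z" "i \<in> I" "z \<in> A" "v = j + x * w" "j \<in> I" "w \<in> A"
    by (auto simp: adjoin_def)
  moreover from this have "(i + j) + x * (z + w) \<in> adjoin I x"
    by (intro adjoinI ideal_ofD(3)[OF I] add_mem)
  ultimately show "u + v \<in> adjoin I x" by (simp add: algebra_simps)
next
  fix u v assume u: "u \<in> A" and "v \<in> adjoin I x"
  then obtain j w where "v = j + x * w" "j \<in> I" "w \<in> A"
    by (auto simp: adjoin_def)
  moreover from this u have "u * j + x * (u * w) \<in> adjoin I x"
    by (intro adjoinI ideal_ofD(4)[OF I] mult_mem)
  ultimately show "u * v \<in> adjoin I x" by (simp add: algebra_simps)
qed

text \<open>Only the nonzerodivisor conditions are recorded, peeled off from the front: each element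
  enlarges the ideal modulo which the remaining ones are tested, which suits induction on the
  list.\<close>

fun reg_mod :: "'a set \<Rightarrow> 'a list \<Rightarrow> bool" where
  "reg_mod I [] = True"
| "reg_mod I (x # xs) = ((\<forall>z\<in>A. x * z \<in> I \<longrightarrow> z \<in> I) \<and> reg_mod (adjoin I x) xs)"

lemma reg_mod_append1: "reg_mod I (xs @ ys) \<Longrightarrow> reg_mod I xs"
  by (induction xs arbitrary: I) auto

text \<open>\<open>Collect (ipow I X n)\<close> is the ideal \<open>I + (X)\<^sup>n\<close>.\<close>

inductive ipow :: "'a set \<Rightarrow> 'a set \<Rightarrow> nat \<Rightarrow> 'a \<Rightarrow> bool" for I X where
  zero: "u \<in> A \<Longrightarrow> ipow I X 0 u"
| base: "u \<in> I \<Longrightarrow> ipow I X n u"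
| mult: "ipow I X n u \<Longrightarrow> x \<in> X \<Longrightarrow> ipow I X (Suc n) (x * u)"
| add: "ipow I X n u \<Longrightarrow> ipow I X n v \<Longrightarrow> ipow I X n (u + v)"

context
  fixes I X assumes I: "ideal_of I" and X: "X \<subseteq> A"
begin

lemma ipow_mem: "ipow I X n u \<Longrightarrow> u \<in> A"
  by (induction rule: ipow.induct) (use X in \<open>auto simp: add_mem mult_mem ideal_ofD[OF I]\<close>)

lemma ipow_antimono: "ipow I X m u \<Longrightarrow> n \<le> m \<Longrightarrow> ipow I X n u"
proof (induction arbitrary: n rule: ipow.induct)
  case (mult m u x)
  then show ?case
    using ipow_mem[OF mult(1)] X by (cases n) (auto intro!: ipow.mult intro: ipow.zero mult_mem)
qed (auto intro: ipow.intros)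

lemma ipow_smult: "ipow I X n u \<Longrightarrow> a \<in> A \<Longrightarrow> ipow I X n (a * u)"
proof (induction rule: ipow.induct)
  case (mult n u x)
  then show ?case
    using ipow.mult[of I X n "a * u" x] by (simp add: mult.left_commute)
next
  case (add n u v)
  then show ?case by (simp add: distrib_left ipow.add)
qed (auto intro: ipow.intros simp: mult_mem ideal_ofD[OF I])

lemma ideal_of_ipow: "ideal_of (Collect (ipow I X n))"
  unfolding ideal_of_def
  by (auto intro: ipow_mem ipow.base ipow.add ipow_smult simp: ideal_ofD[OF I])

lemma ipow_diff: "ipow I X n u \<Longrightarrow> ipow I X n v \<Longrightarrow> ipow I X n (u - v)"
  using ideal_of_diff[OF ideal_of_ipow[of n]] by auto

end

lemma ipow_mono: "ipow I X n u \<Longrightarrow> X \<subseteq> Y \<Longrightarrow> ipow I Y n u"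
  by (induction rule: ipow.induct) (auto intro: ipow.intros)

text \<open>At exponent 0 the predicate holds on all of \<open>A\<close>, so only positive powers of
  the empty set collapse to \<open>I\<close>.\<close>

lemma ipow_empty:
  assumes I: "ideal_of I" shows "ipow I {} (Suc n) u \<longleftrightarrow> u \<in> I"
proof
  have "ipow I {} m u \<Longrightarrow> m = Suc n \<Longrightarrow> u \<in> I" for m
    by (induction rule: ipow.induct) (auto simp: ideal_ofD[OF I])
  then show "ipow I {} (Suc n) u \<Longrightarrow> u \<in> I" by blast
qed (rule ipow.base)

text \<open>A product of \<open>Suc n\<close> generators either avoids \<open>y\<close> or has a
  factor \<open>y\<close> that can be split off.\<close>

lemma ipow_insert_cases:
  assumes "ipow I (insert y X) (Suc n) u" and I: "ideal_of I" and X: "X \<subseteq> A" and y: "y \<in> A"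
  obtains v w where "u = v + y * w" "ipow I X (Suc n) v" "ipow I (insert y X) n w"
proof -
  have "\<exists>v w. u = v + y * w \<and> ipow I X (Suc n) v \<and> ipow I (insert y X) n w"
    if "ipow I (insert y X) m u" "m = Suc n" for m
    using that
  proof (induction arbitrary: n rule: ipow.induct)
    case (base u m)
    have "u = u + y * 0" by simp
    then show ?case using base ideal_ofD(2)[OF I] by (blast intro: ipow.base)
  next
    case (mult m u x)
    show ?case
    proof (cases "x = y")
      case True
      have "x * u = 0 + y * u" using True by simp
      then show ?thesis using mult ideal_ofD(2)[OF I] by (blast intro: ipow.base)
    next
      case False
      then have x: "x \<in> X" using mult by simp
      show ?thesis
      proof (cases m)
        case 0
        have "u \<in> A" using ipow_mem[OF I _ mult(1)] X y by auto
        moreover have "x * u = x * u + y * 0" by simp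
        ultimately show ?thesis using mult 0 x ideal_ofD(2)[OF I] by (blast intro: ipow.intros)
      next
        case (Suc k)
        then obtain v w where "u = v + y * w" "ipow I X (Suc k) v" "ipow I (insert y X) k w"
          using mult by blast
        moreover from this have "x * u = x * v + y * (x * w)" by (simp add: algebra_simps)
        ultimately show ?thesis using x mult Suc by (blast intro: ipow.mult)
      qed
    qed
  next
    case (add m u v)
    then obtain u1 u2 v1 v2 where *: "u = u1 + y * u2" "ipow I X (Suc n) u1" "ipow I (insert y X) n u2"
       "v = v1 + y * v2" "ipow I X (Suc n) v1" "ipow I (insert y X) n v2" by metis
    moreover have "u + v = (u1 + v1) + y * (u2 + v2)" by (simp add: * algebra_simps)
    ultimately show ?case by (blast intro: ipow.add)
  qed simp
  then show thesis using assms(1) that by blast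
qed

text \<open>Lifting from modulo \<open>x\<close> leaves a multiple of \<open>x\<close> whose
  cofactor \<open>w\<close> has no known order; the applications bound this order
  afterwards.\<close>

lemma ipow_adjoin_cases:
  assumes "ipow (adjoin I x) X n u" and I: "ideal_of I" and X: "X \<subseteq> A" and x: "x \<in> A"
  obtains w t where "u = x * w + t" "w \<in> A" "ipow I X n t"
proof -
  have "\<exists>w t. u = x * w + t \<and> w \<in> A \<and> ipow I X n t"
    using assms(1)
  proof (induction rule: ipow.induct)
    case (zero u)
    have "u = x * 0 + u" by simp
    then show ?case using zero zero_mem by (blast intro: ipow.zero)
  next
    case (base u n)
    then obtain i z where "u = x * z + i" "i \<in> I" "z \<in> A"
      by (metis adjoin_cases add.commute)
    then show ?case by (blast intro: ipow.base)
  next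
    case (mult n u y)
    then obtain w t where "u = x * w + t" "w \<in> A" "ipow I X n t" by blast
    moreover from this have "y * u = x * (y * w) + y * t" by (simp add: algebra_simps)
    ultimately show ?case using mult X by (blast intro: ipow.mult mult_mem)
  next
    case (add n u v)
    then obtain w t w' t' where *: "u = x * w + t" "w \<in> A" "ipow I X n t"
      "v = x * w' + t'" "w' \<in> A" "ipow I X n t'" by blast
    then have "u + v = x * (w + w') + (t + t')" by (simp add: algebra_simps)
    then show ?case using * by (blast intro: ipow.add add_mem)
  qed
  then show thesis using that by blast
qed

lemma ipow_insert_imp_adjoin:
  assumes "ipow I (insert x X) n u" and I: "ideal_of I" and X: "X \<subseteq> A" and x: "x \<in> A"
  shows "ipow (adjoin I x) X n u"
  using assms(1)
proof (induction rule: ipow.induct)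
  case (mult n u y)
  have "u \<in> A" using ipow_mem[OF I _ mult(1)] X x by auto
  then have "x * u \<in> adjoin I x" using adjoinI[of 0 I u x] ideal_ofD(2)[OF I] by simp
  then show ?case using mult by (auto intro: ipow.intros)
qed (use subset_adjoin[of I x] in \<open>auto intro: ipow.intros\<close>)

text \<open>Quasi-regularity comes in two halves that need each other: the last element is a
  nonzerodivisor modulo powers of the ideal of the others, and the first element raises the order by
  no more than one. In both, \<open>l\<close> is one less than the length of the whole sequence, and
  each half for \<open>Suc l\<close> uses both halves for \<open>l\<close>.\<close>

lemma reg_mod_ipow_aux:
  shows "\<forall>I xs y n w. length xs = l \<longrightarrow> ideal_of I \<longrightarrow> set xs \<subseteq> A \<longrightarrow> y \<in> A \<longrightarrow> reg_mod I (xs @ [y]) \<longrightarrow>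
           w \<in> A \<longrightarrow> ipow I (set xs) n (y * w) \<longrightarrow> ipow I (set xs) n w"
    and "\<forall>I x ys n z. length ys = l \<longrightarrow> ideal_of I \<longrightarrow> set ys \<subseteq> A \<longrightarrow> x \<in> A \<longrightarrow> reg_mod I (x # ys) \<longrightarrow>
           z \<in> A \<longrightarrow> ipow I (insert x (set ys)) (Suc n) (x * z) \<longrightarrow> ipow I (insert x (set ys)) n z"
proof (induction l)
  case 0
  {
    case 1
    show ?case
    proof clarsimp
      fix I y n w
      assume "ideal_of I" "\<forall>z\<in>A. y * z \<in> I \<longrightarrow> z \<in> I" "w \<in> A" "ipow I {} n (y * w)"
      then show "ipow I {} n w"
        by (cases n) (auto intro: ipow.zero simp: ipow_empty)
    qed
  next
    case 2
    show ?case
    proof clarsimp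
      fix I x n z
      assume I: "ideal_of I" and x: "x \<in> A" and r: "\<forall>z\<in>A. x * z \<in> I \<longrightarrow> z \<in> I" and z: "z \<in> A"
        and p: "ipow I {x} (Suc n) (x * z)"
      from ipow_insert_cases[OF p I _ x] obtain v w
        where vw: "x * z = v + x * w" "ipow I {} (Suc n) v" "ipow I {x} n w" by blast
      then have "v \<in> I" by (simp add: ipow_empty[OF I])
      then have "x * (z - w) \<in> I" using vw by (simp add: algebra_simps)
      moreover have "w \<in> A" using ipow_mem[OF I _ vw(3)] x by auto
      ultimately have "z - w \<in> I" using r z diff_mem by blast
      then have "ipow I {x} n ((z - w) + w)" using vw(3) by (blast intro: ipow.intros)
      then show "ipow I {x} n z" by simp
    qed
  }
next
  case (Suc l)
  note a = Suc(1)[rule_format] and b = Suc(2)[rule_format]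
  {
    case 1
    show ?case
    proof (intro allI impI)
      fix I xs y n w
      assume "length xs = Suc l" and I: "ideal_of I" and xsA: "set xs \<subseteq> A" and y: "y \<in> A"
        and r: "reg_mod I (xs @ [y])" and w: "w \<in> A" and p: "ipow I (set xs) n (y * w)"
      then obtain x xs' where xs: "xs = x # xs'" and l: "length xs' = l" by (cases xs) auto
      have x: "x \<in> A" and xs'A: "set xs' \<subseteq> A" using xs xsA by auto
      note I' = ideal_of_adjoin[OF I x]
      show "ipow I (set xs) n w"
        using w p
      proof (induction n arbitrary: w)
        case (Suc n)
        have "ipow (adjoin I x) (set xs') (Suc n) (y * w)"
          using ipow_insert_imp_adjoin[OF _ I xs'A x] Suc.prems xs by simp
        then have "ipow (adjoin I x) (set xs') (Suc n) w"
          using a[OF l I' xs'A y] r xs Suc.prems by simp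
        then obtain w' t where t: "w = x * w' + t" "w' \<in> A" "ipow I (set xs') (Suc n) t"
          by (rule ipow_adjoin_cases[OF _ I xs'A x])
        have t': "ipow I (set xs) (Suc n) t" using ipow_mono[OF t(3), of "set xs"] xs by auto
        \<comment> \<open>The remainder \<open>t\<close> already has the desired order. Subtracting
          it leaves a multiple of \<open>x\<close>, and cancelling \<open>x\<close> by the second
          half lowers the order to \<open>n\<close>, where the inner induction applies to
          \<open>w'\<close>.\<close>
        have "ipow I (set xs) (Suc n) (y * w - y * t)"
          by (intro ipow_diff[OF I xsA] ipow_smult[OF I xsA] t' y Suc.prems)
        also have "y * w - y * t = x * (y * w')" using t(1) by (simp add: algebra_simps)
        finally have "ipow I (set xs) n (y * w')"
          using b[OF l I xs'A x _ mult_mem[OF y t(2)]] reg_mod_append1[OF r] xs by simp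
        then have "ipow I (set xs) n w'" using Suc.IH t(2) by blast
        then have "ipow I (set xs) (Suc n) (x * w')" using xs by (auto intro: ipow.mult)
        then show ?case using t' t(1) by (simp add: ipow.add)
      qed (auto intro: ipow.zero)
    qed
  next
    case 2
    show ?case
    proof (intro allI impI)
      fix I x ys n z
      assume "length ys = Suc l" and I: "ideal_of I" and ysA: "set ys \<subseteq> A" and x: "x \<in> A"
        and r: "reg_mod I (x # ys)" and z: "z \<in> A" and p: "ipow I (insert x (set ys)) (Suc n) (x * z)"
      then obtain ys' y where ys: "ys = ys' @ [y]" and l: "length ys' = l"
        by (cases ys rule: rev_cases) auto
      let ?X = "insert x (set ys)" and ?X' = "insert x (set ys')"
      have y: "y \<in> A" and ys'A: "set ys' \<subseteq> A" using ys ysA by auto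
      have XA: "?X \<subseteq> A" "?X' \<subseteq> A" using x ysA ys'A by auto
      have X: "?X = insert y ?X'" using ys by auto
      note I' = ideal_of_adjoin[OF I x]
      show "ipow I ?X n z"
        using z p
      proof (induction n arbitrary: z)
        case (Suc n)
        from Suc.prems(2) obtain u v where uv: "x * z = u + y * v" "ipow I ?X' (Suc (Suc n)) u"
            "ipow I ?X (Suc n) v"
          unfolding X by (rule ipow_insert_cases[OF _ I XA(2) y])
        have v: "v \<in> A" using ipow_mem[OF I XA(1) uv(3)] .
        \<comment> \<open>Modulo \<open>x\<close> the product \<open>y * v\<close> equals
          \<open>- u\<close>, so \<open>y\<close> can be cancelled there and \<open>v\<close> is a
          multiple of \<open>x\<close> up to high order. Replacing \<open>z\<close> by
          \<open>z - y * v'\<close> then removes \<open>y\<close>, and the shorter sequence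
          \<open>x # ys'\<close> applies.\<close>
        have "x * z \<in> adjoin I x"
          using adjoinI[of 0 I z x] ideal_ofD(2)[OF I] Suc.prems by simp
        then have "ipow (adjoin I x) (set ys') (Suc (Suc n)) (x * z - u)"
          using ipow_insert_imp_adjoin[OF uv(2) I ys'A x]
          by (intro ipow_diff[OF I' ys'A]) (auto intro: ipow.base)
        also have "x * z - u = y * v" using uv(1) by simp
        finally have "ipow (adjoin I x) (set ys') (Suc (Suc n)) v"
          using a[OF l I' ys'A y _ v] r ys by simp
        then obtain v' t where t: "v = x * v' + t" "v' \<in> A" "ipow I (set ys') (Suc (Suc n)) t"
          by (rule ipow_adjoin_cases[OF _ I ys'A x])
        have t': "ipow I ?X' (Suc (Suc n)) t" using ipow_mono[OF t(3), of ?X'] by auto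
        have "ipow I ?X (Suc n) (v - t)"
          using ipow_antimono[OF I XA(1) ipow_mono[OF t', of ?X], of "Suc n"] X
          by (intro ipow_diff[OF I XA(1)] uv) auto
        then have v': "ipow I ?X n v'" using Suc.IH[of v'] t by simp
        have "ipow I ?X' (Suc (Suc n)) (u + y * t)"
          by (intro ipow.add uv ipow_smult[OF I XA(2)] t' y)
        also have "u + y * t = x * (z - y * v')"
          using uv(1) t(1) by (simp add: algebra_simps)
        finally have "ipow I ?X' (Suc n) (z - y * v')"
          using b[OF l I ys'A x] r ys reg_mod_append1[of "adjoin I x" ys' "[y]"]
            Suc.prems t(2) y by (simp add: diff_mem mult_mem)
        then have "ipow I ?X (Suc n) (z - y * v')" by (rule ipow_mono) (use X in auto)
        moreover have "ipow I ?X (Suc n) (y * v')" using v' X by (auto intro: ipow.mult)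
        ultimately have "ipow I ?X (Suc n) ((z - y * v') + y * v')" by (rule ipow.add)
        then show ?case by simp
      qed (auto intro: ipow.zero)
    qed
  }
qed

lemma reg_mod_ipow_cancel:
  assumes "ideal_of I" "set (x # xs) \<subseteq> A" "reg_mod I (x # xs)" "z \<in> A"
    and "ipow I (set (x # xs)) (Suc n) (x * z)"
  shows "ipow I (set (x # xs)) n z"
  using reg_mod_ipow_aux(2)[of "length xs"] assms by auto

text \<open>
  Every nonzero polynomial expression in \<open>xs\<close> with coefficients in a field of units \<open>U\<close> is of
  this form: factor out the maximal power of the first variable and recurse on the constant term.
\<close>

fun lead_forms :: "'a set \<Rightarrow> 'a list \<Rightarrow> 'a set" where
  "lead_forms U [] = U"
| "lead_forms U (x # xs) = {x ^ e * (g + x * h) | e g h. g \<in> lead_forms U xs \<and> h \<in> A}"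

context
  fixes U assumes U: "U \<subseteq> A" "1 \<in> U" and U_mult: "\<And>u v. u \<in> U \<Longrightarrow> v \<in> U \<Longrightarrow> u * v \<in> U"
    and U_inv: "\<And>u. u \<in> U \<Longrightarrow> \<exists>v\<in>A. v * u = 1"
begin

lemma lead_forms_mem: "set xs \<subseteq> A \<Longrightarrow> lead_forms U xs \<subseteq> A"
  using U by (induction xs) (auto intro!: mult_mem add_mem power_mem)

text \<open>The exponents \<open>e\<close> add and the constant terms \<open>g\<close> multiply.
  Closure under products is what allows a prime ideal to avoid the set.\<close>

lemma lead_forms_mult:
  "set xs \<subseteq> A \<Longrightarrow> f \<in> lead_forms U xs \<Longrightarrow> g \<in> lead_forms U xs \<Longrightarrow> f * g \<in> lead_forms U xs"
proof (induction xs arbitrary: f g)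
  case (Cons x xs)
  then obtain e u h e' u' h' where *: "f = x ^ e * (u + x * h)" "g = x ^ e' * (u' + x * h')"
    "u \<in> lead_forms U xs" "h \<in> A" "u' \<in> lead_forms U xs" "h' \<in> A"
    by auto
  have "u \<in> A" "u' \<in> A" "x \<in> A" using * lead_forms_mem[of xs] Cons.prems by auto
  then have "u * h' + h * u' + x * h * h' \<in> A" using * by (intro add_mem mult_mem)
  moreover have "f * g = x ^ (e + e') * (u * u' + x * (u * h' + h * u' + x * h * h'))"
    by (simp add: * algebra_simps power_add)
  moreover have "u * u' \<in> lead_forms U xs" using Cons * by auto
  ultimately show ?case unfolding lead_forms.simps by blast
qed (simp add: U_mult)

lemma lead_forms_one: "1 \<in> lead_forms U xs"
proof (induction xs)
  case (Cons x xs)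
  have "1 = x ^ 0 * (1 + x * 0)" by simp
  with Cons show ?case using zero_mem unfolding lead_forms.simps by blast
qed (simp add: U)

lemma lead_forms_power: "set xs \<subseteq> A \<Longrightarrow> f \<in> lead_forms U xs \<Longrightarrow> f ^ n \<in> lead_forms U xs"
  by (induction n) (simp_all add: lead_forms_one lead_forms_mult)

text \<open>
  Multiplication by \<open>f\<close> is injective for the adic topology in the strong sense that its inverse is
  continuous. The exact loss of order is irrelevant, which is why no induction on homogeneous
  forms is needed.
\<close>

lemma lead_forms_ipow_cancel:
  assumes "ideal_of I" "set xs \<subseteq> A" "reg_mod I xs" "f \<in> lead_forms U xs"
  shows "\<exists>m. \<forall>z\<in>A. ipow I (set xs) m (f * z) \<longrightarrow> ipow I (set xs) n z"
  using assms
proof (induction xs arbitrary: I f n)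
  case Nil
  then obtain v where v: "v \<in> A" "v * f = 1" using U_inv by auto
  have "\<forall>z\<in>A. ipow I {} n (f * z) \<longrightarrow> ipow I {} n z"
  proof safe
    fix z assume "z \<in> A" "ipow I {} n (f * z)"
    then have "ipow I {} n (v * (f * z))" 
      using ipow_smult[OF Nil(1) empty_subsetI _ v(1)] by blast
    then have "ipow I {} n (v * f * z)" by (simp only: mult.assoc)
    then show "ipow I {} n z" unfolding v(2) by simp
  qed
  then show ?case by auto
next
  case (Cons x xs)
  note I = Cons.prems(1)
  have x: "x \<in> A" and xsA: "set xs \<subseteq> A" using Cons.prems by auto
  note I' = ideal_of_adjoin[OF I x]
  let ?P = "ipow I (set (x # xs))"
  have XA: "set (x # xs) \<subseteq> A" using Cons.prems by auto
  from Cons.prems obtain e g h where f: "f = x ^ e * (g + x * h)" "g \<in> lead_forms U xs" "h \<in> A"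
    by auto
  have g: "g \<in> A" using lead_forms_mem[OF xsA] f by auto
  note cancel = reg_mod_ipow_cancel[OF I XA Cons.prems(3)]
  have cancel_power: "?P (k + n) (x ^ k * z) \<Longrightarrow> z \<in> A \<Longrightarrow> ?P n z" for k n z
  proof (induction k arbitrary: n)
    case (Suc k)
    have "?P (Suc (k + n)) (x * (x ^ k * z))" using Suc.prems by (simp add: mult.assoc)
    then have "?P (k + n) (x ^ k * z)"
      using cancel[OF mult_mem[OF power_mem[OF x] Suc.prems(2)]] by blast
    then show ?case using Suc by blast
  qed simp
  have main: "\<exists>m. \<forall>z\<in>A. ?P m ((g + x * h) * z) \<longrightarrow> ?P n z" for n
  proof (induction n)
    case (Suc n)
    then obtain m where m: "\<And>z. z \<in> A \<Longrightarrow> ?P m ((g + x * h) * z) \<Longrightarrow> ?P n z" by blast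
    \<comment> \<open>This order survives one cancellation of \<open>x\<close> with at least
      \<open>m\<close> left for \<open>z'\<close>, and being at least \<open>Suc n\<close> it also
      takes care of the remainder \<open>w\<close>.\<close>
    let ?k = "Suc (m + n)"
    from Cons.IH[OF I' xsA _ f(2), of ?k] Cons.prems obtain m'
      where m': "\<And>z. z \<in> A \<Longrightarrow> ipow (adjoin I x) (set xs) m' (g * z) \<Longrightarrow> ipow (adjoin I x) (set xs) ?k z"
      by auto
    have "?P (Suc n) z" if z: "z \<in> A" and p: "?P (m' + ?k) ((g + x * h) * z)" for z
    proof -
      have "ipow (adjoin I x) (set xs) m' ((g + x * h) * z)"
        using ipow_insert_imp_adjoin[OF _ I xsA x] ipow_antimono[OF I XA p, of m'] by simp
      moreover have "x * (h * z) \<in> adjoin I x"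
        using adjoinI[of 0 I "h * z" x] ideal_ofD(2)[OF I] f(3) z by (simp add: mult_mem)
      ultimately have "ipow (adjoin I x) (set xs) m' ((g + x * h) * z - x * (h * z))"
        by (intro ipow_diff[OF I' xsA]) (auto intro: ipow.base)
      then have "ipow (adjoin I x) (set xs) m' (g * z)" by (simp add: algebra_simps)
      then have "ipow (adjoin I x) (set xs) ?k z" using m' z by blast
      then obtain z' w where w: "z = x * z' + w" "z' \<in> A" "ipow I (set xs) ?k w"
        by (rule ipow_adjoin_cases[OF _ I xsA x])
      have w': "?P ?k w" using ipow_mono[OF w(3)] by auto
      have "?P ?k ((g + x * h) * z - (g + x * h) * w)"
        using x g f(3) by (intro ipow_diff[OF I XA] ipow_smult[OF I XA] w' ipow_antimono[OF I XA p])
          (auto intro: add_mem mult_mem)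
      also have "(g + x * h) * z - (g + x * h) * w = x * ((g + x * h) * z')"
        using w(1) by (simp add: algebra_simps)
      finally have "?P (m + n) ((g + x * h) * z')"
        using cancel[of "(g + x * h) * z'" "m + n"] x g f(3) w(2) by (simp add: add_mem mult_mem)
      then have "?P n z'" using m[OF w(2)] ipow_antimono[OF I XA, of "m + n" _ m] by simp
      then have "?P (Suc n) (x * z')" by (auto intro: ipow.mult)
      moreover have "?P (Suc n) w" using ipow_antimono[OF I XA w'] by simp
      ultimately show ?thesis unfolding w(1) by (rule ipow.add)
    qed
    then show ?case by blast
  qed (auto intro: ipow.zero)
  from main[of n] obtain m where m: "\<And>z. z \<in> A \<Longrightarrow> ?P m ((g + x * h) * z) \<Longrightarrow> ?P n z" by blast
  have "?P n z" if "z \<in> A" "?P (e + m) (f * z)" for z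
    using that m cancel_power[of e m "(g + x * h) * z"] x g f
    by (auto simp: mult.assoc intro!: add_mem mult_mem)
  then show ?case by blast
qed

text \<open>An element of \<open>I\<close> has infinite order, and cancelling \<open>f\<close>
  passes infinite order on to \<open>z\<close>.\<close>

lemma lead_forms_annihilator:
  assumes "ideal_of I" "set xs \<subseteq> A" "reg_mod I xs" "f \<in> lead_forms U xs" "z \<in> A" "f * z \<in> I"
  shows "ipow I (set xs) n z"
  using lead_forms_ipow_cancel[OF assms(1-4), of n] assms(5,6) by (blast intro: ipow.base)

end

end

section \<open>Primes avoiding a multiplicative set, and independence of characters modulo a
  prime\<close>

section \<open>Prime ideals\<close>

context subring_set
begin

definition prime_of :: "'a set \<Rightarrow> bool" where
  "prime_of P \<longleftrightarrow> ideal_of P \<and> 1 \<notin> P \<and> (\<forall>x\<in>A. \<forall>y\<in>A. x * y \<in> P \<longrightarrow> x \<in> P \<or> y \<in> P)"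

lemma prime_ofD:
  assumes "prime_of P"
  shows "ideal_of P" "1 \<notin> P" "\<And>x y. x \<in> A \<Longrightarrow> y \<in> A \<Longrightarrow> x * y \<in> P \<Longrightarrow> x \<in> P \<or> y \<in> P"
  using assms by (auto simp: prime_of_def)

lemma prime_of_prod:
  assumes "prime_of P" "finite J" "\<And>i. i \<in> J \<Longrightarrow> f i \<in> A" "prod f J \<in> P"
  shows "\<exists>i\<in>J. f i \<in> P"
  using assms(2,3,4)
proof (induction J rule: finite_induct)
  case (insert j J)
  then have "f j \<in> P \<or> prod f J \<in> P"
    using prime_ofD(3)[OF assms(1), of "f j" "prod f J"] prod_mem[of J f] by auto
  then show ?case using insert by auto
qed (use prime_ofD(2)[OF assms(1)] in auto)

text \<open>Zorn's lemma gives an ideal \<open>P\<close> maximal among those that contain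
  \<open>J\<close> and miss \<open>D\<close>. If \<open>x\<close> and \<open>y\<close> are outside
  \<open>P\<close>, enlarging \<open>P\<close> by either one meets \<open>D\<close>; the product of
  the two elements found would lie in \<open>P\<close> as soon as \<open>x * y\<close> does.\<close>

lemma ex_prime_avoiding:
  assumes J: "ideal_of J" and D: "D \<subseteq> A" "1 \<in> D" and D_mult: "\<And>x y. x \<in> D \<Longrightarrow> y \<in> D \<Longrightarrow> x * y \<in> D"
    and disj: "D \<inter> J = {}"
  shows "\<exists>P. prime_of P \<and> J \<subseteq> P \<and> D \<inter> P = {}"
proof -
  let ?C = "{I. ideal_of I \<and> J \<subseteq> I \<and> D \<inter> I = {}}"
  have "\<exists>P\<in>?C. \<forall>I\<in>?C. P \<subseteq> I \<longrightarrow> I = P"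
  proof (rule subset_Zorn_nonempty)
    show "?C \<noteq> {}" using J disj by auto
    fix \<C> assume ne: "\<C> \<noteq> {}" and chain: "subset.chain ?C \<C>"
    then have sub: "\<And>I. I \<in> \<C> \<Longrightarrow> ideal_of I \<and> J \<subseteq> I \<and> D \<inter> I = {}"
      and tot: "\<And>I I'. I \<in> \<C> \<Longrightarrow> I' \<in> \<C> \<Longrightarrow> I \<subseteq> I' \<or> I' \<subseteq> I"
      by (auto simp: subset_chain_def)
    have "ideal_of (\<Union>\<C>)"
      unfolding ideal_of_def
    proof (intro conjI ballI)
      show "\<Union>\<C> \<subseteq> A" using sub ideal_ofD(1) by blast
      show "0 \<in> \<Union>\<C>" using ne sub ideal_ofD(2) by blast
      fix x y assume "x \<in> \<Union>\<C>" "y \<in> \<Union>\<C>"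
      then obtain I I' where "x \<in> I" "I \<in> \<C>" "y \<in> I'" "I' \<in> \<C>" by blast
      with tot obtain I'' where "I'' \<in> \<C>" "x \<in> I''" "y \<in> I''" by blast
      then show "x + y \<in> \<Union>\<C>" using sub ideal_ofD(3) by blast
    next
      fix x y assume "x \<in> A" "y \<in> \<Union>\<C>"
      then show "x * y \<in> \<Union>\<C>" using sub ideal_ofD(4) by blast
    qed
    then show "\<Union>\<C> \<in> ?C" using ne sub by blast
  qed
  then obtain P where P: "ideal_of P" "J \<subseteq> P" "D \<inter> P = {}"
    and max: "\<And>I. ideal_of I \<Longrightarrow> J \<subseteq> I \<Longrightarrow> D \<inter> I = {} \<Longrightarrow> P \<subseteq> I \<Longrightarrow> I = P" by auto
  have meets: "\<exists>d\<in>D. d \<in> adjoin P x" if "x \<in> A" "x \<notin> P" for x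
    using max[of "adjoin P x"] ideal_of_adjoin[OF P(1)] subset_adjoin[of P x] mem_adjoin[OF P(1), of x] that P(2)
    by blast
  have "x \<in> P \<or> y \<in> P" if xy: "x \<in> A" "y \<in> A" "x * y \<in> P" for x y
  proof (rule ccontr)
    assume "\<not> (x \<in> P \<or> y \<in> P)"
    then obtain d e where de: "d \<in> D" "d \<in> adjoin P x" "e \<in> D" "e \<in> adjoin P y"
      using meets xy by blast
    then obtain i z j w where *: "d = i + x * z" "i \<in> P" "z \<in> A" "e = j + y * w" "j \<in> P" "w \<in> A"
      by (auto simp: adjoin_def)
    have "d * e = i * e + (x * z) * j + (z * w) * (x * y)"
      by (simp add: * algebra_simps)
    also have "\<dots> \<in> P"
    proof (intro ideal_ofD(3)[OF P(1)])
      show "i * e \<in> P" using * de(3) D(1) by (intro ideal_ofD(5)[OF P(1)]) auto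
      show "x * z * j \<in> P" "z * w * (x * y) \<in> P"
        using * xy ideal_ofD(4)[OF P(1) mult_mem] by auto
    qed
    finally show False using D_mult[OF de(1,3)] P(3) by blast
  qed
  moreover have "1 \<notin> P" using D P by blast
  ultimately show ?thesis using P by (auto simp: prime_of_def)
qed

text \<open>Artin's argument: comparing the relation at \<open>z * y\<close> with
  \<open>\<chi> i z\<close> times the relation at \<open>y\<close> cancels the term of
  \<open>i\<close>. Coefficients that fall into \<open>P\<close> are dropped, so the shorter
  relation again has all its coefficients outside \<open>P\<close>.\<close>

lemma dedekind_independence_mod_prime:
  assumes P: "prime_of P" and X: "finite X" "X \<noteq> {}"
    and T: "1 \<in> T" "\<And>x y. x \<in> T \<Longrightarrow> y \<in> T \<Longrightarrow> x * y \<in> T"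
    and \<chi>: "\<And>i x. i \<in> X \<Longrightarrow> x \<in> T \<Longrightarrow> \<chi> i x \<in> A" "\<And>i. i \<in> X \<Longrightarrow> \<chi> i 1 = 1"
      "\<And>i x y. i \<in> X \<Longrightarrow> x \<in> T \<Longrightarrow> y \<in> T \<Longrightarrow> \<chi> i (x * y) = \<chi> i x * \<chi> i y"
    and c: "\<And>i. i \<in> X \<Longrightarrow> c i \<in> A" "\<And>i. i \<in> X \<Longrightarrow> c i \<notin> P"
    and rel: "\<And>y. y \<in> T \<Longrightarrow> (\<Sum>i\<in>X. c i * \<chi> i y) \<in> P"
  shows "\<exists>i\<in>X. \<exists>j\<in>X. i \<noteq> j \<and> (\<forall>y\<in>T. \<chi> i y - \<chi> j y \<in> P)"
  using X \<chi> c rel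
proof (induction "card X" arbitrary: X c rule: less_induct)
  case less
  note PI = prime_ofD(1)[OF P]
  obtain i where i: "i \<in> X" using less by auto
  show ?case
  proof (cases "X = {i}")
    case True
    then have "c i \<in> P" using less.prems(8)[OF T(1)] less.prems(4) by simp
    then show ?thesis using less.prems(7)[OF i] by blast
  next
    case False
    then obtain j where j: "j \<in> X" "j \<noteq> i" using i by blast
    show ?thesis
    proof (rule ccontr)
      assume contra: "\<not> ?thesis"
      \<comment> \<open>As \<open>z\<close> separates \<open>j\<close> from \<open>i\<close> modulo
        \<open>P\<close>, the index \<open>j\<close> survives in the new relation while
        \<open>i\<close> disappears.\<close>
      then obtain z where z: "z \<in> T" "\<chi> j z - \<chi> i z \<notin> P" using i j by blast
      define c' where "c' l = c l * (\<chi> l z - \<chi> i z)" for l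
      have c'A: "c' l \<in> A" if "l \<in> X" for l
        unfolding c'_def using that i z less.prems by (intro mult_mem diff_mem) auto
      define X' where "X' = {l \<in> X. c' l \<notin> P}"
      have "i \<notin> X'" using ideal_ofD(2)[OF PI] by (simp add: X'_def c'_def)
      then have "X' \<subset> X" using i X'_def by auto
      have "c' j \<notin> P"
        using prime_ofD(3)[OF P less.prems(6)[OF j(1)] diff_mem[OF less.prems(3)[OF j(1) z(1)]
          less.prems(3)[OF i z(1)]]] less.prems(7)[OF j(1)] z(2) by (auto simp: c'_def)
      then have "j \<in> X'" using j by (simp add: X'_def)
      have rel': "(\<Sum>l\<in>X'. c' l * \<chi> l y) \<in> P" if y: "y \<in> T" for y
      proof -
        have "(\<Sum>l\<in>X'. c' l * \<chi> l y) = (\<Sum>l\<in>X. c' l * \<chi> l y) - (\<Sum>l\<in>X - X'. c' l * \<chi> l y)"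
          using sum.subset_diff[of X' X "\<lambda>l. c' l * \<chi> l y"] \<open>X' \<subset> X\<close> less.prems(1) by auto
        also have "(\<Sum>l\<in>X. c' l * \<chi> l y) = (\<Sum>l\<in>X. c l * \<chi> l (z * y)) - \<chi> i z * (\<Sum>l\<in>X. c l * \<chi> l y)"
          by (auto simp: c'_def algebra_simps sum_distrib_left less.prems z y simp flip: sum_subtractf
              intro!: sum.cong)
        also have "\<dots> - (\<Sum>l\<in>X - X'. c' l * \<chi> l y) \<in> P"
          using z y i less.prems(3)
          by (intro ideal_of_diff[OF PI] ideal_of_sum[OF PI] ideal_ofD(4)[OF PI] ideal_ofD(5)[OF PI] less.prems(8) T)
            (auto simp: X'_def)
        finally show ?thesis .
      qed
      have "\<exists>i\<in>X'. \<exists>j\<in>X'. i \<noteq> j \<and> (\<forall>y\<in>T. \<chi> i y - \<chi> j y \<in> P)"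
      proof (rule less.hyps)
        show "card X' < card X" using psubset_card_mono[OF less.prems(1) \<open>X' \<subset> X\<close>] .
        show "finite X'" using \<open>X' \<subset> X\<close> less.prems(1) by (meson finite_subset psubset_imp_subset)
        show "X' \<noteq> {}" using \<open>j \<in> X'\<close> by blast
      qed (use \<open>X' \<subset> X\<close> less.prems(3-5) c'A rel' in \<open>auto simp: X'_def\<close>)
      then show False using contra \<open>X' \<subset> X\<close> by blast
    qed
  qed
qed

text \<open>Over an infinite field, finitely many proper subspaces do not cover the space. Here
  \<open>C\<close> plays the field and each \<open>h\<close> cuts out the subspace where
  \<open>g h x\<close> lies in \<open>P\<close>. If \<open>v\<close> avoids the old subspaces and
  \<open>w\<close> the new one, each of them contains at most one point
  \<open>v + c * w\<close>.\<close>

lemma avoid_finitely_many_subspaces: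
  assumes P: "prime_of P" and C: "infinite C" "C \<subseteq> A"
    and C_unit: "\<And>c d. c \<in> C \<Longrightarrow> d \<in> C \<Longrightarrow> c \<noteq> d \<Longrightarrow> \<exists>u\<in>A. u * (c - d) = 1"
    and H: "finite H"
    and g: "\<And>h x. h \<in> H \<Longrightarrow> x \<in> A \<Longrightarrow> g h x \<in> A"
      "\<And>h x y. h \<in> H \<Longrightarrow> x \<in> A \<Longrightarrow> y \<in> A \<Longrightarrow> g h (x + y) = g h x + g h y"
      "\<And>h x c. h \<in> H \<Longrightarrow> c \<in> C \<Longrightarrow> x \<in> A \<Longrightarrow> g h (c * x) = c * g h x"
    and ex: "\<And>h. h \<in> H \<Longrightarrow> \<exists>x\<in>A. g h x \<notin> P"
  shows "\<exists>x\<in>A. \<forall>h\<in>H. g h x \<notin> P"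
  using H g ex
proof (induction H rule: finite_induct)
  case empty
  then show ?case using zero_mem by auto
next
  case (insert h H)
  note PI = prime_ofD(1)[OF P]
  have "\<exists>v\<in>A. \<forall>h\<in>H. g h v \<notin> P" by (rule insert.IH) (use insert.prems in auto)
  then obtain v where v: "v \<in> A" "\<forall>h\<in>H. g h v \<notin> P" by blast
  obtain w where w: "w \<in> A" "g h w \<notin> P" using insert.prems(4) by auto
  define bad where "bad l = {c \<in> C. g l (v + c * w) \<in> P}" for l
  have sub: "c = d" if l: "l \<in> insert h H" and cd: "c \<in> bad l" "d \<in> bad l" for l c d
  proof (rule ccontr)
    assume "c \<noteq> d"
    have cdC: "c \<in> C" "d \<in> C" using cd by (auto simp: bad_def)
    then obtain u where u: "u \<in> A" "u * (c - d) = 1" using C_unit \<open>c \<noteq> d\<close> by blast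
    have eq: "g l (v + e * w) = g l v + e * g l w" if "e \<in> C" for e
      using insert.prems(2)[OF l v(1), of "e * w"] insert.prems(3)[OF l that w(1)] that C(2) w(1)
      by (auto intro: mult_mem)
    have "g l (v + c * w) - g l (v + d * w) \<in> P"
      using cd by (intro ideal_of_diff[OF PI]) (auto simp: bad_def)
    then have "u * ((c - d) * g l w) \<in> P"
      using eq[OF cdC(1)] eq[OF cdC(2)] ideal_ofD(4)[OF PI u(1)] by (simp add: left_diff_distrib)
    also have "u * ((c - d) * g l w) = g l w" using u(2) by (simp flip: mult.assoc)
    finally have lw: "g l w \<in> P" .
    then have "l \<in> H" using l w(2) by auto
    have "g l (v + c * w) - c * g l w \<in> P"
      using cd cdC C(2) lw by (intro ideal_of_diff[OF PI] ideal_ofD(4)[OF PI]) (auto simp: bad_def)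
    then have "g l v \<in> P" using eq[OF cdC(1)] by simp
    then show False using v(2) \<open>l \<in> H\<close> by blast
  qed
  have "finite (bad l)" if "l \<in> insert h H" for l
  proof (cases "bad l = {}")
    case False
    then obtain c where "c \<in> bad l" by blast
    then have "bad l \<subseteq> {c}" using sub[OF that] by blast
    then show ?thesis by (rule finite_subset) simp
  qed simp
  then have "finite (\<Union>l\<in>insert h H. bad l)" using insert.hyps(1) by blast
  then obtain c where "c \<in> C" "c \<notin> (\<Union>l\<in>insert h H. bad l)"
    using C(1) by (meson finite_subset subsetI)
  then have "v + c * w \<in> A" "\<forall>l\<in>insert h H. g l (v + c * w) \<notin> P"
    using v(1) w(1) C(2) by (auto simp: bad_def intro!: add_mem mult_mem)
  then show ?case by blast
qed

end

section \<open>Norms, and the prime ideals that contain a relative transfer\<close>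

section \<open>Actions of cyclic groups\<close>

text \<open>The subgroups of a cyclic group of order \<open>p ^ r\<close> form a chain: the one
  generated by \<open>e\<close> is not contained in the one generated by \<open>p ^ b\<close>, so it
  contains \<open>p ^ (b - 1)\<close>.\<close>

lemma ex_multiple_cong_prime_power:
  fixes p b r e :: nat
  assumes "prime p" "0 < b" "b \<le> r" "\<not> p ^ b dvd e"
  shows "\<exists>t. [e * t = p ^ (b - 1)] (mod p ^ r)"
proof -
  obtain c where c: "c \<le> r" "gcd e (p ^ r) = p ^ c"
    using divides_primepow_nat[OF assms(1)] by (metis gcd_dvd2)
  have "c < b"
  proof (rule ccontr)
    assume "\<not> c < b"
    then have "p ^ b dvd p ^ c" by (simp add: le_imp_power_dvd)
    then show False using c(2) assms(4) by (metis dvd_trans gcd_dvd1)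
  qed
  obtain x where "[e * x = p ^ c] (mod p ^ r)"
    using cong_solve_nat[of e "p ^ r"] c by auto
  then have "[e * x * p ^ (b - 1 - c) = p ^ c * p ^ (b - 1 - c)] (mod p ^ r)"
    by (rule cong_scalar_right)
  also have "p ^ c * p ^ (b - 1 - c) = p ^ (b - 1)" using \<open>c < b\<close> by (simp flip: power_add)
  finally show ?thesis by (metis mult.assoc)
qed

text \<open>The map is a ring endomorphism of the whole type but periodic only on \<open>S\<close>,
  just as the action on polynomials is controlled only for variables from the chosen basis. The
  period \<open>q\<close> may exceed the order.\<close>

locale cyclic_action = subring_set S for S :: "'a::comm_ring_1 set" +
  fixes \<sigma> :: "'a \<Rightarrow> 'a" and q :: nat
  assumes hom_zero: "\<sigma> 0 = 0" and hom_one: "\<sigma> 1 = 1"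
    and hom_add: "\<sigma> (x + y) = \<sigma> x + \<sigma> y" and hom_mult: "\<sigma> (x * y) = \<sigma> x * \<sigma> y"
    and closed: "x \<in> S \<Longrightarrow> \<sigma> x \<in> S"
    and period_pos: "0 < q" and period: "x \<in> S \<Longrightarrow> (\<sigma> ^^ q) x = x"
begin

lemma pow_hom:
  "(\<sigma> ^^ i) 0 = 0" "(\<sigma> ^^ i) 1 = 1" "(\<sigma> ^^ i) (x + y) = (\<sigma> ^^ i) x + (\<sigma> ^^ i) y"
  "(\<sigma> ^^ i) (x * y) = (\<sigma> ^^ i) x * (\<sigma> ^^ i) y"
  by (induction i) (simp_all add: hom_zero hom_one hom_add hom_mult)

lemma pow_uminus: "(\<sigma> ^^ i) (- x) = - (\<sigma> ^^ i) x"
  using pow_hom(3)[of i x "- x"] by (simp add: pow_hom(1) eq_neg_iff_add_eq_0 add.commute)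

lemma pow_sum: "(\<sigma> ^^ i) (sum f J) = (\<Sum>j\<in>J. (\<sigma> ^^ i) (f j))"
  by (induction J rule: infinite_finite_induct) (simp_all add: pow_hom)

lemma pow_prod: "(\<sigma> ^^ i) (prod f J) = (\<Prod>j\<in>J. (\<sigma> ^^ i) (f j))"
  by (induction J rule: infinite_finite_induct) (simp_all add: pow_hom)

lemma pow_closed: "x \<in> S \<Longrightarrow> (\<sigma> ^^ i) x \<in> S"
  by (induction i) (simp_all add: closed)

lemma pow_period_mult: "x \<in> S \<Longrightarrow> (\<sigma> ^^ (q * i)) x = x"
  by (induction i) (simp_all add: funpow_add period)

lemma pow_cong:
  assumes "[i = j] (mod q)" "x \<in> S" shows "(\<sigma> ^^ i) x = (\<sigma> ^^ j) x"
proof -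
  have "(\<sigma> ^^ i) x = (\<sigma> ^^ (i mod q)) x" for i
  proof -
    have "(\<sigma> ^^ i) x = (\<sigma> ^^ (i mod q + q * (i div q))) x" by simp
    then show ?thesis
      unfolding funpow_add by (simp add: pow_period_mult[OF assms(2)] del: mod_mult_div_eq)
  qed
  then show ?thesis using assms(1) by (metis cong_def)
qed

definition fixed :: "nat \<Rightarrow> 'a set" where
  "fixed m = {x \<in> S. (\<sigma> ^^ m) x = x}"

lemma subring_fixed: "subring_set (fixed m)"
  by unfold_locales
    (auto simp: fixed_def zero_mem one_mem add_mem mult_mem uminus_mem pow_hom pow_uminus)

lemma fixed_mult: "x \<in> fixed m \<Longrightarrow> x \<in> fixed (m * n)"
  unfolding fixed_def by (induction n) (simp_all add: funpow_add)

abbreviation invs :: "'a set" where "invs \<equiv> fixed 1"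

lemma invs_pow: "x \<in> invs \<Longrightarrow> (\<sigma> ^^ i) x = x"
  using fixed_mult[of x 1 i] by (simp add: fixed_def)

sublocale invs: subring_set invs
  by (rule subring_fixed)

text \<open>The ideal that \<open>J\<close> generates in \<open>S\<close>; in the application
  \<open>J\<close> is an ideal of the invariants only.\<close>

inductive_set ext_ideal :: "'a set \<Rightarrow> 'a set" for J where
  zero: "0 \<in> ext_ideal J"
| add: "u \<in> ext_ideal J \<Longrightarrow> s \<in> S \<Longrightarrow> t \<in> J \<Longrightarrow> u + s * t \<in> ext_ideal J"

lemma ideal_of_ext_ideal:
  assumes "J \<subseteq> S" shows "ideal_of (ext_ideal J)"
  unfolding ideal_of_def
proof (intro conjI ballI subsetI)
  show "u \<in> S" if "u \<in> ext_ideal J" for u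
    using that by induction (use assms in \<open>auto simp: zero_mem intro!: add_mem mult_mem\<close>)
  fix u v assume u: "u \<in> ext_ideal J"
  show "u + v \<in> ext_ideal J" if "v \<in> ext_ideal J"
    using that by induction (use u ext_ideal.add in \<open>auto simp flip: add.assoc\<close>)
next
  fix a u assume a: "a \<in> S" and "u \<in> ext_ideal J"
  from this(2) show "a * u \<in> ext_ideal J"
    by induction (use a ext_ideal.add[of _ J "a * _"] in \<open>auto simp: distrib_left mult.assoc[symmetric] ext_ideal.zero mult_mem\<close>)
qed (rule ext_ideal.zero)

lemma ext_ideal_cases_sum:
  assumes "u \<in> ext_ideal J"
  shows "\<exists>n s t. u = (\<Sum>k<(n::nat). s k * t k) \<and> (\<forall>k<n. s k \<in> S \<and> t k \<in> J)"
  using assms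
proof induction
  case zero
  show ?case by (intro exI[of _ 0]) simp
next
  case (add u a b)
  then obtain n s t where "u = (\<Sum>k<(n::nat). s k * t k)" "\<forall>k<n. s k \<in> S \<and> t k \<in> J" by blast
  then show ?case
    using add by (intro exI[of _ "Suc n"] exI[of _ "s(n := a)"] exI[of _ "t(n := b)"]) (auto simp: less_Suc_eq)
qed

lemma ext_ideal_subset: "1 \<in> S \<Longrightarrow> J \<subseteq> ext_ideal J"
  using ext_ideal.add[OF ext_ideal.zero, of 1] by auto

text \<open>
  The norm of \<open>\<Sum>k. s k * t k\<close> is a form of degree \<open>q\<close> in the \<open>t k\<close> whose coefficients are
  invariant, since \<open>\<sigma>\<close> permutes the terms belonging to a fixed monomial cyclically.
\<close>

lemma invariant_in_ext_ideal_power: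
  assumes J: "invs.ideal_of J" and f: "f \<in> invs" "f \<in> ext_ideal J"
  shows "f ^ q \<in> J"
proof -
  obtain n s t where fsum: "f = (\<Sum>k<(n::nat). s k * t k)" and st: "\<And>k. k < n \<Longrightarrow> s k \<in> S" "\<And>k. k < n \<Longrightarrow> t k \<in> J"
    using ext_ideal_cases_sum[OF f(2)] by blast
  have tinv: "\<And>k. k < n \<Longrightarrow> t k \<in> invs" using st invs.ideal_ofD(1)[OF J] by blast
  \<comment> \<open>A function in \<open>\<Phi>\<close> chooses one summand from each factor of the
    norm. \<open>cnt\<close> records the resulting monomial in the \<open>t k\<close>,
    \<open>coef\<close> its coefficient, and \<open>\<rho>\<close> rotates the choices cyclically,
    with inverse \<open>\<rho>'\<close>.\<close>
  define \<Phi> where "\<Phi> = PiE {..<q} (\<lambda>_. {..<n})"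
  have \<Phi>D: "\<phi> i < n" if "\<phi> \<in> \<Phi>" "i < q" for \<phi> i using that by (auto simp: \<Phi>_def)
  define cnt where "cnt \<phi> = image_mset \<phi> (mset_set {..<q})" for \<phi> :: "nat \<Rightarrow> nat"
  define coef where "coef \<phi> = (\<Prod>i<q. (\<sigma> ^^ i) (s (\<phi> i)))" for \<phi>
  define pre where "pre i = (if i = 0 then q - 1 else i - 1)" for i
  define suc where "suc i = (if i = q - 1 then 0 else Suc i)" for i
  define \<rho> where "\<rho> \<phi> = (\<lambda>i\<in>{..<q}. \<phi> (pre i))" for \<phi> :: "nat \<Rightarrow> nat"
  define \<rho>' where "\<rho>' \<phi> = (\<lambda>i\<in>{..<q}. \<phi> (suc i))" for \<phi> :: "nat \<Rightarrow> nat"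
  have ps: "pre i < q" "suc i < q" "suc (pre i) = i" "pre (suc i) = i" if "i < q" for i
    using that period_pos by (auto simp: pre_def suc_def)
  have bij: "bij_betw pre {..<q} {..<q}" "bij_betw suc {..<q} {..<q}"
    by (intro bij_betw_byWitness[where f'=suc] bij_betw_byWitness[where f'=pre]; use ps in auto)+
  have \<rho>\<Phi>: "\<rho> \<phi> \<in> \<Phi>" "\<rho>' \<phi> \<in> \<Phi>" if "\<phi> \<in> \<Phi>" for \<phi>
    using \<Phi>D[OF that] ps unfolding \<Phi>_def \<rho>_def \<rho>'_def by auto
  have inv: "\<rho>' (\<rho> \<phi>) = \<phi>" "\<rho> (\<rho>' \<phi>) = \<phi>" if "\<phi> \<in> \<Phi>" for \<phi>
    using that by (auto simp: \<rho>_def \<rho>'_def \<Phi>_def ps PiE_def extensional_def restrict_def fun_eq_iff)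
  have cnt_comp: "cnt (\<lambda>i\<in>{..<q}. \<phi> (h i)) = cnt \<phi>" if "bij_betw h {..<q} {..<q}" for \<phi> h
  proof -
    have "cnt (\<lambda>i\<in>{..<q}. \<phi> (h i)) = image_mset \<phi> (image_mset h (mset_set {..<q}))"
      unfolding cnt_def multiset.map_comp by (intro image_mset_cong) auto
    also have "image_mset h (mset_set {..<q}) = mset_set {..<q}"
      using that by (simp add: image_mset_mset_set bij_betw_def)
    finally show ?thesis by (simp only: cnt_def)
  qed
  have cnt\<rho>: "cnt (\<rho> \<phi>) = cnt \<phi>" "cnt (\<rho>' \<phi>) = cnt \<phi>" for \<phi>
    unfolding \<rho>_def \<rho>'_def by (rule cnt_comp bij)+
  have coef\<rho>: "coef (\<rho> \<phi>) = \<sigma> (coef \<phi>)" if "\<phi> \<in> \<Phi>" for \<phi>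
  proof -
    have "\<sigma> (coef \<phi>) = (\<Prod>i<q. (\<sigma> ^^ Suc i) (s (\<phi> i)))"
      using pow_prod[of 1] by (simp add: coef_def)
    also have "\<dots> = (\<Prod>i<q. (\<sigma> ^^ Suc (pre i)) (s (\<phi> (pre i))))"
      by (rule prod.reindex_bij_betw[OF bij(1), symmetric])
    also have "\<dots> = coef (\<rho> \<phi>)"
      unfolding coef_def
    proof (rule prod.cong)
      fix i assume "i \<in> {..<q}"
      then have "i < q" by simp
      \<comment> \<open>Only \<open>i = 0\<close> wraps around: there \<open>Suc (pre i)\<close> is
        \<open>q\<close>, and the period turns this power into the identity.\<close>
      show "(\<sigma> ^^ Suc (pre i)) (s (\<phi> (pre i))) = (\<sigma> ^^ i) (s (\<rho> \<phi> i))"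
        using \<open>i < q\<close> period[OF st(1)[OF \<Phi>D[OF that ps(1)[OF \<open>i < q\<close>]]]]
        by (cases i; cases q) (auto simp: pre_def \<rho>_def)
    qed simp
    finally show ?thesis by simp
  qed
  have coefS: "coef \<phi> \<in> S" if "\<phi> \<in> \<Phi>" for \<phi>
    unfolding coef_def using \<Phi>D[OF that] by (intro prod_mem pow_closed st) auto
  have fin: "finite \<Phi>" unfolding \<Phi>_def by (intro finite_PiE) auto
  have term_mem: "(\<Sum>\<phi>\<in>{\<phi> \<in> \<Phi>. cnt \<phi> = m}. \<Prod>i<q. (\<sigma> ^^ i) (s (\<phi> i)) * t (\<phi> i)) \<in> J"
    if m: "m \<in> cnt ` \<Phi>" for m
  proof -
    obtain \<phi>0 where \<phi>0: "\<phi>0 \<in> \<Phi>" "m = cnt \<phi>0" using m by blast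
    let ?F = "{\<phi> \<in> \<Phi>. cnt \<phi> = m}"
    have tprod: "(\<Prod>i<q. t (\<phi> i)) = prod_mset (image_mset t m)" if "\<phi> \<in> ?F" for \<phi>
    proof -
      have "(\<Prod>i<q. t (\<phi> i)) = prod_mset (image_mset t (cnt \<phi>))"
        unfolding cnt_def by (simp add: prod_unfold_prod_mset multiset.map_comp comp_def)
      then show ?thesis using that by simp
    qed
    have "(\<Sum>\<phi>\<in>?F. \<Prod>i<q. (\<sigma> ^^ i) (s (\<phi> i)) * t (\<phi> i)) = (\<Sum>\<phi>\<in>?F. coef \<phi>) * prod_mset (image_mset t m)"
      unfolding sum_distrib_right by (intro sum.cong refl) (simp only: prod.distrib tprod coef_def)
    moreover have "(\<Sum>\<phi>\<in>?F. coef \<phi>) \<in> invs"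
    proof -
      have "\<sigma> (\<Sum>\<phi>\<in>?F. coef \<phi>) = (\<Sum>\<phi>\<in>?F. coef (\<rho> \<phi>))"
        using pow_sum[of 1 coef ?F] by (simp add: coef\<rho>)
      also have "\<dots> = (\<Sum>\<phi>\<in>?F. coef \<phi>)"
        by (rule sum.reindex_bij_witness[of _ \<rho>' \<rho>]) (auto simp: inv \<rho>\<Phi> cnt\<rho>)
      finally show ?thesis using coefS by (auto simp: fixed_def intro!: sum_mem)
    qed
    moreover have "prod_mset (image_mset t m) \<in> J"
    proof -
      \<comment> \<open>As \<open>q\<close> is positive, the monomial has at least one factor, which
        lies in \<open>J\<close>; the others are merely invariant.\<close>
      have "{..<q} = insert 0 {1..<q}" using period_pos by auto
      then have "(\<Prod>i<q. t (\<phi>0 i)) = t (\<phi>0 0) * (\<Prod>i\<in>{1..<q}. t (\<phi>0 i))" by simp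
      also have "\<dots> \<in> J"
        using \<Phi>D[OF \<phi>0(1)] period_pos
        by (intro invs.ideal_ofD(5)[OF J] invs.prod_mem tinv st) auto
      finally show ?thesis using tprod[of \<phi>0] \<phi>0 by simp
    qed
    ultimately show ?thesis using invs.ideal_ofD(4)[OF J] by simp
  qed
  \<comment> \<open>For an invariant \<open>f\<close> the norm is the power
    \<open>f ^ q\<close>.\<close>
  have "f ^ q = (\<Prod>i<q. (\<sigma> ^^ i) f)" using invs_pow[OF f(1)] by simp
  also have "\<dots> = (\<Prod>i<q. \<Sum>k<n. (\<sigma> ^^ i) (s k) * t k)"
    unfolding fsum pow_sum pow_hom using invs_pow[OF tinv] by simp
  also have "\<dots> = (\<Sum>\<phi>\<in>\<Phi>. \<Prod>i<q. (\<sigma> ^^ i) (s (\<phi> i)) * t (\<phi> i))"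
    unfolding \<Phi>_def by (rule prod_sum_PiE) auto
  also have "\<dots> = (\<Sum>m\<in>cnt ` \<Phi>. \<Sum>\<phi>\<in>{\<phi> \<in> \<Phi>. cnt \<phi> = m}. \<Prod>i<q. (\<sigma> ^^ i) (s (\<phi> i)) * t (\<phi> i))"
    by (rule sum.image_gen[OF fin])
  also have "\<dots> \<in> J" by (rule invs.ideal_of_sum[OF J]) (rule term_mem)
  finally show ?thesis .
qed

lemma coeff_map_poly_hom: "coeff (map_poly (\<sigma> ^^ i) g) k = (\<sigma> ^^ i) (coeff g k)"
  by (simp add: coeff_map_poly pow_hom)

lemma map_poly_hom_mult: "map_poly (\<sigma> ^^ i) (f * g) = map_poly (\<sigma> ^^ i) f * map_poly (\<sigma> ^^ i) g"
  by (rule poly_eqI) (simp add: coeff_map_poly_hom coeff_mult pow_sum pow_hom)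

lemma map_poly_hom_prod: "map_poly (\<sigma> ^^ i) (\<Prod>j\<in>J. f j) = (\<Prod>j\<in>J. map_poly (\<sigma> ^^ i) (f j))"
  by (induction J rule: infinite_finite_induct)
    (simp_all add: map_poly_hom_mult map_poly_1 pow_hom)

text \<open>The powers of \<open>\<sigma>\<close> below \<open>m\<close>, restricted to
  \<open>fixed m\<close>, satisfy a relation modulo \<open>P\<close> with all coefficients 1, so two
  of them agree there. Agreement on the invariants of a subgroup extends to each \<open>a\<close> in
  \<open>S\<close> up to an element of that subgroup, which may depend on \<open>a\<close>.\<close>

lemma prime_containing_transfer:
  assumes P: "prime_of P" and q: "q = m * n" "0 < m"
    and tr: "\<And>y. y \<in> fixed m \<Longrightarrow> (\<Sum>j<m. (\<sigma> ^^ j) y) \<in> P"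
  shows "\<exists>c. 0 < c \<and> c < m \<and> (\<forall>a\<in>S. \<exists>l<n. a - (\<sigma> ^^ (c + m * l)) a \<in> P)"
proof -
  note PI = prime_ofD(1)[OF P]
  interpret T: subring_set "fixed m" by (rule subring_fixed)
  have TS: "fixed m \<subseteq> S" by (auto simp: fixed_def)
  have "\<exists>i\<in>{..<m}. \<exists>j\<in>{..<m}. i \<noteq> j \<and> (\<forall>y\<in>fixed m. (\<sigma> ^^ i) y - (\<sigma> ^^ j) y \<in> P)"
    using TS q(2) prime_ofD(2)[OF P] tr
    by (intro dedekind_independence_mod_prime[OF P, where c="\<lambda>_. 1"])
      (auto simp: T.one_mem one_mem T.mult_mem pow_hom intro!: pow_closed)
  then obtain i j where ij0: "i < m" "j < m" "i \<noteq> j" "\<forall>y\<in>fixed m. (\<sigma> ^^ i) y - (\<sigma> ^^ j) y \<in> P"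
    by auto
  obtain i j where ij: "i < j" "j < m" and eq: "\<And>y. y \<in> fixed m \<Longrightarrow> (\<sigma> ^^ i) y - (\<sigma> ^^ j) y \<in> P"
  proof (cases "i < j")
    case True
    then show thesis using ij0 that by blast
  next
    case False
    then show thesis
      using ij0 that[of j i] ideal_of_uminus[OF PI, of "(\<sigma> ^^ i) _ - (\<sigma> ^^ j) _"] by (metis linorder_neqE_nat minus_diff_eq)
  qed
  have "\<exists>l<n. a - (\<sigma> ^^ (j - i + m * l)) a \<in> P" if a: "a \<in> S" for a
  proof -
    have "m \<le> q" using q period_pos by (cases n) auto
    then have "i \<le> q" using ij by simp
    define b where "b = (\<sigma> ^^ (q - i)) a"
    have b: "b \<in> S" using a by (simp add: b_def pow_closed)
    have ib: "(\<sigma> ^^ (i + k)) b = (\<sigma> ^^ k) a" for k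
    proof -
      have "(\<sigma> ^^ (i + k)) b = (\<sigma> ^^ (i + k + (q - i))) a" by (simp add: b_def funpow_add)
      also have "i + k + (q - i) = k + q" using \<open>i \<le> q\<close> by simp
      finally show ?thesis by (simp add: funpow_add period a)
    qed
    \<comment> \<open>\<open>Q\<close> is the product over the orbit of \<open>b\<close> under the
      \<open>m\<close>-th power of \<open>\<sigma>\<close>, so its coefficients lie in
      \<open>fixed m\<close> and its images under the \<open>i\<close>-th and \<open>j\<close>-th
      powers agree modulo \<open>P\<close>. The first image has the root \<open>a\<close>, by the
      choice of \<open>b\<close>.\<close>
    define Q where "Q = (\<Prod>l<n. [:- (\<sigma> ^^ (m * l)) b, 1:])"
    have mapQ: "map_poly (\<sigma> ^^ k) Q = (\<Prod>l<n. [:- (\<sigma> ^^ (k + m * l)) b, 1:])" for k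
      by (simp add: Q_def map_poly_hom_prod map_poly_pCons pow_hom pow_uminus funpow_add)
    have coefS: "coeff Q k \<in> S" for k
    proof -
      have "coeff (\<Prod>l\<in>J. [:- (\<sigma> ^^ (m * l)) b, 1:]) k \<in> S" for J
        by (induction J arbitrary: k rule: infinite_finite_induct)
         (auto simp: coeff_mult coeff_pCons zero_mem one_mem uminus_mem pow_closed b
            intro!: sum_mem mult_mem diff_mem uminus_mem split: nat.splits)
      then show ?thesis by (simp add: Q_def)
    qed
    have "map_poly (\<sigma> ^^ m) Q = Q"
    proof -
      have "map_poly (\<sigma> ^^ m) Q * [:- b, 1:] = (\<Prod>l<Suc n. [:- (\<sigma> ^^ (m * l)) b, 1:])"
        unfolding mapQ by (subst prod.lessThan_Suc_shift) (simp add: mult.commute)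
      also have "\<dots> = Q * [:- b, 1:]"
        using period[OF b] by (simp add: Q_def q)
      finally have *: "(map_poly (\<sigma> ^^ m) Q - Q) * [:- b, 1:] = 0"
        by (simp only: left_diff_distrib) simp
      \<comment> \<open>The type may have zero divisors; the linear factor is cancelled because it
        is monic, by comparing leading coefficients.\<close>
      have "lead_coeff (map_poly (\<sigma> ^^ m) Q - Q) = 0"
        using coeff_mult_degree_sum[of "map_poly (\<sigma> ^^ m) Q - Q" "[:- b, 1:]"] unfolding * by simp
      then show ?thesis by (simp only: leading_coeff_0_iff right_minus_eq)
    qed
    then have coefT: "coeff Q k \<in> fixed m" for k
      using coefS coeff_map_poly_hom[of m Q k] by (simp add: fixed_def)
    have "poly (map_poly (\<sigma> ^^ i) Q) a - poly (map_poly (\<sigma> ^^ j) Q) a \<in> P"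
    proof -
      have "poly (map_poly (\<sigma> ^^ i) Q - map_poly (\<sigma> ^^ j) Q) a =
          (\<Sum>k\<le>degree (map_poly (\<sigma> ^^ i) Q - map_poly (\<sigma> ^^ j) Q).
            ((\<sigma> ^^ i) (coeff Q k) - (\<sigma> ^^ j) (coeff Q k)) * a ^ k)"
        by (simp add: poly_altdef coeff_map_poly_hom)
      also have "\<dots> \<in> P"
        using eq coefT a by (intro ideal_of_sum[OF PI] ideal_ofD(5)[OF PI] power_mem) auto
      finally show ?thesis by simp
    qed
    moreover have "poly (map_poly (\<sigma> ^^ i) Q) a = 0"
    proof -
      have "a - (\<sigma> ^^ (i + m * 0)) b = 0" "0 < n"
        using ib[of 0] q period_pos by (auto intro: gr0I)
      then have "(\<Prod>l<n. a - (\<sigma> ^^ (i + m * l)) b) = 0"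
        by (subst prod.remove[of _ 0]) simp_all
      then show ?thesis by (simp add: mapQ poly_prod)
    qed
    moreover have "poly (map_poly (\<sigma> ^^ j) Q) a = (\<Prod>l<n. a - (\<sigma> ^^ (j - i + m * l)) a)"
      using ij ib[of "j - i + m * _"] by (simp add: mapQ poly_prod)
    ultimately have "(\<Prod>l<n. a - (\<sigma> ^^ (j - i + m * l)) a) \<in> P"
      using ideal_of_uminus[OF PI] by fastforce
    then show ?thesis
      using prime_of_prod[OF P, of "{..<n}" "\<lambda>l. a - (\<sigma> ^^ (j - i + m * l)) a"] a
      by (auto intro: diff_mem pow_closed)
  qed
  then show ?thesis using ij by (intro exI[of _ "j - i"]) auto
qed

text \<open>
  Geometrically: the relative transfer from the subgroup of index \<open>p ^ b\<close> cuts out the fixed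
  points of the next larger subgroup.
\<close>

lemma prime_containing_transfer_inertia:
  assumes P: "prime_of P" and p: "prime p" and q: "q = p ^ r" and b: "0 < b" "b \<le> r"
    and tr: "\<And>y. y \<in> fixed (p ^ b) \<Longrightarrow> (\<Sum>j<p ^ b. (\<sigma> ^^ j) y) \<in> P"
    and C: "infinite C" "C \<subseteq> S" "\<And>c. c \<in> C \<Longrightarrow> \<sigma> c = c"
      "\<And>c d. c \<in> C \<Longrightarrow> d \<in> C \<Longrightarrow> c \<noteq> d \<Longrightarrow> \<exists>u\<in>S. u * (c - d) = 1"
    and a: "a \<in> S"
  shows "a - (\<sigma> ^^ (p ^ (b - 1))) a \<in> P"
proof -
  note PI = prime_ofD(1)[OF P]
  let ?n = "p ^ (r - b)"
  have qmn: "q = p ^ b * ?n" using q b by (simp flip: power_add)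
  have "0 < p" using p by (simp add: prime_gt_0_nat)
  obtain c where c: "0 < c" "c < p ^ b" and ex: "\<forall>a\<in>S. \<exists>l<?n. a - (\<sigma> ^^ (c + p ^ b * l)) a \<in> P"
    using prime_containing_transfer[OF P qmn _ tr] \<open>0 < p\<close> by auto
  have powC: "(\<sigma> ^^ i) x = x" if "x \<in> C" for i x
    by (induction i) (use C(3)[OF that] in auto)
  \<comment> \<open>So far \<open>l\<close> depends on \<open>a\<close>. For fixed \<open>l\<close>
    the congruence defines a subspace, and over an infinite field one of finitely many subspaces
    covering \<open>S\<close> is all of \<open>S\<close>.\<close>
  have "\<exists>l<?n. \<forall>a\<in>S. a - (\<sigma> ^^ (c + p ^ b * l)) a \<in> P"
  proof (rule ccontr)
    assume "\<not> ?thesis"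
    then have "\<exists>x\<in>S. \<forall>l\<in>{..<?n}. x - (\<sigma> ^^ (c + p ^ b * l)) x \<notin> P"
      by (intro avoid_finitely_many_subspaces[OF P C(1,2,4)])
        (auto simp: diff_mem pow_closed pow_hom powC right_diff_distrib)
    then show False using ex by blast
  qed
  then obtain l where l: "\<And>a. a \<in> S \<Longrightarrow> a - (\<sigma> ^^ (c + p ^ b * l)) a \<in> P" by blast
  let ?e = "c + p ^ b * l"
  \<comment> \<open>The congruence telescopes along multiples of \<open>?e\<close>. As
    \<open>p ^ b\<close> does not divide \<open>?e\<close>, one of these multiples is
    \<open>p ^ (b - 1)\<close> modulo \<open>q\<close>.\<close>
  have e: "a - (\<sigma> ^^ (?e * t)) a \<in> P" for t
  proof (induction t)
    case (Suc t)
    have "(a - (\<sigma> ^^ (?e * t)) a) + ((\<sigma> ^^ (?e * t)) a - (\<sigma> ^^ ?e) ((\<sigma> ^^ (?e * t)) a)) \<in> P"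
      by (intro ideal_ofD(3)[OF PI] Suc l pow_closed a)
    then show ?case by (simp add: funpow_add del: add_mult_distrib add_mult_distrib2 distrib_left distrib_right)
  qed (simp add: ideal_ofD(2)[OF PI])
  have "\<not> p ^ b dvd ?e" using c by (auto simp: dvd_add_left_iff dest: dvd_imp_le)
  then obtain t where "[?e * t = p ^ (b - 1)] (mod q)"
    using ex_multiple_cong_prime_power[OF p b] q by blast
  then show ?thesis using e[of t] pow_cong[OF _ a] by metis
qed

end

section \<open>Counting monomials as a substitute for transcendence degree\<close>

section \<open>Algebraic dependence modulo an ideal\<close>

definition power_product :: "'a::comm_ring_1 list \<Rightarrow> nat list \<Rightarrow> 'a" where
  "power_product xs es = (\<Prod>(x, e)\<leftarrow>zip xs es. x ^ e)"

lemma power_product_simps [simp]: "power_product [] es = 1" "power_product (x # xs) (e # es) = x ^ e * power_product xs es"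
  by (simp_all add: power_product_def)

text \<open>A box of exponent vectors rather than a bound on the total degree: its size is exactly a
  power of \<open>N\<close>, which keeps the later count elementary.\<close>

definition exps :: "nat \<Rightarrow> nat \<Rightarrow> nat list set" where
  "exps d N = {es. set es \<subseteq> {..<N} \<and> length es = d}"

lemma finite_exps: "finite (exps d N)" and card_exps: "card (exps d N) = N ^ d"
  unfolding exps_def by (simp_all add: finite_lists_length_eq card_lists_length_eq)

lemma exps_Suc: "exps (Suc d) N = (\<lambda>(e, es). e # es) ` ({..<N} \<times> exps d N)"
  unfolding exps_def by (force simp: length_Suc_conv)

lemma sum_exps_Suc: "(\<Sum>es\<in>exps (Suc d) N. f es) = (\<Sum>e<N. \<Sum>es\<in>exps d N. f (e # es))"
proof -
  have "inj_on (\<lambda>(e, es). e # es) ({..<N} \<times> exps d N)" by (auto simp: inj_on_def)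
  then show ?thesis
    unfolding exps_Suc by (simp add: sum.reindex sum.cartesian_product case_prod_unfold)
qed

lemma power_product_add:
  "length es = length xs \<Longrightarrow> length es' = length xs \<Longrightarrow> power_product xs (map2 (+) es es') = power_product xs es * power_product xs es'"
proof (induction xs arbitrary: es es')
  case (Cons x xs)
  then obtain e fs e' fs' where "es = e # fs" "es' = e' # fs'" by (metis length_Suc_conv)
  with Cons show ?case by (simp add: power_add mult_ac)
qed simp

lemma power_product_replicate_0: "power_product xs (replicate (length xs) 0) = 1"
  by (induction xs) simp_all

locale coefficient_map =
  fixes \<iota> :: "'k::field \<Rightarrow> 'a::comm_ring_1"
  assumes coeff_zero: "\<iota> 0 = 0" and coeff_one: "\<iota> 1 = 1"
    and coeff_add: "\<iota> (c + d) = \<iota> c + \<iota> d" and coeff_mult: "\<iota> (c * d) = \<iota> c * \<iota> d"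
begin

sublocale vs: vector_space "\<lambda>c x. \<iota> c * x"
  by unfold_locales (simp_all add: coeff_add coeff_mult coeff_one algebra_simps)

lemma coeff_uminus: "\<iota> (- c) = - \<iota> c"
  using coeff_add[of "- c" c] by (simp add: coeff_zero eq_neg_iff_add_eq_0)

lemma coeff_diff: "\<iota> (c - d) = \<iota> c - \<iota> d"
  using coeff_add[of c "- d"] by (simp add: coeff_uminus)

lemma coeff_inverse: "c \<noteq> 0 \<Longrightarrow> \<iota> (inverse c) * \<iota> c = 1"
  by (simp flip: coeff_mult add: coeff_one)

lemma inj_coeff: "inj \<iota>"
proof (rule injI)
  fix c d assume "\<iota> c = \<iota> d"
  then have "\<iota> (c - d) = 0" by (simp add: coeff_diff)
  then show "c = d" using coeff_inverse[of "c - d"] by force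
qed

abbreviation units :: "'a set" where "units \<equiv> \<iota> ` (UNIV - {0})"

text \<open>These are the polynomials in \<open>ws\<close> with every exponent at most
  \<open>E\<close>; \<open>exps\<close> bounds exponents strictly, hence
  \<open>Suc E\<close>.\<close>

definition mspan :: "'a list \<Rightarrow> nat \<Rightarrow> 'a set" where
  "mspan ws E = vs.span (power_product ws ` exps (length ws) (Suc E))"

lemma mspan_mono: "E \<le> E' \<Longrightarrow> mspan ws E \<subseteq> mspan ws E'"
  unfolding mspan_def by (intro vs.span_mono image_mono) (auto simp: exps_def)

lemma one_mspan: "1 \<in> mspan ws 0"
proof -
  have "replicate (length ws) 0 \<in> exps (length ws) (Suc 0)" by (auto simp: exps_def)
  then show ?thesis
    unfolding mspan_def using power_product_replicate_0[of ws] by (metis image_eqI vs.span_base)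
qed

lemma mult_mspan:
  assumes "u \<in> mspan ws E" "v \<in> mspan ws E'" shows "u * v \<in> mspan ws (E + E')"
proof -
  have 1: "power_product ws es * power_product ws es' \<in> mspan ws (E + E')"
    if "es \<in> exps (length ws) (Suc E)" "es' \<in> exps (length ws) (Suc E')" for es es'
  proof -
    have "map2 (+) es es' \<in> exps (length ws) (Suc (E + E'))"
      using that by (fastforce simp: exps_def set_zip subset_iff in_set_conv_nth)
    moreover have "power_product ws es * power_product ws es' = power_product ws (map2 (+) es es')"
      using that by (simp add: power_product_add exps_def)
    ultimately show ?thesis unfolding mspan_def by (simp add: vs.span_base)
  qed
  have 2: "power_product ws es * v \<in> mspan ws (E + E')" if "es \<in> exps (length ws) (Suc E)" for es
    using assms(2)[unfolded mspan_def]
  proof (induction rule: vs.span_induct_alt)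
    case (step c x y)
    then show ?case
      using 1[OF that] vs.span_add vs.span_scale unfolding mspan_def
      by (auto simp: distrib_left mult.left_commute)
  qed (simp add: mspan_def vs.span_zero)
  show ?thesis
    using assms(1)[unfolded mspan_def]
  proof (induction rule: vs.span_induct_alt)
    case (step c x y)
    then show ?case
      using 2 vs.span_add vs.span_scale unfolding mspan_def
      by (auto simp: distrib_right mult.assoc)
  qed (simp add: mspan_def vs.span_zero)
qed

lemma list_mem_mspan: "w \<in> set ws \<Longrightarrow> w \<in> mspan ws 1"
proof -
  assume "w \<in> set ws"
  then have "\<exists>es\<in>exps (length ws) 2. power_product ws es = w"
  proof (induction ws)
    case (Cons v ws)
    show ?case
    proof (cases "w = v")
      case True
      have "1 # replicate (length ws) 0 \<in> exps (length (v # ws)) 2"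
        by (auto simp: exps_def set_replicate_conv_if)
      moreover have "power_product (v # ws) (1 # replicate (length ws) 0) = w"
        using True by (simp add: power_product_replicate_0)
      ultimately show ?thesis by blast
    next
      case False
      then obtain es where "es \<in> exps (length ws) 2" "power_product ws es = w" using Cons by auto
      then show ?thesis by (intro bexI[of _ "0 # es"]) (auto simp: exps_def)
    qed
  qed simp
  then show "w \<in> mspan ws 1"
    unfolding mspan_def by (auto simp: numeral_2_eq_2 intro!: vs.span_base)
qed

text \<open>The family is indexed by \<open>X\<close>, so a repeated value already gives a relation,
  with coefficients 1 and -1. Otherwise the image has more elements than the spanning set and is
  dependent.\<close>

lemma ex_relation:
  assumes "finite X" "finite W" "card W < card X" "\<And>x. x \<in> X \<Longrightarrow> u x \<in> vs.span W"
  shows "\<exists>c. (\<exists>x\<in>X. c x \<noteq> 0) \<and> (\<Sum>x\<in>X. \<iota> (c x) * u x) = 0"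
proof (cases "inj_on u X")
  case True
  have "vs.dependent (u ` X)"
  proof (rule ccontr)
    assume "\<not> vs.dependent (u ` X)"
    then have "card (u ` X) \<le> card W"
      using vs.independent_span_bound[OF assms(2), of "u ` X"] assms(4) by blast
    then show False using True assms(3) by (simp add: card_image)
  qed
  then obtain c where "\<exists>v\<in>u ` X. c v \<noteq> 0" "(\<Sum>v\<in>u ` X. \<iota> (c v) * v) = 0"
    using vs.dependent_finite[of "u ` X"] assms(1) by auto
  then show ?thesis using True by (intro exI[of _ "c \<circ> u"]) (simp add: sum.reindex)
next
  case False
  then obtain x y where xy: "x \<in> X" "y \<in> X" "x \<noteq> y" "u x = u y" by (auto simp: inj_on_def)
  let ?c = "\<lambda>z. if z = x then 1 else if z = y then - 1 else (0::'k)"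
  have "(\<Sum>z\<in>X. \<iota> (?c z) * u z) = (\<Sum>z\<in>{x, y}. \<iota> (?c z) * u z)"
    using xy assms(1) by (intro sum.mono_neutral_right) (auto simp: coeff_zero)
  also have "\<dots> = 0" using xy by (simp add: coeff_uminus coeff_one)
  finally show ?thesis using xy by (intro exI[of _ ?c]) auto
qed

end

text \<open>For \<open>N = (E * d + 1) ^ m + 1\<close> the left side is at most
  \<open>(N - 1) * N ^ m\<close>. In the count, \<open>N ^ d\<close> products of \<open>d\<close>
  elements are expressed through at most \<open>(E * d * N + 1) ^ m\<close> monomials.\<close>

lemma ex_power_gt:
  fixes E d m :: nat assumes "m < d" shows "\<exists>N. (E * d * N + 1) ^ m < N ^ d"
proof -
  let ?K = "(E * d + 1) ^ m"
  let ?N = "?K + 1"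
  have "(E * d * ?N + 1) ^ m \<le> ((E * d + 1) * ?N) ^ m"
    by (intro power_mono) (auto simp: algebra_simps)
  also have "\<dots> = ?K * ?N ^ m" by (rule power_mult_distrib)
  also have "\<dots> < ?N * ?N ^ m" by simp
  also have "\<dots> = ?N ^ Suc m" by simp
  also have "\<dots> \<le> ?N ^ d" using assms by (intro power_increasing) auto
  finally show ?thesis by blast
qed

locale coefficient_subring = subring_set A + coefficient_map \<iota>
  for A :: "'a::comm_ring_1 set" and \<iota> :: "'k::field \<Rightarrow> 'a" +
  assumes coeff_mem: "\<iota> c \<in> A"
begin

lemma units_facts:
  "units \<subseteq> A" "1 \<in> units" "\<And>u v. u \<in> units \<Longrightarrow> v \<in> units \<Longrightarrow> u * v \<in> units"
  "\<And>u. u \<in> units \<Longrightarrow> \<exists>v\<in>A. v * u = 1"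
proof -
  show "1 \<in> units" by (rule image_eqI[of _ _ 1]) (simp_all add: coeff_one)
  show "u * v \<in> units" if "u \<in> units" "v \<in> units" for u v
    using that by (auto simp flip: coeff_mult)
  show "\<exists>v\<in>A. v * u = 1" if "u \<in> units" for u
    using that coeff_inverse coeff_mem by blast
qed (auto simp: coeff_mem)

lemma power_product_mem: "set xs \<subseteq> A \<Longrightarrow> length es = length xs \<Longrightarrow> power_product xs es \<in> A"
proof (induction xs arbitrary: es)
  case (Cons x xs)
  then show ?case by (cases es) (auto intro!: mult_mem power_mem)
qed (simp add: one_mem)

text \<open>The condition concerns the coefficients and not the value, which could a priori be zero.
  The least exponent of \<open>x\<close> that carries a nonzero coefficient gives the power to
  factor out.\<close>

lemma combination_in_lead_forms:
  assumes "set xs \<subseteq> A" "\<exists>es\<in>exps (length xs) N. c es \<noteq> 0"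
  shows "(\<Sum>es\<in>exps (length xs) N. \<iota> (c es) * power_product xs es) \<in> lead_forms units xs"
  using assms
proof (induction xs arbitrary: c)
  case Nil
  have "exps 0 N = {[]}" by (auto simp: exps_def)
  then show ?case using Nil by auto
next
  case (Cons x xs)
  let ?X = "exps (length xs) N"
  define F where "F e = (\<Sum>es\<in>?X. \<iota> (c (e # es)) * power_product xs es)" for e
  have FA: "F e \<in> A" for e
    unfolding F_def using Cons.prems(1)
    by (intro sum_mem mult_mem coeff_mem power_product_mem) (auto simp: exps_def)
  let ?Q = "\<lambda>e. e < N \<and> (\<exists>es\<in>?X. c (e # es) \<noteq> 0)"
  define e where "e = (LEAST e. ?Q e)"
  have "\<exists>e. ?Q e" using Cons.prems(2) by (auto simp: exps_Suc)
  then have e: "?Q e" unfolding e_def by (rule LeastI_ex)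
  have F0: "F i = 0" if "i < e" for i
  proof -
    have "\<not> ?Q i" using that unfolding e_def by (rule not_less_Least)
    then show ?thesis using that e by (auto simp: F_def coeff_zero intro!: sum.neutral)
  qed
  have "(\<Sum>es\<in>exps (length (x # xs)) N. \<iota> (c es) * power_product (x # xs) es) = (\<Sum>i<N. x ^ i * F i)"
    by (simp add: sum_exps_Suc F_def sum_distrib_left mult_ac)
  also have "\<dots> = (\<Sum>i\<in>{e..<N}. x ^ i * F i)"
    by (rule sum.mono_neutral_right) (auto simp: F0 not_le)
  also have "{e..<N} = insert e {Suc e..<N}" using e by auto
  also have "(\<Sum>i\<in>\<dots>. x ^ i * F i) = x ^ e * F e + (\<Sum>i\<in>{Suc e..<N}. x ^ i * F i)" by simp
  also have "(\<Sum>i\<in>{Suc e..<N}. x ^ i * F i) = (\<Sum>i\<in>{Suc e..<N}. x ^ e * (x * (x ^ (i - Suc e) * F i)))"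
  proof (rule sum.cong)
    fix i assume "i \<in> {Suc e..<N}"
    then have "i = e + 1 + (i - Suc e)" by simp
    then have "x ^ i = x ^ e * x * x ^ (i - Suc e)" by (metis power_add power_one_right)
    then show "x ^ i * F i = x ^ e * (x * (x ^ (i - Suc e) * F i))" by (simp add: mult.assoc)
  qed simp
  also have "x ^ e * F e + \<dots> = x ^ e * (F e + x * (\<Sum>i\<in>{Suc e..<N}. x ^ (i - Suc e) * F i))"
    by (simp add: distrib_left sum_distrib_left)
  also have "\<dots> \<in> lead_forms units (x # xs)"
  proof -
    have "F e \<in> lead_forms units xs" unfolding F_def using Cons e by auto
    moreover have "(\<Sum>i\<in>{Suc e..<N}. x ^ (i - Suc e) * F i) \<in> A"
      using Cons.prems(1) FA by (intro sum_mem mult_mem power_mem) auto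
    ultimately show ?thesis unfolding lead_forms.simps by blast
  qed
  finally show ?case .
qed

text \<open>The exponent bound \<open>E\<close> is recorded because it grows only linearly under
  powers, on which the comparison of dimensions relies.\<close>

definition reducible_to :: "'a set \<Rightarrow> 'a list \<Rightarrow> nat \<Rightarrow> 'a \<Rightarrow> bool" where
  "reducible_to P ws E f \<longleftrightarrow> f \<in> A \<and> (\<exists>u\<in>mspan ws E. f - u \<in> P)"

lemma mspan_mem:
  assumes "set ws \<subseteq> A" "u \<in> mspan ws E" shows "u \<in> A"
  using assms(2) unfolding mspan_def
proof (induction rule: vs.span_induct_alt)
  case (step c x y)
  then show ?case using assms(1) by (auto intro!: add_mem mult_mem coeff_mem power_product_mem simp: exps_def)
qed (rule zero_mem)

context
  fixes P ws assumes P: "ideal_of P" and ws: "set ws \<subseteq> A"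
begin

lemma reducible_to_mono: "reducible_to P ws E f \<Longrightarrow> E \<le> E' \<Longrightarrow> reducible_to P ws E' f"
  unfolding reducible_to_def using mspan_mono by blast

lemma reducible_to_one: "reducible_to P ws 0 1"
  unfolding reducible_to_def using one_mspan ideal_ofD(2)[OF P] one_mem by force

lemma reducible_to_mult:
  assumes "reducible_to P ws E f" "reducible_to P ws E' g"
  shows "reducible_to P ws (E + E') (f * g)"
proof -
  from assms obtain u v where uv: "f \<in> A" "g \<in> A" "u \<in> mspan ws E" "f - u \<in> P" "v \<in> mspan ws E'" "g - v \<in> P"
    by (auto simp: reducible_to_def)
  then have "f * (g - v) + v * (f - u) \<in> P"
    using mspan_mem[OF ws] by (intro ideal_ofD(3)[OF P] ideal_ofD(4)[OF P]) auto
  also have "f * (g - v) + v * (f - u) = f * g - u * v" by (simp add: algebra_simps)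
  finally show ?thesis unfolding reducible_to_def using mult_mspan uv mult_mem by blast
qed

lemma reducible_to_power: "reducible_to P ws E f \<Longrightarrow> reducible_to P ws (E * n) (f ^ n)"
  by (induction n) (auto simp: reducible_to_one reducible_to_mult)

lemma reducible_to_add:
  assumes "reducible_to P ws E f" "reducible_to P ws E g"
  shows "reducible_to P ws E (f + g)"
proof -
  from assms obtain u v where uv: "f \<in> A" "g \<in> A" "u \<in> mspan ws E" "f - u \<in> P" "v \<in> mspan ws E" "g - v \<in> P"
    by (auto simp: reducible_to_def)
  then have "(f - u) + (g - v) \<in> P" by (intro ideal_ofD(3)[OF P])
  moreover have "(f - u) + (g - v) = (f + g) - (u + v)" by simp
  moreover have "u + v \<in> mspan ws E" using uv vs.span_add by (simp add: mspan_def)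
  ultimately show ?thesis unfolding reducible_to_def using uv add_mem by metis
qed

lemma reducible_to_coeff: "reducible_to P ws 0 (\<iota> c)"
proof -
  have "\<iota> c * 1 \<in> mspan ws 0"
    using one_mspan vs.span_scale unfolding mspan_def by blast
  then show ?thesis
    unfolding reducible_to_def using ideal_ofD(2)[OF P] coeff_mem by force
qed

lemma reducible_to_mono_list:
  assumes "\<And>f. f \<in> set fs \<Longrightarrow> reducible_to P ws E f" "es \<in> exps (length fs) N"
  shows "reducible_to P ws (E * length fs * N) (power_product fs es)"
  using assms
proof (induction fs arbitrary: es)
  case (Cons f fs)
  then obtain e es' where es: "es = e # es'" "e < N" "es' \<in> exps (length fs) N" by (auto simp: exps_Suc)
  have "reducible_to P ws (E * e + E * length fs * N) (power_product (f # fs) es)"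
    unfolding es(1) power_product_simps using Cons es by (intro reducible_to_mult reducible_to_power) auto
  moreover have "E * e + E * length fs * N \<le> E * length (f # fs) * N"
    using es(2) mult_le_mono2[of e N E] by (simp add: algebra_simps)
  ultimately show ?case by (rule reducible_to_mono)
qed (simp add: reducible_to_one)

text \<open>Modulo \<open>P\<close> the power products of \<open>fs\<close> lie in the span of fewer
  monomials in \<open>ws\<close>, so a combination with a nonzero coefficient falls into
  \<open>P\<close>. It is read as a leading form over a possibly different ring \<open>A'\<close>,
  in the application the invariants.\<close>

lemma lead_forms_meet_ideal:
  assumes fs: "set fs \<subseteq> A'" "\<And>f. f \<in> set fs \<Longrightarrow> \<exists>E. reducible_to P ws E f"
    and A': "coefficient_subring A' \<iota>" and len: "length ws < length fs"
  shows "subring_set.lead_forms A' units fs \<inter> P \<noteq> {}"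
proof -
  from fs(2) obtain E0 where E0: "\<And>f. f \<in> set fs \<Longrightarrow> reducible_to P ws (E0 f) f" by metis
  define E where "E = (\<Sum>f\<in>set fs. E0 f)"
  have E: "reducible_to P ws E f" if "f \<in> set fs" for f
    using reducible_to_mono[OF E0[OF that]] member_le_sum[OF that, of E0] by (simp add: E_def)
  let ?d = "length fs" and ?m = "length ws"
  obtain N where N: "(E * ?d * N + 1) ^ ?m < N ^ ?d" using ex_power_gt[OF len] by blast
  let ?X = "exps ?d N" and ?W = "power_product ws ` exps ?m (Suc (E * ?d * N))"
  have "\<exists>u\<in>vs.span ?W. power_product fs es - u \<in> P" if "es \<in> ?X" for es
    using reducible_to_mono_list[OF E that] unfolding reducible_to_def mspan_def by blast
  then obtain u where u: "\<And>es. es \<in> ?X \<Longrightarrow> u es \<in> vs.span ?W" "\<And>es. es \<in> ?X \<Longrightarrow> power_product fs es - u es \<in> P"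
    by metis
  have "card ?W \<le> card (exps ?m (Suc (E * ?d * N)))" by (intro card_image_le finite_exps)
  then have "card ?W < card ?X" using N by (simp add: card_exps)
  then obtain c where c: "\<exists>es\<in>?X. c es \<noteq> 0" "(\<Sum>es\<in>?X. \<iota> (c es) * u es) = 0"
    using ex_relation[of ?X ?W u] u(1) finite_exps by auto
  let ?f = "\<Sum>es\<in>?X. \<iota> (c es) * power_product fs es"
  have "?f = (\<Sum>es\<in>?X. \<iota> (c es) * (power_product fs es - u es))"
    using c(2) by (simp add: right_diff_distrib sum_subtractf)
  also have "\<dots> \<in> P" by (intro ideal_of_sum[OF P] ideal_ofD(4)[OF P] coeff_mem u)
  finally have "?f \<in> P" .
  moreover have "?f \<in> subring_set.lead_forms A' units fs"
    by (rule coefficient_subring.combination_in_lead_forms[OF A' fs(1) c(1)])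
  ultimately show ?thesis by blast
qed

end

end

section \<open>Transfer ideals, and the length bound in abstract form\<close>

locale linear_cyclic_action = cyclic_action S \<sigma> q + coefficient_subring S \<iota>
  for S :: "'a::comm_ring_1 set" and \<sigma> q and \<iota> :: "'k::field \<Rightarrow> 'a" +
  assumes coeff_invariant: "\<sigma> (\<iota> c) = \<iota> c" and infinite_field: "infinite (UNIV :: 'k set)"
begin

text \<open>On \<open>fixed m\<close>, with \<open>m\<close> dividing \<open>q\<close>, this is the
  relative transfer from the subgroup generated by the \<open>m\<close>-th power of
  \<open>\<sigma>\<close>.\<close>

definition tr :: "nat \<Rightarrow> 'a \<Rightarrow> 'a" where
  "tr m f = (\<Sum>j<m. (\<sigma> ^^ j) f)"

lemma coefficient_subring_invs: "coefficient_subring invs \<iota>"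
  by (intro coefficient_subring.intro invs.subring_set_axioms coefficient_map_axioms)
    (unfold_locales, simp add: fixed_def coeff_mem coeff_invariant)

lemma tr_zero: "tr m 0 = 0" and tr_add: "tr m (f + g) = tr m f + tr m g"
  by (simp_all add: tr_def pow_hom sum.distrib)

lemma tr_mult_left: "f \<in> invs \<Longrightarrow> tr m (f * g) = f * tr m g"
  by (simp add: tr_def pow_hom invs_pow sum_distrib_left)

text \<open>Applying \<open>\<sigma>\<close> shifts the summands by one place, and the term that
  enters equals the one that leaves.\<close>

lemma tr_invariant:
  assumes "f \<in> fixed m" shows "tr m f \<in> invs"
proof -
  have f: "f \<in> S" "(\<sigma> ^^ m) f = f" using assms by (auto simp: fixed_def)
  have "\<sigma> (tr m f) + f = (\<Sum>j<Suc m. (\<sigma> ^^ j) f)"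
    using pow_sum[of 1 "\<lambda>j. (\<sigma> ^^ j) f" "{..<m}"]
    by (subst sum.lessThan_Suc_shift) (simp add: tr_def add.commute)
  also have "\<dots> = tr m f + f" using f(2) by (simp add: tr_def)
  finally show ?thesis using f(1) by (auto simp: fixed_def tr_def intro!: sum_mem pow_closed)
qed

lemma fixed_subset_mult: "f \<in> invs \<Longrightarrow> g \<in> fixed m \<Longrightarrow> f * g \<in> fixed m"
  using invs_pow[of f m] by (auto simp: fixed_def pow_hom mult_mem)

lemma ideal_of_tr: "invs.ideal_of (tr m ` fixed m)"
proof -
  interpret T: subring_set "fixed m" by (rule subring_fixed)
  show ?thesis
    unfolding invs.ideal_of_def
  proof (intro conjI ballI subsetI)
    show "f \<in> invs" if "f \<in> tr m ` fixed m" for f using that tr_invariant by blast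
    show "0 \<in> tr m ` fixed m" using tr_zero T.zero_mem by (metis imageI)
    show "f + g \<in> tr m ` fixed m" if "f \<in> tr m ` fixed m" "g \<in> tr m ` fixed m" for f g
      using that T.add_mem by (auto simp flip: tr_add)
    show "f * g \<in> tr m ` fixed m" if "f \<in> invs" "g \<in> tr m ` fixed m" for f g
      using that fixed_subset_mult by (auto simp: tr_mult_left[symmetric])
  qed
qed

text \<open>Polynomials enter only through the assumption on \<open>ws\<close>: modulo any ideal
  that trivializes the \<open>p ^ (b - 1)\<close>-th power of \<open>\<sigma>\<close>, everything
  becomes a polynomial in \<open>ws\<close>.\<close>

lemma regular_sequence_length_le:
  assumes p: "prime p" and q: "q = p ^ r" and b: "0 < b" "b \<le> r"
    and I: "invs.ideal_of I" and fs: "set fs \<subseteq> invs" "invs.reg_mod I fs"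
    and y: "y \<in> invs" "\<not> (\<forall>n. invs.ipow I (set fs) n y)"
    and ann: "\<And>f. f \<in> tr (p ^ b) ` fixed (p ^ b) \<Longrightarrow> f * y \<in> I"
    and ws: "set ws \<subseteq> S"
      "\<And>P f. ideal_of P \<Longrightarrow> (\<And>a. a \<in> S \<Longrightarrow> a - (\<sigma> ^^ (p ^ (b - 1))) a \<in> P) \<Longrightarrow> f \<in> S \<Longrightarrow>
        \<exists>E. reducible_to P ws E f"
  shows "length fs \<le> length ws"
proof (rule ccontr)
  assume "\<not> length fs \<le> length ws"
  then have len: "length ws < length fs" by simp
  interpret cinv: coefficient_subring invs \<iota> by (rule coefficient_subring_invs)
  let ?J = "tr (p ^ b) ` fixed (p ^ b)" and ?D = "invs.lead_forms units fs"
  note J = ideal_of_tr[of "p ^ b"]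
  have invsS: "invs \<subseteq> S" by (auto simp: fixed_def)
  have JS: "?J \<subseteq> S" using invs.ideal_ofD(1)[OF J] invsS by blast
  have D: "?D \<subseteq> invs" by (rule invs.lead_forms_mem[OF cinv.units_facts fs(1)])
  \<comment> \<open>A common element \<open>f\<close> would have \<open>f ^ q\<close> both in
    \<open>?D\<close> and in \<open>?J\<close>. Then \<open>f ^ q\<close> kills \<open>y\<close>
    modulo \<open>I\<close>, which forces \<open>y\<close> to have infinite order.\<close>
  have "?D \<inter> ext_ideal ?J = {}"
  proof (rule ccontr)
    assume "?D \<inter> ext_ideal ?J \<noteq> {}"
    then obtain f where f: "f \<in> ?D" "f \<in> ext_ideal ?J" by blast
    have "f ^ q \<in> ?J" using invariant_in_ext_ideal_power[OF J _ f(2)] D f(1) by blast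
    moreover have "f ^ q \<in> ?D" using invs.lead_forms_power[OF cinv.units_facts fs(1) f(1)] .
    ultimately have "invs.ipow I (set fs) n y" for n
      using invs.lead_forms_annihilator[OF cinv.units_facts I fs _ y(1)] ann by blast
    then show False using y(2) by blast
  qed
  then obtain P where P: "prime_of P" "ext_ideal ?J \<subseteq> P" "?D \<inter> P = {}"
    using ex_prime_avoiding[OF ideal_of_ext_ideal[OF JS], of ?D] D invsS
      invs.lead_forms_one[OF cinv.units_facts] invs.lead_forms_mult[OF cinv.units_facts fs(1)] by blast
  have "a - (\<sigma> ^^ (p ^ (b - 1))) a \<in> P" if "a \<in> S" for a
  proof (rule prime_containing_transfer_inertia[OF P(1) p q b, where C="range \<iota>"])
    show "(\<Sum>j<p ^ b. (\<sigma> ^^ j) y) \<in> P" if "y \<in> fixed (p ^ b)" for y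
      using that ext_ideal_subset[OF one_mem, of ?J] P(2) unfolding tr_def by blast
    show "infinite (range \<iota>)" using inj_coeff infinite_field by (simp add: finite_image_iff)
    show "\<exists>u\<in>S. u * (c - d) = 1" if cd: "c \<in> range \<iota>" "d \<in> range \<iota>" "c \<noteq> d" for c d
    proof -
      obtain c' d' where "c = \<iota> c'" "d = \<iota> d'" using cd by blast
      then have "\<iota> (inverse (c' - d')) * (c - d) = 1"
        using coeff_inverse[of "c' - d'"] cd(3) by (auto simp: coeff_diff)
      then show ?thesis using coeff_mem by blast
    qed
  qed (use that coeff_mem coeff_invariant in auto)
  \<comment> \<open>Modulo \<open>P\<close> the elements \<open>fs\<close> become polynomials in the
    fewer elements \<open>ws\<close>, so the count contradicts the choice of
    \<open>P\<close>.\<close>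
  then have "?D \<inter> P \<noteq> {}"
    using ws fs(1) invsS prime_ofD(1)[OF P(1)]
    by (intro lead_forms_meet_ideal[OF _ _ _ _ coefficient_subring_invs len]) blast+
  then show False using P(3) by blast
qed

end

section \<open>Transfers as powers of \<open>T - 1\<close> in characteristic
  \<open>p\<close>\<close>

section \<open>Polynomials in a linear operator\<close>

context vector_space
begin

definition poly_op :: "('b \<Rightarrow> 'b) \<Rightarrow> 'a poly \<Rightarrow> 'b \<Rightarrow> 'b" where
  "poly_op T P v = (\<Sum>i\<le>degree P. coeff P i *s (T ^^ i) v)"

end

locale linear_endo = vector_space scale
  for scale :: "'k::field \<Rightarrow> 'b::ab_group_add \<Rightarrow> 'b" (infixr \<open>*s\<close> 75) +
  fixes T :: "'b \<Rightarrow> 'b"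
  assumes T_add: "T (u + v) = T u + T v" and T_scale: "T (c *s v) = c *s T v"
begin

lemma pow_add: "(T ^^ i) (u + v) = (T ^^ i) u + (T ^^ i) v"
  and pow_scale: "(T ^^ i) (c *s v) = c *s (T ^^ i) v"
  by (induction i) (simp_all add: T_add T_scale)

lemma pow_zero: "(T ^^ i) 0 = 0"
  using pow_add[of i 0 0] by simp

lemma pow_sum: "(T ^^ i) (sum f J) = (\<Sum>j\<in>J. (T ^^ i) (f j))"
  by (induction J rule: infinite_finite_induct) (simp_all add: pow_add pow_zero)

lemma poly_op_altdef:
  assumes "degree P \<le> n" shows "poly_op T P v = (\<Sum>i\<le>n. coeff P i *s (T ^^ i) v)"
  unfolding poly_op_def using assms
  by (intro sum.mono_neutral_left) (auto simp: coeff_eq_0)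

lemma poly_op_add: "poly_op T (P + Q) v = poly_op T P v + poly_op T Q v"
proof -
  let ?n = "max (degree P) (degree Q)"
  show ?thesis
    using degree_add_le_max[of P Q]
    by (simp add: poly_op_altdef[of _ ?n] scale_left_distrib sum.distrib)
qed

lemma poly_op_sum: "poly_op T (\<Sum>j\<in>J. P j) v = (\<Sum>j\<in>J. poly_op T (P j) v)"
  by (induction J rule: infinite_finite_induct) (simp_all add: poly_op_add, simp_all add: poly_op_def)

lemma poly_op_monom: "poly_op T (monom c i) v = c *s (T ^^ i) v"
proof -
  have "poly_op T (monom c i) v = (\<Sum>j\<le>i. coeff (monom c i) j *s (T ^^ j) v)"
    by (rule poly_op_altdef) (rule degree_monom_le)
  also have "\<dots> = (\<Sum>j\<in>{i}. coeff (monom c i) j *s (T ^^ j) v)"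
    by (rule sum.mono_neutral_right) auto
  finally show ?thesis by simp
qed

lemma poly_op_mult: "poly_op T (P * Q) v = poly_op T P (poly_op T Q v)"
proof -
  have "P * Q = (\<Sum>i\<le>degree P. \<Sum>j\<le>degree Q. monom (coeff P i * coeff Q j) (i + j))"
    by (subst poly_as_sum_of_monoms[of P, symmetric], subst poly_as_sum_of_monoms[of Q, symmetric])
      (simp add: sum_product mult_monom)
  then have "poly_op T (P * Q) v =
      (\<Sum>i\<le>degree P. \<Sum>j\<le>degree Q. (coeff P i * coeff Q j) *s (T ^^ (i + j)) v)"
    by (simp add: poly_op_sum poly_op_monom)
  also have "\<dots> = poly_op T P (poly_op T Q v)"
    by (simp add: poly_op_def pow_sum pow_scale scale_sum_right funpow_add)
  finally show ?thesis .
qed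

lemma poly_op_1: "poly_op T 1 v = v"
  using poly_op_monom[of 1 0 v] by (simp add: one_pCons monom_0)

lemma poly_op_power: "poly_op T (P ^ i) v = (poly_op T P ^^ i) v"
  by (induction i) (simp_all add: poly_op_1 poly_op_mult)

abbreviation Delta :: "'b \<Rightarrow> 'b" where "Delta v \<equiv> T v - v"

lemma poly_op_X_minus_1: "poly_op T (monom 1 1 - 1) = Delta"
proof
  fix v
  have "poly_op T (monom 1 1 + monom (- 1) 0) v = Delta v"
    unfolding poly_op_add poly_op_monom by simp
  moreover have "monom (- 1) 0 = (- 1 :: 'k poly)" by (simp add: monom_0 one_pCons)
  ultimately show "poly_op T (monom 1 1 - 1) v = Delta v" by (simp only: diff_conv_add_uminus)
qed

lemma Delta_pow: "poly_op T ((monom 1 1 - 1) ^ i) v = (Delta ^^ i) v"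
  by (simp only: poly_op_power poly_op_X_minus_1)

end

text \<open>Writing \<open>X\<close> as \<open>(X - 1) + 1\<close> keeps the sign of
  \<open>-1\<close> out of the Frobenius identity, so \<open>p = 2\<close> needs no separate
  case.\<close>

lemma X_minus_1_power_char:
  assumes "prime p" "CHAR('k::field) = p"
  shows "(monom 1 1 - 1 :: 'k poly) ^ (p ^ e) = monom 1 (p ^ e) - 1"
proof -
  have "(monom 1 1 - 1 + 1 :: 'k poly) ^ (p ^ e) = (monom 1 1 - 1) ^ (p ^ e) + 1 ^ (p ^ e)"
    by (rule freshmans_dream') (use assms in simp_all)
  then show ?thesis by (simp add: monom_power)
qed

text \<open>The sum is a geometric series in the \<open>p ^ b\<close>-th power of \<open>X\<close>;
  multiplied by \<open>(X - 1) ^ (p ^ b)\<close> it becomes \<open>(X - 1) ^ (p ^ a)\<close>, and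
  the factor cancels.\<close>

lemma sum_X_power_char:
  assumes p: "prime p" "CHAR('k::field) = p" and "b \<le> a"
  shows "(\<Sum>i<p ^ (a - b). monom 1 (p ^ b * i)) = (monom 1 1 - 1 :: 'k poly) ^ (p ^ a - p ^ b)"
proof -
  let ?X = "monom 1 1 :: 'k poly"
  have "p > 0" using p by (simp add: prime_gt_0_nat)
  have le: "p ^ b \<le> p ^ a" using assms \<open>p > 0\<close> by (intro power_increasing) auto
  have "(?X - 1) ^ (p ^ b) * (\<Sum>i<p ^ (a - b). monom 1 (p ^ b * i)) =
      (monom 1 (p ^ b) - 1) * (\<Sum>i<p ^ (a - b). monom 1 (p ^ b) ^ i)"
    unfolding X_minus_1_power_char[OF p] by (simp add: monom_power)
  also have "\<dots> = monom 1 (p ^ b) ^ (p ^ (a - b)) - 1" by (rule power_diff_1_eq[symmetric])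
  also have "\<dots> = (?X - 1) ^ (p ^ a)"
    unfolding X_minus_1_power_char[OF p] using \<open>b \<le> a\<close> by (simp add: monom_power flip: power_add)
  also have "\<dots> = (?X - 1) ^ (p ^ b) * (?X - 1) ^ (p ^ a - p ^ b)"
    using le by (simp flip: power_add)
  finally show ?thesis
  proof (rule mult_left_cancel[THEN iffD1, rotated])
    have "coeff (?X - 1) 1 \<noteq> 0" by (simp add: one_pCons)
    then show "(?X - 1) ^ (p ^ b) \<noteq> 0" by (metis coeff_0 power_not_zero)
  qed
qed

context linear_endo
begin

lemma Delta_pow_char:
  assumes "prime p" "CHAR('k) = p"
  shows "(Delta ^^ (p ^ e)) v = (T ^^ (p ^ e)) v - v"
proof -
  have "(Delta ^^ (p ^ e)) v = poly_op T (monom 1 (p ^ e) + monom (- 1) 0) v"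
  proof -
    have "monom (- 1) 0 = (- 1 :: 'k poly)" by (simp add: monom_0 one_pCons)
    then show ?thesis
      unfolding Delta_pow[symmetric] X_minus_1_power_char[OF assms] by simp
  qed
  then show ?thesis unfolding poly_op_add poly_op_monom by simp
qed

text \<open>The sum that defines a relative transfer becomes a power of \<open>Delta\<close>, which
  is a shift on a Jordan block. This turns the bounds on \<open>n\<close> into statements about
  transfers.\<close>

lemma sum_pow_char:
  assumes "prime p" "CHAR('k) = p" "b \<le> a"
  shows "(\<Sum>i<p ^ (a - b). (T ^^ (p ^ b * i)) v) = (Delta ^^ (p ^ a - p ^ b)) v"
  unfolding Delta_pow[symmetric] sum_X_power_char[OF assms, symmetric] poly_op_sum poly_op_monom by simp

end

text \<open>\<open>D\<close> maps the kernel of one power into the kernel of the preceding power,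
  and what it loses lies in its own kernel. Preimages of a basis of the image, together with a basis
  of the kernel of \<open>D\<close>, span.\<close>

lemma (in finite_dimensional_vector_space) dim_kernel_funpow_le:
  assumes "Vector_Spaces.linear scale scale D"
  shows "dim {v. (D ^^ n) v = 0} \<le> n * dim {v. D v = 0}"
proof -
  interpret D: Vector_Spaces.linear scale scale D by fact
  show ?thesis
  proof (induction n)
    case (Suc n)
    let ?U = "{v. (D ^^ Suc n) v = 0}" and ?W = "{v. (D ^^ n) v = 0}" and ?Z = "{v. D v = 0}"
    obtain C where C: "C \<subseteq> D ` ?U" "independent C" "D ` ?U \<subseteq> span C" "card C = dim (D ` ?U)"
      using basis_exists by blast
    obtain Z where Z: "Z \<subseteq> ?Z" "independent Z" "?Z \<subseteq> span Z" "card Z = dim ?Z"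
      using basis_exists by blast
    have fin: "finite C" "finite Z" using C Z finiteI_independent by auto
    obtain C' where "C' \<subseteq> ?U" "inj_on D C'" "C = D ` C'"
      using C(1) by (auto simp: subset_image_inj)
    then have C': "C' \<subseteq> ?U" "C = D ` C'" "card C' \<le> card C" "finite C'"
      using fin(1) by (auto simp: card_image finite_image_iff)
    have "?U \<subseteq> span (C' \<union> Z)"
    proof
      fix u assume "u \<in> ?U"
      then have "D u \<in> D ` span C'" using C(3) C'(2) D.span_image by auto
      then obtain x where x: "x \<in> span C'" "D x = D u" by auto
      then have "u - x \<in> span Z" using Z(3) by (auto simp: D.diff)
      then have "x + (u - x) \<in> span (C' \<union> Z)"
        using x(1) span_mono[of C' "C' \<union> Z"] span_mono[of Z "C' \<union> Z"] by (blast intro: span_add)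
      then show "u \<in> span (C' \<union> Z)" by simp
    qed
    then have "dim ?U \<le> card (C' \<union> Z)" using fin C' by (intro dim_le_card) auto
    also have "\<dots> \<le> card C' + card Z" by (rule card_Un_le)
    also have "\<dots> \<le> dim (D ` ?U) + dim ?Z" using C C' Z by simp
    also have "dim (D ` ?U) \<le> dim ?W"
      by (intro dim_subset) (auto simp: funpow_swap1)
    also have "dim ?W + dim ?Z \<le> Suc n * dim ?Z" using Suc by simp
    finally show ?case by simp
  qed simp
qed

section \<open>Degree, truncation and functoriality of the action on polynomials\<close>

section \<open>The symmetric algebra of the dual space\<close>

definition mdeg :: "('v \<Rightarrow>\<^sub>0 nat) \<Rightarrow> nat" where
  "mdeg m = (\<Sum>i\<in>Poly_Mapping.keys m. Poly_Mapping.lookup m i)"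

lemma mdeg_add: "mdeg (m + m') = mdeg m + mdeg m'"
proof -
  let ?S = "Poly_Mapping.keys m \<union> Poly_Mapping.keys m'"
  have *: "mdeg u = (\<Sum>i\<in>?S. Poly_Mapping.lookup u i)" if "Poly_Mapping.keys u \<subseteq> ?S" for u
    unfolding mdeg_def using that by (intro sum.mono_neutral_left) (auto simp: in_keys_iff)
  have "mdeg (m + m') = (\<Sum>i\<in>?S. Poly_Mapping.lookup (m + m') i)" by (intro *) (rule keys_add)
  then show ?thesis by (simp add: * lookup_add sum.distrib)
qed

lemma homogeneous_altdef: "homogeneous d = {f. \<forall>m\<in>Poly_Mapping.keys f. mdeg m = d}"
  by (simp add: homogeneous_def mdeg_def)

lemma mem_sym_dual: "f \<in> carrier (sym_dual B) \<longleftrightarrow> (\<forall>m\<in>Poly_Mapping.keys f. Poly_Mapping.keys m \<subseteq> B)"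
  by (simp add: sym_dual_def)

lemma homogeneous_mult:
  assumes "f \<in> homogeneous d" "g \<in> homogeneous e" shows "f * g \<in> homogeneous (d + e)"
  using assms keys_mult[of f g] by (fastforce simp: homogeneous_altdef mdeg_add)

lemma homogeneous_sum: "(\<And>j. j \<in> J \<Longrightarrow> f j \<in> homogeneous d) \<Longrightarrow> sum f J \<in> homogeneous d"
proof (induction J rule: infinite_finite_induct)
  case (insert j J)
  then show ?case using keys_add[of "f j" "sum f J"] by (fastforce simp: homogeneous_altdef)
qed (simp_all add: homogeneous_altdef)

lemma homogeneous_const: "const c \<in> homogeneous 0"
  by (simp add: homogeneous_altdef const_def mdeg_def)

lemma homogeneous_var: "var b \<in> homogeneous 1"
  by (simp add: homogeneous_altdef var_def mdeg_def)

lemma homogeneous_power: "f \<in> homogeneous d \<Longrightarrow> f ^ n \<in> homogeneous (n * d)"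
proof (induction n)
  case 0
  show ?case using homogeneous_const[of 1] by (simp add: const_1)
qed (simp add: homogeneous_mult)

lemma homogeneous_prod:
  "(\<And>j. j \<in> J \<Longrightarrow> f j \<in> homogeneous (d j)) \<Longrightarrow> prod f J \<in> homogeneous (sum d J)"
proof (induction J rule: infinite_finite_induct)
  case (insert j J)
  then show ?case by (simp add: homogeneous_mult)
qed (use homogeneous_const[of 1] in \<open>simp_all add: const_1\<close>)

lemma homogeneous_linear_form: "linear_form B \<phi> \<in> homogeneous 1"
  unfolding linear_form_def
  using homogeneous_mult[OF homogeneous_const homogeneous_var] by (intro homogeneous_sum) simp

lemma subring_sym_dual: "subring_set (carrier (sym_dual B) :: ('v, 'k::field) mpoly set)"
proof
  fix f g :: "('v, 'k) mpoly"
  assume "f \<in> carrier (sym_dual B)" "g \<in> carrier (sym_dual B)"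
  note fg = this[unfolded mem_sym_dual]
  show "f + g \<in> carrier (sym_dual B)"
    using fg keys_add[of f g] by (auto simp: mem_sym_dual)
  show "f * g \<in> carrier (sym_dual B)"
    unfolding mem_sym_dual
  proof
    fix m assume "m \<in> Poly_Mapping.keys (f * g)"
    then obtain a b where "m = a + b" "a \<in> Poly_Mapping.keys f" "b \<in> Poly_Mapping.keys g"
      using keys_mult[of f g] by blast
    then show "Poly_Mapping.keys m \<subseteq> B" using fg keys_add[of a b] by blast
  qed
qed (simp_all add: mem_sym_dual)

lemma const_in_sym_dual: "const c \<in> carrier (sym_dual B)"
  by (simp add: mem_sym_dual const_def)

lemma var_in_sym_dual: "b \<in> B \<Longrightarrow> var b \<in> carrier (sym_dual B)"
  by (simp add: mem_sym_dual var_def)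

lemma linear_form_in_sym_dual: "linear_form B \<phi> \<in> carrier (sym_dual B)"
proof -
  interpret subring_set "carrier (sym_dual B) :: ('a, 'b) mpoly set" by (rule subring_sym_dual)
  show ?thesis
    unfolding linear_form_def by (intro sum_mem mult_mem const_in_sym_dual var_in_sym_dual)
qed

lemma var_power: "var i ^ e = Poly_Mapping.single (Poly_Mapping.single i e) 1"
  by (induction e) (simp_all add: var_def mult_single flip: single_add)

lemma prod_var_power:
  "(\<Prod>i\<in>K. var i ^ e i) = Poly_Mapping.single (\<Sum>i\<in>K. Poly_Mapping.single i (e i)) 1"
  by (induction K rule: infinite_finite_induct) (simp_all add: var_power mult_single)

lemma single_expand:
  "Poly_Mapping.single m c =
     const c * (\<Prod>i\<in>Poly_Mapping.keys m. var i ^ Poly_Mapping.lookup m i)"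
proof -
  have "(\<Sum>i\<in>Poly_Mapping.keys m. Poly_Mapping.single i (Poly_Mapping.lookup m i)) = m"
    by (rule poly_mapping_eqI) (simp add: lookup_sum lookup_single when_def in_keys_iff)
  then show ?thesis by (simp add: prod_var_power const_def mult_single)
qed

lemma sym_dual_induct [consumes 1, case_names const var add mult]:
  assumes f: "f \<in> carrier (sym_dual B)"
    and const: "\<And>c. Q (const c)" and var: "\<And>b. b \<in> B \<Longrightarrow> Q (var b)"
    and add: "\<And>f g. f \<in> carrier (sym_dual B) \<Longrightarrow> g \<in> carrier (sym_dual B) \<Longrightarrow> Q f \<Longrightarrow> Q g \<Longrightarrow> Q (f + g)"
    and mult: "\<And>f g. f \<in> carrier (sym_dual B) \<Longrightarrow> g \<in> carrier (sym_dual B) \<Longrightarrow> Q f \<Longrightarrow> Q g \<Longrightarrow> Q (f * g)"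
  shows "Q f"
proof -
  let ?S = "carrier (sym_dual B) :: ('a, 'b) mpoly set"
  note step = add mult
  interpret subring_set ?S by (rule subring_sym_dual)
  define R where "R f \<longleftrightarrow> f \<in> ?S \<and> Q f" for f
  have R0: "R 0" and R1: "R 1"
    using const[of 0] const[of 1] zero_mem one_mem by (simp_all add: R_def const_0 const_1)
  have Rmult: "R f \<Longrightarrow> R g \<Longrightarrow> R (f * g)" and Radd: "R f \<Longrightarrow> R g \<Longrightarrow> R (f + g)" for f g
    using step mult_mem add_mem by (auto simp: R_def)
  have Rpow: "R f \<Longrightarrow> R (f ^ n)" for f n
    by (induction n) (auto simp: R1 Rmult)
  have Rprod: "(\<And>j. j \<in> J \<Longrightarrow> R (h j)) \<Longrightarrow> R (prod h J)" for h :: "_ \<Rightarrow> _" and J :: "'a set"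
    by (induction J rule: infinite_finite_induct) (auto simp: R1 Rmult)
  have Rsum: "(\<And>j. j \<in> J \<Longrightarrow> R (h j)) \<Longrightarrow> R (sum h J)" for h :: "_ \<Rightarrow> _" and J :: "('a \<Rightarrow>\<^sub>0 nat) set"
    by (induction J rule: infinite_finite_induct) (auto simp: R0 Radd)
  have "R (Poly_Mapping.single m (Poly_Mapping.lookup f m))" if "m \<in> Poly_Mapping.keys f" for m
  proof -
    have "Poly_Mapping.keys m \<subseteq> B" using f that by (simp add: mem_sym_dual)
    then have "R (var i)" if "i \<in> Poly_Mapping.keys m" for i
      using that var var_in_sym_dual[of i B, where 'b='b] by (auto simp: R_def)
    moreover have "R (const c)" for c using const const_in_sym_dual by (auto simp: R_def)
    ultimately show ?thesis unfolding single_expand by (intro Rmult Rprod Rpow)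
  qed
  then have "R (\<Sum>m\<in>Poly_Mapping.keys f. Poly_Mapping.single m (Poly_Mapping.lookup f m))"
    by (rule Rsum)
  then show ?thesis by (simp flip: mpoly_expand add: R_def)
qed

lemma act_hom:
  "act s B g (f + h) = act s B g f + act s B g h" "act s B g (f * h) = act s B g f * act s B g h"
  "act s B g (const c) = const c" "act s B g 0 = 0" "act s B g 1 = 1"
  "act s B g (var b) = linear_form B (coordinate s B b \<circ> inv_into UNIV g)"
proof -
  show c: "act s B g (const c) = const c" for c
    by (simp add: act_def peval_const const_0)
  show "act s B g 1 = 1" using c[of 1] by (simp add: const_1)
qed (simp_all add: act_def peval_add peval_mult peval_zero peval_var const_0 const_1 const_add const_mult)

lemma act_in_sym_dual: "act s B g f \<in> carrier (sym_dual B)"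
proof -
  interpret subring_set "carrier (sym_dual B) :: ('a, 'b) mpoly set" by (rule subring_sym_dual)
  show ?thesis
    unfolding act_def peval_def
    by (intro sum_mem mult_mem prod_mem power_mem const_in_sym_dual linear_form_in_sym_dual)
qed

text \<open>Each variable is sent to a linear form, so a monomial spreads only over monomials of its
  own degree.\<close>

lemma act_keys_degree:
  assumes "m \<in> Poly_Mapping.keys (act s B g f)"
  shows "\<exists>m'\<in>Poly_Mapping.keys f. mdeg m = mdeg m'"
proof -
  let ?t = "\<lambda>m. const (Poly_Mapping.lookup f m) * (\<Prod>i\<in>Poly_Mapping.keys m.
      linear_form B (coordinate s B i \<circ> inv_into UNIV g) ^ Poly_Mapping.lookup m i)"
  have "?t m \<in> homogeneous (mdeg m)" for m
  proof -
    have "?t m \<in> homogeneous (0 + (\<Sum>i\<in>Poly_Mapping.keys m. Poly_Mapping.lookup m i * 1))"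
      by (intro homogeneous_mult homogeneous_const homogeneous_prod homogeneous_power homogeneous_linear_form)
    then show ?thesis by (simp add: mdeg_def)
  qed
  moreover have "\<exists>m'\<in>Poly_Mapping.keys f. m \<in> Poly_Mapping.keys (?t m')"
    using assms keys_sum[of ?t "Poly_Mapping.keys f"] unfolding act_def peval_def by blast
  ultimately show ?thesis unfolding homogeneous_altdef by blast
qed

text \<open>Truncation stands in for the decomposition into homogeneous components: it is additive
  and commutes with the action, hence with every transfer.\<close>

definition low_part :: "nat \<Rightarrow> ('v, 'k::field) mpoly \<Rightarrow> ('v, 'k) mpoly" where
  "low_part N f = (\<Sum>m\<in>{m\<in>Poly_Mapping.keys f. mdeg m < N}. Poly_Mapping.single m (Poly_Mapping.lookup f m))"

lemma lookup_low_part: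
  "Poly_Mapping.lookup (low_part N f) m = (if mdeg m < N then Poly_Mapping.lookup f m else 0)"
  unfolding low_part_def by (simp add: lookup_sum lookup_single when_def in_keys_iff)

lemma low_part_add: "low_part N (f + g) = low_part N f + low_part N g"
  by (rule poly_mapping_eqI) (simp add: lookup_low_part lookup_add)

lemma low_part_sum: "low_part N (sum f J) = (\<Sum>j\<in>J. low_part N (f j))"
proof -
  have "low_part N 0 = 0" by (rule poly_mapping_eqI) (simp add: lookup_low_part)
  then show ?thesis
    by (induction J rule: infinite_finite_induct) (simp_all add: low_part_add)
qed

lemma low_part_in_sym_dual: "f \<in> carrier (sym_dual B) \<Longrightarrow> low_part N f \<in> carrier (sym_dual B)"
  by (auto simp: mem_sym_dual in_keys_iff lookup_low_part split: if_splits)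

lemma low_part_eq_self: "\<forall>m\<in>Poly_Mapping.keys f. mdeg m < N \<Longrightarrow> low_part N f = f"
  by (rule poly_mapping_eqI) (auto simp: lookup_low_part in_keys_iff)

lemma low_part_eq_0: "\<forall>m\<in>Poly_Mapping.keys f. N \<le> mdeg m \<Longrightarrow> low_part N f = 0"
  by (rule poly_mapping_eqI) (metis in_keys_iff lookup_low_part lookup_zero not_le)

lemma low_part_act: "low_part N (act s B g f) = act s B g (low_part N f)"
proof -
  have "f = low_part N f + (f - low_part N f)" by simp
  then have "act s B g f = act s B g (low_part N f) + act s B g (f - low_part N f)"
    by (metis act_hom(1))
  moreover have "\<forall>m\<in>Poly_Mapping.keys (low_part N f). mdeg m < N"
    "\<forall>m\<in>Poly_Mapping.keys (f - low_part N f). N \<le> mdeg m"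
    by (auto simp: in_keys_iff lookup_low_part lookup_minus split: if_splits)
  then have "\<forall>m\<in>Poly_Mapping.keys (act s B g (low_part N f)). mdeg m < N"
    "\<forall>m\<in>Poly_Mapping.keys (act s B g (f - low_part N f)). N \<le> mdeg m"
    using act_keys_degree by metis+
  then have "low_part N (act s B g (low_part N f)) = act s B g (low_part N f)"
    "low_part N (act s B g (f - low_part N f)) = 0"
    by (auto intro: low_part_eq_self low_part_eq_0)
  ultimately show ?thesis by (simp add: low_part_add)
qed

lemma low_part_act_funpow: "low_part N ((act s B g ^^ i) f) = (act s B g ^^ i) (low_part N f)"
  by (induction i) (simp_all add: low_part_act)

lemma ex_degree_bound: "\<exists>N. \<forall>m\<in>Poly_Mapping.keys f. mdeg m < N"
proof
  show "\<forall>m\<in>Poly_Mapping.keys f. mdeg m < Suc (\<Sum>m\<in>Poly_Mapping.keys f. mdeg m)"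
    using member_le_sum[of _ "Poly_Mapping.keys f" mdeg] by (auto simp: less_Suc_eq_le)
qed

lemma act_comp:
  fixes s :: "'k::field \<Rightarrow> 'v::ab_group_add \<Rightarrow> 'v"
  assumes V: "finite_dimensional_vector_space s B" and g: "g \<in> carrier (GL s)" and h: "h \<in> carrier (GL s)"
    and f: "f \<in> carrier (sym_dual B)"
  shows "act s B (g \<circ> h) f = act s B g (act s B h f)"
  using f
proof (induction rule: sym_dual_induct)
  case (var b)
  have "bij g" "bij h" using g h by (auto simp: GL_def)
  then have "inv_into UNIV (g \<circ> h) = inv_into UNIV h \<circ> inv_into UNIV g" by (rule o_inv_distrib)
  then show ?case
    by (simp only: act_hom act_linear_form[OF V g linear_coordinate_inv[OF V h]] comp_assoc)
qed (simp_all add: act_hom)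

lemma act_id:
  fixes s :: "'k::field \<Rightarrow> 'v::ab_group_add \<Rightarrow> 'v"
  assumes V: "finite_dimensional_vector_space s B" and f: "f \<in> carrier (sym_dual B)"
  shows "act s B id f = f"
  using f
proof (induction rule: sym_dual_induct)
  case (var b)
  interpret finite_dimensional_vector_space s B by (rule V)
  have "linear_form B (coordinate s B b) = (\<Sum>c\<in>B. const (if c = b then 1 else 0) * var c)"
    unfolding linear_form_def coordinate_def
    by (intro sum.cong) (auto simp: representation_basis independent_Basis)
  also have "\<dots> = (\<Sum>c\<in>{b}. const (if c = b then 1 else 0) * var c)"
    using var finite_Basis by (intro sum.mono_neutral_right) (auto simp: const_0)
  finally show ?case by (simp only: act_hom inv_id comp_id if_True const_1) (simp add: const_1)
qed (simp_all add: act_hom)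

lemma funpow_GL: "g \<in> carrier (GL s) \<Longrightarrow> vector_space s \<Longrightarrow> (g ^^ i) \<in> carrier (GL s)"
proof (induction i)
  case 0
  then interpret vector_space s by simp
  show ?case unfolding funpow.simps(1) GL_def by (simp add: linear_id del: id_apply)
next
  case (Suc i)
  then have "Vector_Spaces.linear s s (g \<circ> g ^^ i)" "bij (g \<circ> g ^^ i)"
    by (auto simp: GL_def intro: Vector_Spaces.linear_compose bij_comp)
  then show ?case unfolding funpow.simps(2) GL_def partial_object.simps by blast
qed

lemma act_funpow:
  fixes s :: "'k::field \<Rightarrow> 'v::ab_group_add \<Rightarrow> 'v"
  assumes V: "finite_dimensional_vector_space s B" and g: "g \<in> carrier (GL s)"
    and f: "f \<in> carrier (sym_dual B)"
  shows "act s B (g ^^ i) f = (act s B g ^^ i) f"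
proof (induction i)
  case 0
  show ?case using act_id[OF V f] by (simp add: id_def)
next
  case (Suc i)
  interpret finite_dimensional_vector_space s B by (rule V)
  show ?case
    using act_comp[OF V g funpow_GL[OF g vector_space_axioms] f, of i] Suc
    unfolding funpow.simps(2) comp_def by simp
qed

lemma linear_form_add: "linear_form B (\<lambda>v. \<phi> v + \<psi> v) = linear_form B \<phi> + linear_form B \<psi>"
  by (simp add: linear_form_def const_add distrib_right sum.distrib)

lemma linear_form_scale: "linear_form B (\<lambda>v. c * \<phi> v) = const c * linear_form B \<phi>"
  by (simp add: linear_form_def const_mult sum_distrib_left mult.assoc)

lemma linear_form_sum:
  "linear_form B (\<lambda>v. \<Sum>j\<in>J. \<phi> j v) = (\<Sum>j\<in>J. linear_form B (\<phi> j))"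
  by (induction J rule: infinite_finite_induct)
    (simp_all add: linear_form_add, simp_all add: linear_form_def const_0)

section \<open>From quotient rings and cosets to ideals and representatives\<close>

section \<open>Quotients of subrings\<close>

context subring_set
begin

abbreviation as_ring :: "'a ring" where
  "as_ring \<equiv> \<lparr>carrier = A, mult = (*), one = 1, zero = 0, add = (+)\<rparr>"

lemma cring_as_ring: "cring as_ring"
proof (rule cringI)
  show "abelian_group as_ring"
  proof (rule abelian_groupI)
    fix x assume "x \<in> carrier as_ring"
    then show "\<exists>y\<in>carrier as_ring. y \<oplus>\<^bsub>as_ring\<^esub> x = \<zero>\<^bsub>as_ring\<^esub>"
      by (auto intro!: bexI[of _ "- x"] uminus_mem)
  qed (auto simp: zero_mem add_mem add_ac)
  show "comm_monoid as_ring"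
    by (rule comm_monoidI) (auto simp: one_mem mult_mem mult_ac)
qed (auto simp: distrib_right)

lemma ideal_as_ring:
  assumes "ideal_of I" shows "ideal I as_ring"
proof (rule idealI)
  show "ring as_ring" using cring_as_ring by (rule cring.axioms)
  interpret cring as_ring by (rule cring_as_ring)
  show "subgroup I (add_monoid as_ring)"
  proof (rule group.subgroupI)
    show "Group.group (add_monoid as_ring)" by (rule add.group_axioms)
    fix x assume x: "x \<in> I"
    then have xA: "x \<in> A" using ideal_ofD(1)[OF assms] by blast
    have "inv\<^bsub>add_monoid as_ring\<^esub> x = - x"
      by (rule group.inv_equality[OF add.group_axioms]) (use xA uminus_mem in auto)
    then show "inv\<^bsub>add_monoid as_ring\<^esub> x \<in> I" using ideal_of_uminus[OF assms x] by simp
  qed (use ideal_ofD[OF assms] in auto)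
qed (auto simp: ideal_ofD[OF assms])

lemma mem_coset_as_ring: "z \<in> I +>\<^bsub>as_ring\<^esub> y \<longleftrightarrow> (\<exists>i\<in>I. z = i + y)"
  by (auto simp: a_r_coset_def')

lemma foldl_adjoin:
  assumes "ideal_of I" "set fs \<subseteq> A"
  shows "ideal_of (foldl adjoin I fs)" "I \<subseteq> foldl adjoin I fs" "set fs \<subseteq> foldl adjoin I fs"
proof -
  have "ideal_of (foldl adjoin I fs) \<and> I \<subseteq> foldl adjoin I fs \<and> set fs \<subseteq> foldl adjoin I fs"
    using assms
  proof (induction fs arbitrary: I)
    case (Cons f fs)
    then have "ideal_of (adjoin I f)" "f \<in> adjoin I f" "I \<subseteq> adjoin I f"
      by (auto intro: ideal_of_adjoin mem_adjoin subset_adjoin[THEN subsetD])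
    with Cons.IH[of "adjoin I f"] Cons.prems show ?case by auto
  qed auto
  then show "ideal_of (foldl adjoin I fs)" "I \<subseteq> foldl adjoin I fs" "set fs \<subseteq> foldl adjoin I fs"
    by auto
qed

lemma reg_modI:
  assumes "\<And>i z. i < length fs \<Longrightarrow> z \<in> A \<Longrightarrow> fs ! i * z \<in> foldl adjoin I (take i fs) \<Longrightarrow>
      z \<in> foldl adjoin I (take i fs)"
  shows "reg_mod I fs"
  using assms
proof (induction fs arbitrary: I)
  case (Cons f fs)
  have "\<forall>z\<in>A. f * z \<in> I \<longrightarrow> z \<in> I" using Cons.prems[of 0] by auto
  moreover have "reg_mod (adjoin I f) fs" using Cons.prems[of "Suc _"] by (intro Cons.IH) auto
  ultimately show ?case by simp
qed simp

text \<open>\<open>foldl adjoin I fs\<close> is the preimage of the ideal generated by the cosets.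
  One inclusion is minimality of the generated ideal; for the other, any ideal containing these
  cosets absorbs the generators one by one.\<close>

lemma coset_mem_genideal_iff:
  assumes I: "ideal_of I" and fs: "set fs \<subseteq> A" and y: "y \<in> A"
  shows "I +>\<^bsub>as_ring\<^esub> y \<in> genideal (as_ring Quot I) (set (map ((+>\<^bsub>as_ring\<^esub>) I) fs)) \<longleftrightarrow>
           y \<in> foldl adjoin I fs"
proof
  let ?Q = "as_ring Quot I" and ?c = "(+>\<^bsub>as_ring\<^esub>) I" and ?q = "foldl adjoin I fs"
  interpret R: cring as_ring by (rule cring_as_ring)
  interpret I: ideal I as_ring by (rule ideal_as_ring[OF I])
  interpret Q: cring ?Q by (rule I.quotient_is_cring[OF cring_as_ring])
  interpret h: ring_hom_ring as_ring ?Q ?c by (rule I.rcos_ring_hom_ring)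
  note q = foldl_adjoin[OF I fs]
  have cl: "set (map ?c fs) \<subseteq> carrier ?Q" using fs h.hom_closed by auto
  {
    assume "?c y \<in> genideal ?Q (set (map ?c fs))"
    moreover have "genideal ?Q (set (map ?c fs)) \<subseteq> ?c ` ?q"
      using q(3) by (intro Q.genideal_minimal R.ring_ideal_imp_quot_ideal ideal_as_ring q(1) I) auto
    ultimately obtain y' where y': "y' \<in> ?q" "?c y = ?c y'" by blast
    have "y \<in> ?c y" using ideal_ofD(2)[OF I] by (auto simp: mem_coset_as_ring)
    then obtain i where "i \<in> I" "y = i + y'" using y'(2) by (auto simp: mem_coset_as_ring)
    then show "y \<in> ?q" using q(2) y'(1) ideal_ofD(3)[OF q(1)] by blast
  }
  have *: "\<forall>y\<in>foldl adjoin I' gs. ?c y \<in> J"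
    if "ideal J ?Q" "set gs \<subseteq> A" "ideal_of I'" "\<forall>y\<in>I'. ?c y \<in> J" "set (map ?c gs) \<subseteq> J" for J gs I'
    using that
  proof (induction gs arbitrary: I')
    case (Cons g gs)
    interpret J: ideal J ?Q by fact
    have "?c y \<in> J" if "y \<in> adjoin I' g" for y
    proof -
      obtain i z where iz: "y = i + g * z" "i \<in> I'" "z \<in> A" using \<open>y \<in> adjoin I' g\<close> by (auto simp: adjoin_def)
      have g: "g \<in> A" and i: "i \<in> A" using Cons.prems iz ideal_ofD(1) by auto
      have "?c y = ?c i \<oplus>\<^bsub>?Q\<^esub> (?c g \<otimes>\<^bsub>?Q\<^esub> ?c z)"
        using h.hom_add[of i "g * z"] h.hom_mult[of g z] iz g i mult_mem by simp
      then show ?thesis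
        using Cons.prems iz J.a_closed[OF _ J.I_r_closed[OF _ h.hom_closed[of z]]] by simp
    qed
    then show ?case
      using Cons.prems Cons.IH[of "adjoin I' g"] ideal_of_adjoin[OF Cons.prems(3), of g] by simp
  qed simp
  have "?c i \<in> genideal ?Q (set (map ?c fs))" if "i \<in> I" for i
  proof -
    interpret J: ideal "genideal ?Q (set (map ?c fs))" ?Q by (rule Q.genideal_ideal[OF cl])
    have "?c i = ?c 0"
    proof (rule Set.set_eqI)
      fix z
      have "z - i \<in> I \<longleftrightarrow> z \<in> I"
        using ideal_of_diff[OF I, of z i] ideal_ofD(3)[OF I, of "z - i" i] that by auto
      moreover have "(\<exists>j\<in>I. z = j + i) \<longleftrightarrow> z - i \<in> I"
        by (metis add_diff_cancel_right' diff_add_cancel)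
      ultimately show "z \<in> ?c i \<longleftrightarrow> z \<in> ?c 0" by (auto simp: mem_coset_as_ring)
    qed
    then show ?thesis using h.hom_zero J.zero_closed by simp
  qed
  then show "?c y \<in> genideal ?Q (set (map ?c fs))" if "y \<in> ?q"
    using *[OF Q.genideal_ideal[OF cl] fs I _ Q.genideal_self[OF cl]] that by blast
qed

lemma reg_mod_if_regular_sequence:
  assumes I: "ideal_of I" and fs: "set fs \<subseteq> A"
    and reg: "regular_sequence (as_ring Quot I) (map ((+>\<^bsub>as_ring\<^esub>) I) fs)"
  shows "reg_mod I fs"
proof (rule reg_modI)
  let ?Q = "as_ring Quot I" and ?c = "(+>\<^bsub>as_ring\<^esub>) I"
  fix i z assume i: "i < length fs" and z: "z \<in> A" and m: "fs ! i * z \<in> foldl adjoin I (take i fs)"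
  interpret I: ideal I as_ring by (rule ideal_as_ring[OF I])
  interpret h: ring_hom_ring as_ring ?Q ?c by (rule I.rcos_ring_hom_ring)
  have fi: "fs ! i \<in> A" using i fs by auto
  have t: "set (take i fs) \<subseteq> A" using fs set_take_subset[of i fs] by blast
  have "?c (fs ! i * z) \<in> genideal ?Q (set (map ?c (take i fs)))"
    using coset_mem_genideal_iff[OF I t] m mult_mem[OF fi z] by blast
  then have "map ?c fs ! i \<otimes>\<^bsub>?Q\<^esub> ?c z \<in> genideal ?Q (set (take i (map ?c fs)))"
    using h.hom_mult[of "fs ! i" z] fi z i by (simp add: take_map)
  then have "?c z \<in> genideal ?Q (set (take i (map ?c fs)))"
    using reg i h.hom_closed[of z] z unfolding regular_sequence_def by simp
  then show "z \<in> foldl adjoin I (take i fs)"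
    using coset_mem_genideal_iff[OF I t z] by (simp add: take_map)
qed

text \<open>Representatives are chosen summand by summand and added. The set \<open>H\<close> is
  later the set of polynomials without constant term.\<close>

lemma positive_part_quotient:
  assumes I: "ideal_of I"
    and x: "x \<in> positive_part (as_ring Quot I) (\<lambda>d. (\<lambda>f. I +>\<^bsub>as_ring\<^esub> f) ` (A \<inter> D d))"
    and H: "0 \<in> H" "\<And>f g. f \<in> H \<Longrightarrow> g \<in> H \<Longrightarrow> f + g \<in> H" "\<And>d. 0 < d \<Longrightarrow> D d \<subseteq> H"
  shows "\<exists>f\<in>A \<inter> H. x = I +>\<^bsub>as_ring\<^esub> f"
proof -
  let ?Q = "as_ring Quot I" and ?c = "(+>\<^bsub>as_ring\<^esub>) I"
  interpret I: ideal I as_ring by (rule ideal_as_ring[OF I])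
  interpret Q: cring ?Q by (rule I.quotient_is_cring[OF cring_as_ring])
  interpret h: ring_hom_ring as_ring ?Q ?c by (rule I.rcos_ring_hom_ring)
  obtain n u where u: "x = finsum ?Q u {1..n}" "u \<in> Pi {1..n} (\<lambda>d. ?c ` (A \<inter> D d))"
    using x by (auto simp: positive_part_def)
  have "\<exists>f\<in>A \<inter> H. finsum ?Q u {1..n} = ?c f" using u(2)
  proof (induction n)
    case 0
    then show ?case using H zero_mem h.hom_zero by (intro bexI[of _ 0]) auto
  next
    case (Suc n)
    have eq: "{1..Suc n} = insert (Suc n) {1..n}" by auto
    obtain f where f: "f \<in> A" "f \<in> H" "finsum ?Q u {1..n} = ?c f" using Suc by (auto simp: Pi_iff)
    obtain g where g: "g \<in> A" "g \<in> D (Suc n)" "u (Suc n) = ?c g"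
      using Pi_mem[OF Suc.prems, of "Suc n"] by auto
    have ucl: "u \<in> {1..n} \<rightarrow> carrier ?Q"
    proof
      fix i assume "i \<in> {1..n}"
      then obtain g where "g \<in> A" "u i = ?c g" using Pi_mem[OF Suc.prems, of i] by auto
      then show "u i \<in> carrier ?Q" using h.hom_closed[of g] by simp
    qed
    have "finsum ?Q u {1..Suc n} = u (Suc n) \<oplus>\<^bsub>?Q\<^esub> finsum ?Q u {1..n}"
      unfolding eq using ucl g h.hom_closed[of g] by (subst Q.finsum_insert) auto
    also have "\<dots> = ?c (g + f)" using f g h.hom_add[of g f] by simp
    finally show ?case using f g H(2) H(3)[of "Suc n"] add_mem by (intro bexI[of _ "g + f"]) auto
  qed
  then show ?thesis using u(1) by simp
qed

end

section \<open>Linear forms modulo inertia, and the socle of a Jordan summand\<close>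

section \<open>Linear forms and Jordan summands\<close>

lemma coefficient_subring_sym_dual: "coefficient_subring (carrier (sym_dual B)) const"
  by (intro coefficient_subring.intro subring_sym_dual)
    (unfold_locales, simp_all add: const_0 const_1 const_add const_mult const_in_sym_dual)

lemma linear_form_coordinate:
  fixes s :: "'k::field \<Rightarrow> 'v::ab_group_add \<Rightarrow> 'v"
  assumes V: "finite_dimensional_vector_space s B" and "b \<in> B"
  shows "linear_form B (coordinate s B b) = var b"
  using act_id[OF V var_in_sym_dual[OF assms(2)]] by (simp only: act_hom inv_id comp_id)

lemma linear_functional_iff:
  fixes s :: "'k::field \<Rightarrow> 'v::ab_group_add \<Rightarrow> 'v"
  assumes "vector_space s"
  shows "Vector_Spaces.linear s (*) \<phi> \<longleftrightarrow>
    (\<forall>v w. \<phi> (v + w) = \<phi> v + \<phi> w) \<and> (\<forall>c v. \<phi> (s c v) = c * \<phi> v)"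
proof -
  have "vector_space ((*) :: 'k \<Rightarrow> 'k \<Rightarrow> 'k)"
    by unfold_locales (auto simp: algebra_simps)
  then show ?thesis using assms by (simp add: Vector_Spaces.linear_iff)
qed

text \<open>The fixed space is the kernel of the identity minus the inverse of
  \<open>\<tau>\<close>. A functional that vanishes on it factors through this map, and composing
  with a right inverse on the range gives the factor.\<close>

lemma linear_forms_vanishing_on_fixed_space:
  fixes s :: "'k::field \<Rightarrow> 'v::ab_group_add \<Rightarrow> 'v"
  assumes V: "finite_dimensional_vector_space s B" and \<tau>: "\<tau> \<in> carrier (GL s)"
    and \<psi>: "Vector_Spaces.linear s (*) \<psi>" "\<And>v. v \<in> fixed_space {\<tau>} \<Longrightarrow> \<psi> v = 0"
  shows "\<exists>\<psi>'. linear_form B \<psi> = linear_form B \<psi>' - act s B \<tau> (linear_form B \<psi>')"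
proof -
  interpret finite_dimensional_vector_space s B by (rule V)
  interpret vector_space_pair s s by unfold_locales
  interpret \<psi>: Vector_Spaces.linear s "(*)" \<psi> by (rule \<psi>(1))
  let ?\<rho> = "inv_into UNIV \<tau>"
  interpret \<rho>: Vector_Spaces.linear s s ?\<rho> by (rule linear_inv_GL[OF \<tau>])
  have bij: "bij \<tau>" using \<tau> by (simp add: GL_def)
  define T where "T v = v - ?\<rho> v" for v
  have T: "Vector_Spaces.linear s s T"
    using vector_space_axioms
    by (simp add: Vector_Spaces.linear_iff T_def \<rho>.add \<rho>.scale scale_right_diff_distrib)
  then obtain g where g: "Vector_Spaces.linear s s g" "\<And>v. T (g (T v)) = T v"
    using linear_exists_right_inverse_on[OF T subspace_UNIV] by auto
  interpret T: Vector_Spaces.linear s s T by (rule T)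
  have \<psi>g: "\<psi> (g (T v)) = \<psi> v" for v
  proof -
    have "T (v - g (T v)) = 0" using g(2) by (simp add: T.diff)
    then have "v - g (T v) = ?\<rho> (v - g (T v))" by (simp add: T_def)
    then have "\<tau> (v - g (T v)) = v - g (T v)"
      using bij by (metis bij_is_surj surj_f_inv_f)
    then have "\<psi> (v - g (T v)) = 0" by (intro \<psi>(2)) (simp add: fixed_space_def)
    then show ?thesis by (simp add: \<psi>.diff)
  qed
  let ?\<psi>' = "\<psi> \<circ> g"
  have lin: "Vector_Spaces.linear s (*) ?\<psi>'" by (rule Vector_Spaces.linear_compose[OF g(1) \<psi>(1)])
  interpret \<psi>': Vector_Spaces.linear s "(*)" ?\<psi>' by (rule lin)
  have "linear_form B ?\<psi>' = linear_form B (\<lambda>v. \<psi> v + (?\<psi>' \<circ> ?\<rho>) v)"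
  proof (rule arg_cong[where f="linear_form B"], rule ext)
    fix v
    have "\<psi> v = ?\<psi>' v - ?\<psi>' (?\<rho> v)" using \<psi>g[of v] \<psi>'.diff[of v "?\<rho> v"] by (simp add: T_def)
    then show "?\<psi>' v = \<psi> v + (?\<psi>' \<circ> ?\<rho>) v" by simp
  qed
  then have "linear_form B \<psi> = linear_form B ?\<psi>' - act s B \<tau> (linear_form B ?\<psi>')"
    unfolding act_linear_form[OF V \<tau> lin]
    using linear_form_add[of B \<psi> "?\<psi>' \<circ> ?\<rho>"] by (metis add_diff_cancel_right')
  then show ?thesis by blast
qed

text \<open>Modulo \<open>P\<close> a linear form depends only on its restriction to the fixed space
  of \<open>\<tau>\<close>, so functionals dual to a basis of that space generate.\<close>

lemma linear_forms_generate_mod_inertia: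
  fixes s :: "'k::field \<Rightarrow> 'v::ab_group_add \<Rightarrow> 'v"
  assumes V: "finite_dimensional_vector_space s B" and \<tau>: "\<tau> \<in> carrier (GL s)"
  shows "\<exists>ws. length ws = vector_space.dim s (fixed_space {\<tau>}) \<and> set ws \<subseteq> carrier (sym_dual B) \<and>
    (\<forall>P f. subring_set.ideal_of (carrier (sym_dual B)) P \<longrightarrow>
       (\<forall>a\<in>carrier (sym_dual B). a - act s B \<tau> a \<in> P) \<longrightarrow> f \<in> carrier (sym_dual B) \<longrightarrow>
       (\<exists>E. coefficient_subring.reducible_to (carrier (sym_dual B)) const P ws E f))"
proof -
  let ?S = "carrier (sym_dual B) :: ('v, 'k) mpoly set"
  interpret finite_dimensional_vector_space s B by (rule V)
  interpret cs: coefficient_subring ?S const by (rule coefficient_subring_sym_dual)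
  let ?W = "fixed_space {\<tau>}"
  obtain C where C: "C \<subseteq> ?W" "independent C" "?W \<subseteq> span C" "card C = dim ?W"
    using basis_exists by blast
  have finC: "finite C" using C(2) by (rule finiteI_independent)
  \<comment> \<open>The dual functionals have to be defined on the whole space; an extended basis
    supplies them.\<close>
  let ?E = "extend_basis C"
  have E: "independent ?E" "span ?E = UNIV" "C \<subseteq> ?E"
    using independent_extend_basis[OF C(2)] span_extend_basis[OF C(2)] extend_basis_superset[OF C(2)] by auto
  define dual where "dual c v = representation ?E v c" for c v
  have dual: "dual c (v + w) = dual c v + dual c w" "dual c (s x v) = x * dual c v" for c v w x
    by (simp_all add: dual_def representation_add representation_scale E)
  have expand: "\<phi> v = (\<Sum>c\<in>C. \<phi> c * dual c v)"
    if "v \<in> ?W" and \<phi>: "Vector_Spaces.linear s (*) \<phi>" for \<phi> v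
  proof -
    interpret \<phi>: Vector_Spaces.linear s "(*)" \<phi> by (rule \<phi>)
    have v: "v \<in> span C" using C(3) that by blast
    have "\<phi> v = \<phi> (\<Sum>c\<in>C. s (representation C v c) c)"
      by (simp add: sum_representation_eq[OF C(2) v finC])
    also have "representation C v = representation ?E v"
      by (rule representation_extend[OF E(1) v E(3), symmetric])
    finally show ?thesis by (simp add: \<phi>.sum \<phi>.scale dual_def mult.commute)
  qed
  obtain cl where cl: "set cl = C" "distinct cl" using finite_distinct_list[OF finC] by blast
  let ?ws = "map (\<lambda>c. linear_form B (dual c)) cl"
  have len: "length ?ws = dim ?W" using cl C(4) distinct_card by fastforce
  have wsS: "set ?ws \<subseteq> ?S" using linear_form_in_sym_dual by auto
  have "\<exists>e. cs.reducible_to P ?ws e f"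
    if P: "cs.ideal_of P" "\<forall>a\<in>?S. a - act s B \<tau> a \<in> P" and "f \<in> ?S" for P f
    using \<open>f \<in> ?S\<close>
  proof (induction rule: sym_dual_induct)
    case (const c)
    show ?case using cs.reducible_to_coeff[OF P(1) wsS] by blast
  next
    case (var b)
    let ?\<phi> = "coordinate s B b"
    have \<phi>: "Vector_Spaces.linear s (*) ?\<phi>" by (rule linear_coordinate[OF V])
    \<comment> \<open>\<open>u\<close> agrees with the coordinate on the fixed space, so the linear
      form of the difference lies in \<open>P\<close>.\<close>
    define u where "u v = (\<Sum>c\<in>C. ?\<phi> c * dual c v)" for v
    let ?\<psi> = "\<lambda>v. ?\<phi> v - u v"
    have "Vector_Spaces.linear s (*) ?\<psi>"
      using \<phi> unfolding linear_functional_iff[OF vector_space_axioms]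
      by (simp add: u_def dual sum.distrib distrib_left right_diff_distrib sum_distrib_left mult.left_commute)
    moreover have "?\<psi> v = 0" if "v \<in> ?W" for v using expand[OF that \<phi>] by (simp add: u_def)
    ultimately obtain \<psi>' where "linear_form B ?\<psi> = linear_form B \<psi>' - act s B \<tau> (linear_form B \<psi>')"
      using linear_forms_vanishing_on_fixed_space[OF V \<tau>] by blast
    then have "linear_form B ?\<psi> \<in> P" using P(2) linear_form_in_sym_dual by metis
    moreover have "var b = linear_form B ?\<psi> + linear_form B u"
      unfolding linear_form_coordinate[OF V var, symmetric] linear_form_add[symmetric] by simp
    ultimately have "var b - linear_form B u \<in> P" by simp
    moreover have "linear_form B u \<in> cs.mspan ?ws 1"
    proof -
      have "linear_form B u = (\<Sum>c\<in>C. const (?\<phi> c) * linear_form B (dual c))"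
        unfolding u_def linear_form_sum linear_form_scale ..
      also have "\<dots> \<in> cs.mspan ?ws 1"
        unfolding cs.mspan_def
        by (intro cs.vs.span_sum cs.vs.span_scale cs.list_mem_mspan[unfolded cs.mspan_def]) (use cl in auto)
      finally show ?thesis .
    qed
    ultimately show ?case unfolding cs.reducible_to_def using var_in_sym_dual[OF var] by blast
  next
    case (add f g)
    then obtain e e' where "cs.reducible_to P ?ws e f" "cs.reducible_to P ?ws e' g" by blast
    then have "cs.reducible_to P ?ws (max e e') f" "cs.reducible_to P ?ws (max e e') g"
      using cs.reducible_to_mono[OF P(1) wsS] by (meson max.cobounded1 max.cobounded2)+
    then show ?case using cs.reducible_to_add[OF P(1) wsS] by blast
  next
    case (mult f g)
    then show ?case using cs.reducible_to_mult[OF P(1) wsS] by blast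
  qed
  then show ?thesis using len wsS by blast
qed

lemma linear_endo_act: "linear_endo (\<lambda>c f. const c * f) (act s B g)"
  by unfold_locales
    (simp_all add: const_add const_mult const_1 act_hom distrib_left distrib_right mult.assoc)

text \<open>On coordinate vectors \<open>Delta\<close> is the shift towards index 0. Its power
  \<open>p ^ a - p ^ b\<close> takes a suitable unit vector to the socle, while its power
  \<open>p ^ a - 1\<close> kills the block; both powers are transfer sums.\<close>

lemma jordan_summand_socle:
  fixes s :: "'k::field \<Rightarrow> 'v::ab_group_add \<Rightarrow> 'v"
  assumes p: "prime p" "CHAR('k) = p" and b: "b \<le> a"
    and n: "p ^ a - p ^ b + 1 \<le> n" "n \<le> p ^ a - 1"
    and G: "\<sigma> \<in> G" and summand: "direct_summand s B G M"
    and iso: "isomorphic_to_jordan s B \<sigma> M n"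
  shows "\<exists>w\<in>carrier (sym_dual B). \<exists>y. y = (\<Sum>i<p ^ (a - b). (act s B \<sigma> ^^ (p ^ b * i)) w) \<and>
    (act s B \<sigma> ^^ (p ^ a)) w = w \<and> act s B \<sigma> y = y \<and>
    (\<forall>f\<in>carrier (sym_dual B). (\<Sum>j<p ^ a. (act s B \<sigma> ^^ j) f) \<noteq> y)"
proof -
  let ?S = "carrier (sym_dual B) :: ('v, 'k) mpoly set" and ?T = "act s B \<sigma> :: ('v, 'k) mpoly \<Rightarrow> _"
  interpret linear_endo "\<lambda>c f. const c * f" ?T by (rule linear_endo_act)
  obtain \<psi> :: "(nat \<Rightarrow> 'k) \<Rightarrow> ('v, 'k) mpoly" where bij: "bij_betw \<psi> (jordan_module n) M"
    and add: "\<And>v w. v \<in> jordan_module n \<Longrightarrow> w \<in> jordan_module n \<Longrightarrow> \<psi> (\<lambda>i. v i + w i) = \<psi> v + \<psi> w"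
    and gen: "\<And>v. v \<in> jordan_module n \<Longrightarrow> \<psi> (jordan_gen v) = ?T (\<psi> v)"
    using iso unfolding isomorphic_to_jordan_def by blast
  obtain N where N: "submodule_of_sym s B G M" "submodule_of_sym s B G N"
    "{f + h | f h. f \<in> M \<and> h \<in> N} = ?S" "M \<inter> N = {0}"
    using summand unfolding direct_summand_def direct_decomposition_def by blast
  have zero: "\<psi> (\<lambda>i. 0) = 0"
    using add[of "\<lambda>i. 0" "\<lambda>i. 0"] by (simp add: jordan_module_def)
  have Delta1: "Delta (\<psi> v) = \<psi> (\<lambda>i. v (Suc i))" if v: "v \<in> jordan_module n" for v
  proof -
    have "(\<lambda>i. v (Suc i)) \<in> jordan_module n" using v by (auto simp: jordan_module_def)
    from add[OF v this] gen[OF v] show ?thesis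
      unfolding jordan_gen_def by (metis add_diff_cancel_left')
  qed
  have Delta: "(Delta ^^ k) (\<psi> v) = \<psi> (\<lambda>i. v (i + k))" if v: "v \<in> jordan_module n" for v k
  proof (induction k)
    case (Suc k)
    have "(\<lambda>i. v (i + k)) \<in> jordan_module n" using v by (auto simp: jordan_module_def)
    from Delta1[OF this] Suc show ?case by simp
  qed simp
  define e where "e j = (\<lambda>i. if i = j then 1 else (0::'k))" for j :: nat
  have e: "e j \<in> jordan_module n" if "j < n" for j using that by (auto simp: e_def jordan_module_def)
  have "0 < p" using p by (simp add: prime_gt_0_nat)
  \<comment> \<open>Indices start at 0, so the lower bound on \<open>n\<close> says exactly that the
    block has a unit vector with this index.\<close>
  let ?j = "p ^ a - p ^ b"
  have j: "?j < n" "0 < n" using n by auto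
  define w where "w = \<psi> (e ?j)"
  define y where "y = \<psi> (e 0)"
  have shift: "(\<lambda>i. e ?j (i + k)) = (if k \<le> ?j then e (?j - k) else (\<lambda>i. 0))" for k
    by (auto simp: e_def fun_eq_iff)
  have "(Delta ^^ ?j) w = y" unfolding w_def y_def Delta[OF e[OF j(1)]] shift by simp
  then have y: "y = (\<Sum>i<p ^ (a - b). (?T ^^ (p ^ b * i)) w)"
    using sum_pow_char[OF p b, of w] by simp
  \<comment> \<open>In characteristic \<open>p\<close> this means that the \<open>p ^ a\<close>-th
    power of the action fixes \<open>w\<close>.\<close>
  have "(Delta ^^ (p ^ a)) w = 0"
  proof -
    have "\<not> p ^ a \<le> ?j" using \<open>0 < p\<close> by (simp add: not_le)
    then show ?thesis unfolding w_def Delta[OF e[OF j(1)]] shift using zero by simp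
  qed
  then have w: "(?T ^^ (p ^ a)) w = w" unfolding Delta_pow_char[OF p] by simp
  have "(\<lambda>i. e 0 (Suc i)) = (\<lambda>i. 0)" by (simp add: e_def)
  then have "Delta y = 0" using Delta1[OF e[OF j(2)]] zero by (simp add: y_def)
  then have Ty: "?T y = y" by simp
  have yM: "y \<in> M" and wM: "w \<in> M" using bij e j unfolding y_def w_def by (auto dest: bij_betwE)
  have "e 0 \<noteq> (\<lambda>i. 0)" by (auto simp: e_def fun_eq_iff)
  moreover have "(\<lambda>i. 0) \<in> jordan_module n" by (simp add: jordan_module_def)
  ultimately have y0: "y \<noteq> 0"
    using bij e[OF j(2)] zero unfolding y_def bij_betw_def inj_on_def by metis
  have "(\<Sum>j<p ^ a. (?T ^^ j) f) \<noteq> y" if "f \<in> ?S" for f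
  proof
    assume eq: "(\<Sum>j<p ^ a. (?T ^^ j) f) = y"
    \<comment> \<open>The part of \<open>f\<close> in \<open>M\<close> has zero transfer sum. Hence
      \<open>y\<close> would be the transfer sum of the part in the complement and lie in
      \<open>M \<inter> N\<close>.\<close>
    obtain g h where gh: "f = g + h" "g \<in> M" "h \<in> N" using N(3) \<open>f \<in> ?S\<close> by blast
    obtain v where v: "v \<in> jordan_module n" "g = \<psi> v" using gh(2) bij by (auto simp: bij_betw_def)
    have "(\<Sum>j<p ^ a. (?T ^^ j) g) = (Delta ^^ (p ^ a - 1)) g"
      using sum_pow_char[OF p, of 0 a g] by simp
    also have "(\<lambda>i. v (i + (p ^ a - 1))) = (\<lambda>i. 0)"
      using v(1) n by (auto simp: jordan_module_def)
    then have "(Delta ^^ (p ^ a - 1)) g = 0" unfolding v(2) Delta[OF v(1)] using zero by simp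
    finally have "y = (\<Sum>j<p ^ a. (?T ^^ j) h)"
      using eq unfolding gh(1) pow_add sum.distrib by simp
    moreover have "(?T ^^ j) h \<in> N" for j
      by (induction j) (use gh(3) N(2) G in \<open>auto simp: submodule_of_sym_def\<close>)
    then have "(\<Sum>j\<in>J. (?T ^^ j) h) \<in> N" for J
      by (induction J rule: infinite_finite_induct) (use N(2) in \<open>auto simp: submodule_of_sym_def\<close>)
    ultimately have "y \<in> M \<inter> N" using yM by blast
    then show False using N(4) y0 by blast
  qed
  moreover have "w \<in> ?S" using wM N(1) by (auto simp: submodule_of_sym_def)
  ultimately show ?thesis using y w Ty by blast
qed

section \<open>Cosets, transfers and fixed spaces for a cyclic linear group\<close>

section \<open>Cyclic subgroups of the general linear group\<close>

lemma group_GL: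
  fixes s :: "'k::field \<Rightarrow> 'v::ab_group_add \<Rightarrow> 'v"
  assumes "vector_space s" shows "group (GL s)"
proof (rule groupI)
  interpret vector_space s by fact
  show "\<one>\<^bsub>GL s\<^esub> \<in> carrier (GL s)" 
    using linear_id bij_id by (simp only: GL_def partial_object.simps monoid.simps) blast
  fix g h assume "g \<in> carrier (GL s)" "h \<in> carrier (GL s)"
  then have "Vector_Spaces.linear s s (g \<circ> h)" "bij (g \<circ> h)"
    by (auto simp: GL_def intro: Vector_Spaces.linear_compose bij_comp)
  then show "g \<otimes>\<^bsub>GL s\<^esub> h \<in> carrier (GL s)" by (simp only: GL_def partial_object.simps monoid.simps) blast
next
  fix g assume g: "g \<in> carrier (GL s)"
  then have "bij g" by (simp add: GL_def)
  then have "inv_into UNIV g \<in> carrier (GL s)" "inv_into UNIV g \<circ> g = id"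
    using linear_inv_GL[OF g] by (auto simp: GL_def bij_imp_bij_inv bij_is_inj)
  then show "\<exists>h\<in>carrier (GL s). h \<otimes>\<^bsub>GL s\<^esub> g = \<one>\<^bsub>GL s\<^esub>" by (auto simp: GL_def)
qed (auto simp: GL_def comp_assoc)

lemma GL_pow: "g [^]\<^bsub>GL s\<^esub> (i::nat) = g ^^ i"
proof (induction i)
  case (Suc i)
  then show ?case by (simp only: nat_pow_Suc funpow_Suc_right) (simp add: GL_def)
qed (simp add: GL_def)

lemma generate_GL_cyclic:
  assumes "vector_space s" and g: "g \<in> carrier (GL s)" and n: "g ^^ n = id" "0 < n"
  shows "generate (GL s) {g} = range (\<lambda>i. g ^^ i)"
proof -
  interpret group "GL s" by (rule group_GL) fact
  have "g [^]\<^bsub>GL s\<^esub> n = \<one>\<^bsub>GL s\<^esub>" using n(1) by (simp add: GL_pow) (simp add: GL_def)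
  then have "ord g dvd n" using pow_eq_id[OF g] by blast
  then have "ord g \<noteq> 0" using n(2) by auto
  then show ?thesis using generate_pow_nat[OF g] by (auto simp: GL_pow)
qed

locale GL_cyclic =
  fixes s :: "'k::field \<Rightarrow> 'v::ab_group_add \<Rightarrow> 'v" and B :: "'v set" and \<sigma> :: "'v \<Rightarrow> 'v" and q :: nat
  assumes V: "finite_dimensional_vector_space s B" and \<sigma>: "\<sigma> \<in> carrier (GL s)"
    and card_generate: "card (generate (GL s) {\<sigma>}) = q" and q_pos: "0 < q"
begin

sublocale finite_dimensional_vector_space s B by (rule V)

abbreviation G :: "('v \<Rightarrow> 'v) set" where "G \<equiv> generate (GL s) {\<sigma>}"

abbreviation T :: "('v, 'k) mpoly \<Rightarrow> ('v, 'k) mpoly" where "T \<equiv> act s B \<sigma>"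

abbreviation S :: "('v, 'k) mpoly set" where "S \<equiv> carrier (sym_dual B)"

lemma pow_eq_iff: "\<sigma> ^^ i = \<sigma> ^^ j \<longleftrightarrow> [i = j] (mod q)"
proof -
  interpret GL: group "GL s" by (rule group_GL) (rule vector_space_axioms)
  have "GL.ord \<sigma> = q" using GL.generate_pow_card[OF \<sigma>] card_generate by simp
  then show ?thesis
    using GL.int_pow_eq[OF \<sigma>, of "int i" "int j"]
    by (simp add: int_pow_int GL_pow cong_int_iff[symmetric] cong_iff_dvd_diff dvd_diff_commute)
qed

lemma pow_period: "\<sigma> ^^ q = id"
  using pow_eq_iff[of q 0] by (simp add: cong_def)

lemma generate_pow_eq: "generate (GL s) {\<sigma> ^^ m} = range (\<lambda>i. \<sigma> ^^ (m * i))"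
proof -
  have "(\<sigma> ^^ m) ^^ q = id"
    using pow_eq_iff[of "m * q" 0] by (simp add: funpow_mult mult.commute cong_def)
  from generate_GL_cyclic[OF vector_space_axioms funpow_GL[OF \<sigma> vector_space_axioms] this q_pos]
  show ?thesis by (simp add: funpow_mult mult.commute)
qed

lemma G_eq: "G = range (\<lambda>i. \<sigma> ^^ i)"
  using generate_pow_eq[of 1] by simp

lemma act_pow: "f \<in> S \<Longrightarrow> act s B (\<sigma> ^^ i) f = (T ^^ i) f"
  by (rule act_funpow[OF V \<sigma>])

sublocale act: cyclic_action S T q
proof -
  interpret subring_set S by (rule subring_sym_dual)
  show "cyclic_action S T q"
    by unfold_locales
      (use act_pow[of _ q] act_id[OF V] in \<open>auto simp: act_hom act_in_sym_dual q_pos pow_period\<close>)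
qed

lemma invariants_generate: "invariants s B (generate (GL s) {\<sigma> ^^ m}) = act.fixed m"
proof -
  have "(\<forall>h\<in>range (\<lambda>i. \<sigma> ^^ (m * i)). act s B h f = f) \<longleftrightarrow> (T ^^ m) f = f" if f: "f \<in> S" for f
  proof
    assume "\<forall>h\<in>range (\<lambda>i. \<sigma> ^^ (m * i)). act s B h f = f"
    then have "act s B (\<sigma> ^^ (m * 1)) f = f" by blast
    then show "(T ^^ m) f = f" using act_pow[OF f] by simp
  next
    assume "(T ^^ m) f = f"
    then have "f \<in> act.fixed m" using f by (simp add: act.fixed_def)
    then have "(T ^^ (m * i)) f = f" for i using act.fixed_mult by (simp add: act.fixed_def)
    then show "\<forall>h\<in>range (\<lambda>i. \<sigma> ^^ (m * i)). act s B h f = f" using act_pow[OF f] by auto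
  qed
  then show ?thesis unfolding invariants_def generate_pow_eq act.fixed_def by auto
qed

lemma invariants_G: "invariants s B G = act.invs"
  using invariants_generate[of 1] by simp

text \<open>The cosets are the sets \<open>c j\<close> for \<open>j < m\<close>. The representative
  picked by \<open>SOME\<close> differs from \<open>\<sigma> ^^ j\<close> by an element of the
  subgroup, which fixes \<open>f\<close>.\<close>

lemma transfer_eq:
  assumes q: "q = m * n" and f: "f \<in> act.fixed m"
  shows "transfer s B G (generate (GL s) {\<sigma> ^^ m}) f = (\<Sum>j<m. (T ^^ j) f)"
proof -
  define c where "c j = {\<sigma> ^^ (j + m * t) | t. True}" for j
  have m: "0 < m" "0 < n" using q q_pos by auto
  have fS: "f \<in> S" using f by (simp add: act.fixed_def)
  have c_mod: "c i = c (i mod m)" for i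
  proof
    show "c i \<subseteq> c (i mod m)"
    proof
      fix g assume "g \<in> c i"
      then obtain t where "g = \<sigma> ^^ (i + m * t)" by (auto simp: c_def)
      also have "i + m * t = i mod m + m * (i div m + t)" by (simp add: distrib_left)
      finally show "g \<in> c (i mod m)" unfolding c_def by blast
    qed
    show "c (i mod m) \<subseteq> c i"
    proof
      fix g assume "g \<in> c (i mod m)"
      then obtain t where t: "g = \<sigma> ^^ (i mod m + m * t)" by (auto simp: c_def)
      let ?k = "i div m"
      \<comment> \<open>Exponents are natural numbers, so going down by \<open>m * ?k\<close> is
        replaced by going up by \<open>m * ?k * (n - 1)\<close>, which is the same modulo
        \<open>q\<close>.\<close>
      have "?k + ?k * (n - 1) = ?k * n" using m(2) by (cases n) auto
      then have "m * ?k + m * (?k * (n - 1)) = q * ?k"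
        unfolding q by (metis distrib_left mult.assoc mult.commute)
      moreover have "i + m * (t + ?k * (n - 1)) = (i mod m + m * ?k) + m * (t + ?k * (n - 1))"
        by simp
      then have "i + m * (t + ?k * (n - 1)) = i mod m + m * t + (m * ?k + m * (?k * (n - 1)))"
        by (simp only: distrib_left add_ac)
      ultimately have "i + m * (t + ?k * (n - 1)) = i mod m + m * t + q * ?k" by simp
      then have "[i mod m + m * t = i + m * (t + ?k * (n - 1))] (mod q)"
        by (simp add: cong_def)
      then have "g = \<sigma> ^^ (i + m * (t + ?k * (n - 1)))" unfolding t pow_eq_iff .
      then show "g \<in> c i" unfolding c_def by blast
    qed
  qed
  have "lcosets\<^bsub>(GL s)\<lparr>carrier := G\<rparr>\<^esub> (generate (GL s) {\<sigma> ^^ m}) = range c"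
  proof -
    have "(\<sigma> ^^ i) <#\<^bsub>(GL s)\<lparr>carrier := G\<rparr>\<^esub> (range (\<lambda>i. \<sigma> ^^ (m * i))) = c i" for i
      unfolding l_coset_def c_def by (auto simp: GL_def funpow_add)
    then show ?thesis unfolding LCOSETS_def generate_pow_eq G_eq by auto
  qed
  also have "range c = c ` {..<m}"
  proof
    show "range c \<subseteq> c ` {..<m}"
    proof
      fix C assume "C \<in> range c"
      then obtain i where "C = c (i mod m)" using c_mod by blast
      then show "C \<in> c ` {..<m}" using m(1) by auto
    qed
  qed blast
  finally have cosets: "lcosets\<^bsub>(GL s)\<lparr>carrier := G\<rparr>\<^esub> (generate (GL s) {\<sigma> ^^ m}) = c ` {..<m}" .
  have "inj_on c {..<m}"
  proof (rule inj_onI)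
    fix i j assume ij: "i \<in> {..<m}" "j \<in> {..<m}" "c i = c j"
    have "\<sigma> ^^ i \<in> c i" unfolding c_def by (auto intro!: exI[of _ 0])
    then obtain t where "\<sigma> ^^ i = \<sigma> ^^ (j + m * t)" using ij(3) by (auto simp: c_def)
    then have "[i = j + m * t] (mod m)"
      unfolding pow_eq_iff q by (rule cong_dvd_modulus_nat) simp
    then show "i = j" using ij by (simp add: cong_def)
  qed
  then have "transfer s B G (generate (GL s) {\<sigma> ^^ m}) f = (\<Sum>j<m. act s B (SOME \<tau>. \<tau> \<in> c j) f)"
    unfolding transfer_def cosets by (simp add: sum.reindex)
  also have "\<dots> = (\<Sum>j<m. (T ^^ j) f)"
  proof (rule sum.cong)
    fix j
    have "\<exists>\<tau>. \<tau> \<in> c j" unfolding c_def by blast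
    then have "(SOME \<tau>. \<tau> \<in> c j) \<in> c j" by (rule someI_ex)
    then obtain t where "(SOME \<tau>. \<tau> \<in> c j) = \<sigma> ^^ (j + m * t)" by (auto simp: c_def)
    moreover have "(T ^^ (m * t)) f = f" using act.fixed_mult[OF f] by (simp add: act.fixed_def)
    ultimately show "act s B (SOME \<tau>. \<tau> \<in> c j) f = (T ^^ j) f"
      by (simp only: act_pow[OF fS]) (simp add: funpow_add)
  qed simp
  finally show ?thesis .
qed

lemma fixed_space_pow_char:
  assumes "prime p" "CHAR('k) = p"
  shows "fixed_space {\<sigma> ^^ (p ^ e)} = {v. ((\<lambda>v. \<sigma> v - v) ^^ (p ^ e)) v = 0}"
    and "fixed_space G = {v. \<sigma> v - v = 0}"
proof -
  interpret \<sigma>: Vector_Spaces.linear s s \<sigma> using \<sigma> by (simp add: GL_def)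
  interpret linear_endo s \<sigma> by unfold_locales (simp_all add: \<sigma>.add \<sigma>.scale)
  show "fixed_space {\<sigma> ^^ (p ^ e)} = {v. ((\<lambda>v. \<sigma> v - v) ^^ (p ^ e)) v = 0}"
    unfolding Delta_pow_char[OF assms] by (simp add: fixed_space_def)
  have "(\<sigma> ^^ i) v = v" if "\<sigma> v = v" for i v by (induction i) (use that in auto)
  moreover have "\<sigma> \<in> range (\<lambda>i. \<sigma> ^^ i)" by (rule range_eqI[of _ _ 1]) simp
  ultimately have "(\<forall>h\<in>range (\<lambda>i. \<sigma> ^^ i). h v = v) \<longleftrightarrow> \<sigma> v = v" for v by blast
  then show "fixed_space G = {v. \<sigma> v - v = 0}"
    unfolding fixed_space_def G_eq by simp
qed

lemma dim_fixed_space_pow_le: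
  assumes "prime p" "CHAR('k) = p"
  shows "dim (fixed_space {\<sigma> ^^ (p ^ e)}) \<le> p ^ e * dim (fixed_space G)"
proof -
  interpret \<sigma>: Vector_Spaces.linear s s \<sigma> using \<sigma> by (simp add: GL_def)
  have "Vector_Spaces.linear s s (\<lambda>v. \<sigma> v - v)"
    using vector_space_axioms
    by (simp add: Vector_Spaces.linear_iff \<sigma>.add \<sigma>.scale scale_right_diff_distrib)
  then show ?thesis unfolding fixed_space_pow_char[OF assms] by (rule dim_kernel_funpow_le)
qed

end

locale infinite_GL_cyclic = GL_cyclic s B \<sigma> q
  for s :: "'k::field \<Rightarrow> 'v::ab_group_add \<Rightarrow> 'v" and B \<sigma> q +
  assumes inf_field: "infinite (UNIV :: 'k set)"
begin

sublocale act: linear_cyclic_action S T q const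
proof -
  interpret cs: coefficient_subring S const by (rule coefficient_subring_sym_dual)
  show "linear_cyclic_action S T q const"
    by unfold_locales (simp_all add: act_hom inf_field)
qed

text \<open>Since \<open>y\<close> is itself a sum over powers of the \<open>m\<close>-th power of
  \<open>\<sigma>\<close>, this combines the projection formula with transitivity of the transfer;
  \<open>m * i + j\<close> runs once through all exponents below \<open>m * n\<close>.\<close>

lemma tr_tower:
  assumes f: "f \<in> act.fixed m" and w: "(T ^^ (m * n)) w = w" "w \<in> S"
    and y: "y = (\<Sum>i<n. (T ^^ (m * i)) w)" "y \<in> act.invs"
  shows "act.tr m f * y = act.tr (m * n) (f * w)"
proof -
  have fm: "(T ^^ (m * i)) f = f" for i using act.fixed_mult[OF f] by (simp add: act.fixed_def)
  have "act.tr m f * y = act.tr m (y * f)" using act.tr_mult_left[OF y(2)] by (simp add: mult.commute)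
  also have "y * f = (\<Sum>i<n. (T ^^ (m * i)) (f * w))"
    unfolding y(1) act.pow_hom fm by (simp add: sum_distrib_left mult.commute)
  also have "act.tr m \<dots> = (\<Sum>j<m. \<Sum>i<n. (T ^^ (m * i + j)) (f * w))"
    unfolding act.tr_def act.pow_sum by (simp add: funpow_add add.commute)
  also have "\<dots> = (\<Sum>i<n. \<Sum>j<m. (T ^^ (m * i + j)) (f * w))" by (rule sum.swap)
  also have "\<dots> = (\<Sum>i<n. \<Sum>l\<in>{i * m..<i * m + m}. (T ^^ l) (f * w))"
  proof (rule sum.cong)
    fix i
    show "(\<Sum>j<m. (T ^^ (m * i + j)) (f * w)) = (\<Sum>l\<in>{i * m..<i * m + m}. (T ^^ l) (f * w))"
      by (rule sum.reindex_bij_witness[of _ "\<lambda>l. l - i * m" "\<lambda>j. m * i + j"]) (auto simp: mult.commute)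
  qed simp
  also have "\<dots> = act.tr (m * n) (f * w)"
    unfolding act.tr_def sum.nat_group by (simp add: mult.commute)
  finally show ?thesis .
qed

lemma transfer_ideal_eq:
  "q = m * n \<Longrightarrow> transfer_ideal s B G (generate (GL s) {\<sigma> ^^ m}) = act.tr m ` act.fixed m"
  unfolding transfer_ideal_def invariants_generate act.tr_def
  using transfer_eq by (intro image_cong) auto

text \<open>The generators \<open>fs\<close> have no constant term, so an element of order
  \<open>N\<close> is a transfer up to terms of degree at least \<open>N\<close>. Truncating below
  \<open>N\<close>, with \<open>N\<close> above the degree of \<open>y\<close>, makes
  \<open>y\<close> a transfer.\<close>

lemma ipow_tr_separated:
  assumes "set fs \<subseteq> act.invs" "set fs \<subseteq> {f. \<forall>m\<in>Poly_Mapping.keys f. 1 \<le> mdeg m}"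
    and "\<And>N. act.invs.ipow (act.tr m ` act.fixed m) (set fs) N y"
  shows "y \<in> act.tr m ` act.fixed m"
proof -
  let ?I = "act.tr m ` act.fixed m"
  define H where "H N = {f :: ('v, 'k) mpoly. \<forall>m\<in>Poly_Mapping.keys f. N \<le> mdeg m}" for N
  have H_add: "f + g \<in> H N" if "f \<in> H N" "g \<in> H N" for f g N
    using that keys_add[of f g] by (auto simp: H_def)
  have H_mult: "f * g \<in> H (Suc N)" if "f \<in> H 1" "g \<in> H N" for f g N
    using that keys_mult[of f g] by (fastforce simp: H_def mdeg_add)
  have H0: "0 \<in> H N" "f \<in> H 0" for N f by (auto simp: H_def)
  note I = act.ideal_of_tr[of m]
  have split: "\<exists>i\<in>?I. \<exists>t\<in>H N. u = i + t" if "act.invs.ipow ?I (set fs) N u" for N u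
    using that
  proof (induction rule: act.invs.ipow.induct)
    case (zero u)
    show ?case using act.invs.ideal_ofD(2)[OF I] H0 by (intro bexI[of _ 0] bexI[of _ u]) auto
  next
    case (base u n)
    then show ?case using H0 by (intro bexI[of _ u] bexI[of _ 0]) auto
  next
    case (mult n u x)
    then obtain i t where it: "i \<in> ?I" "t \<in> H n" "u = i + t" by blast
    have "x * i \<in> ?I" using it mult assms(1) act.invs.ideal_ofD(4)[OF I] by blast
    moreover have "x * t \<in> H (Suc n)" using it mult assms(2) by (intro H_mult) (auto simp: H_def)
    ultimately show ?case unfolding it(3) distrib_left by blast
  next
    case (add n u v)
    then obtain i t j r where "i \<in> ?I" "t \<in> H n" "u = i + t" "j \<in> ?I" "r \<in> H n" "v = j + r" by blast
    moreover from this have "u + v = (i + j) + (t + r)" by simp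
    ultimately show ?case using act.invs.ideal_ofD(3)[OF I] H_add by blast
  qed
  obtain N where N: "\<forall>m\<in>Poly_Mapping.keys y. mdeg m < N" using ex_degree_bound by blast
  obtain g t where gt: "g \<in> act.fixed m" "t \<in> H N" "y = act.tr m g + t"
    using split[OF assms(3)[of N]] by blast
  have "low_part N y = act.tr m (low_part N g)"
    using gt(2) low_part_eq_0[of t N]
    by (simp add: gt(3) low_part_add act.tr_def low_part_sum low_part_act_funpow H_def)
  moreover have "low_part N g \<in> act.fixed m"
    using gt(1) low_part_in_sym_dual by (auto simp: act.fixed_def simp flip: low_part_act_funpow)
  ultimately show ?thesis using low_part_eq_self[OF N] by auto
qed

end

theorem proposition6:
  fixes s :: "'k::field \<Rightarrow> 'v::ab_group_add \<Rightarrow> 'v"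
    and B :: "'v set"
    and \<sigma> :: "'v \<Rightarrow> 'v"
    and G K :: "('v \<Rightarrow> 'v) set"
    and p r a b n :: nat
    and M :: "('v, 'k) mpoly set"
  assumes "prime p"
    and "infinite (UNIV :: 'k set)"
    and "CHAR('k) = p"
    and "finite_dimensional_vector_space s B"
    and "r \<ge> 1"
    and "\<sigma> \<in> carrier (GL s)"
    and "G = generate (GL s) {\<sigma>}"
    and "card G = p ^ r"
    and "a \<le> r"
    and "K = generate (GL s) {\<sigma> [^]\<^bsub>GL s\<^esub> (p ^ a)}"
    and "0 < b" and "b \<le> a"
    and "p ^ a - p ^ b + 1 \<le> n" and "n \<le> p ^ a - 1"
    and "direct_summand s B G M"
    and "indecomposable s B G M"
    and "isomorphic_to_jordan s B \<sigma> M n"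
  shows "depth (transfer_quotient s B G K) (transfer_quotient_grading s B G K)
           \<le> enat (vector_space.dim s (fixed_space {\<sigma> [^]\<^bsub>GL s\<^esub> (p ^ (b - 1))}))
         \<and> vector_space.dim s (fixed_space {\<sigma> [^]\<^bsub>GL s\<^esub> (p ^ (b - 1))})
           \<le> p ^ (b - 1) * vector_space.dim s (fixed_space G)"
proof -
  note p = assms(1,3)
  have "0 < p" using p by (simp add: prime_gt_0_nat)
  interpret V: infinite_GL_cyclic s B \<sigma> "p ^ r"
    using assms(2,4,6,7,8) \<open>0 < p\<close>
    by (intro infinite_GL_cyclic.intro GL_cyclic.intro infinite_GL_cyclic_axioms.intro) auto
  have G: "G = V.G" by fact
  have K: "K = generate (GL s) {\<sigma> ^^ (p ^ a)}" using assms(10) by (simp only: GL_pow)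
  have q: "p ^ r = p ^ a * p ^ (r - a)" using \<open>a \<le> r\<close> by (simp flip: power_add)
  have ab: "p ^ a = p ^ b * p ^ (a - b)" using \<open>b \<le> a\<close> by (simp flip: power_add)
  let ?\<tau> = "\<sigma> ^^ (p ^ (b - 1))" and ?I = "V.act.tr (p ^ a) ` V.act.fixed (p ^ a)"
  note I = V.act.ideal_of_tr[of "p ^ a"]
  have invs: "invariants s B G = V.act.invs" unfolding G by (rule V.invariants_G)
  have ring: "invariant_ring s B G = V.act.invs.as_ring"
    by (simp add: invariant_ring_def sym_dual_def invs)
  have ideal: "transfer_ideal s B G K = ?I"
    unfolding K G by (rule V.transfer_ideal_eq[OF q])
  have "\<sigma> \<in> G" unfolding G V.G_eq by (rule range_eqI[of _ _ 1]) simp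
  from jordan_summand_socle[OF p \<open>b \<le> a\<close> assms(13,14) this assms(15,17)]
  obtain w y where w: "w \<in> V.S" "(V.T ^^ (p ^ a)) w = w"
    and y: "y = (\<Sum>i<p ^ (a - b). (V.T ^^ (p ^ b * i)) w)" "V.T y = y"
    and not_tr: "\<And>f. f \<in> V.S \<Longrightarrow> (\<Sum>j<p ^ a. (V.T ^^ j) f) \<noteq> y"
    by blast
  have y_inv: "y \<in> V.act.invs"
    using y w(1) by (auto simp: V.act.fixed_def intro!: V.act.sum_mem V.act.pow_closed)
  have y_notin: "y \<notin> ?I" using not_tr by (auto simp: V.act.tr_def V.act.fixed_def)
  obtain ws where ws: "length ws = V.dim (fixed_space {?\<tau>})" "set ws \<subseteq> V.S"
    and red: "\<And>P f. V.act.ideal_of P \<Longrightarrow> \<forall>a\<in>V.S. a - act s B ?\<tau> a \<in> P \<Longrightarrow> f \<in> V.S \<Longrightarrow>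
       \<exists>E. V.act.reducible_to P ws E f"
    using linear_forms_generate_mod_inertia[OF assms(4) funpow_GL[OF assms(6) V.vector_space_axioms]] by blast
  have "length xs \<le> V.dim (fixed_space {?\<tau>})"
    if reg: "regular_sequence (transfer_quotient s B G K) xs"
      and pos: "set xs \<subseteq> positive_part (transfer_quotient s B G K) (transfer_quotient_grading s B G K)" for xs
  proof -
    let ?c = "(+>\<^bsub>V.act.invs.as_ring\<^esub>) ?I"
    let ?H = "{f :: ('v, 'k) mpoly. \<forall>m\<in>Poly_Mapping.keys f. 1 \<le> mdeg m}"
    have Q: "transfer_quotient s B G K = V.act.invs.as_ring Quot ?I"
      unfolding transfer_quotient_def ring ideal ..
    have grading: "transfer_quotient_grading s B G K = (\<lambda>d. ?c ` (V.act.invs \<inter> homogeneous d))"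
      unfolding transfer_quotient_grading_def ring ideal invs ..
    have "\<exists>f\<in>V.act.invs \<inter> ?H. x = ?c f" if "x \<in> set xs" for x
    proof (rule V.act.invs.positive_part_quotient[OF I])
      show "x \<in> positive_part (V.act.invs.as_ring Quot ?I) (\<lambda>d. ?c ` (V.act.invs \<inter> homogeneous d))"
        using that pos unfolding Q grading by blast
      show "f + g \<in> ?H" if "f \<in> ?H" "g \<in> ?H" for f g using that keys_add[of f g] by blast
    qed (auto simp: homogeneous_altdef)
    then have "\<forall>x\<in>set xs. \<exists>f. f \<in> V.act.invs \<and> f \<in> ?H \<and> x = ?c f" by blast
    \<comment> \<open>\<open>F\<close> lifts each coset of the sequence to an invariant without
      constant term.\<close>
    then obtain F where F: "\<forall>x\<in>set xs. F x \<in> V.act.invs \<and> F x \<in> ?H \<and> x = ?c (F x)"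
      by (rule bchoice[THEN exE])
    let ?fs = "map F xs"
    have fs: "set ?fs \<subseteq> V.act.invs" "set ?fs \<subseteq> ?H" using F by auto
    have "map ?c ?fs = xs" using F by (auto intro!: map_idI simp: comp_def)
    then have regm: "V.act.invs.reg_mod ?I ?fs"
      using reg unfolding Q by (intro V.act.invs.reg_mod_if_regular_sequence[OF I fs(1)]) simp
    have sep: "\<not> (\<forall>N. V.act.invs.ipow ?I (set ?fs) N y)"
      using V.ipow_tr_separated[OF fs] y_notin by blast
    \<comment> \<open>As \<open>y\<close> is the relative transfer of \<open>w\<close>, multiplying
      it by a transfer \<open>f\<close> of \<open>g\<close> gives the transfer of
      \<open>g * w\<close>.\<close>
    have ann: "f * y \<in> ?I" if f: "f \<in> V.act.tr (p ^ b) ` V.act.fixed (p ^ b)" for f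
    proof -
      obtain g where g: "f = V.act.tr (p ^ b) g" "g \<in> V.act.fixed (p ^ b)" using f by blast
      have "f * y = V.act.tr (p ^ a) (g * w)"
        unfolding g(1) ab using V.tr_tower[OF g(2) _ w(1) y(1) y_inv] w(2) ab by simp
      moreover have "g * w \<in> V.act.fixed (p ^ a)"
        using V.act.fixed_mult[OF g(2), of "p ^ (a - b)"] w
        by (simp add: V.act.fixed_def V.act.pow_hom V.act.mult_mem flip: ab)
      ultimately show ?thesis by blast
    qed
    have "length ?fs \<le> length ws"
    proof (rule V.act.regular_sequence_length_le[OF assms(1) refl \<open>0 < b\<close> _ I fs(1) regm y_inv sep ann ws(2)])
      show "b \<le> r" using \<open>b \<le> a\<close> \<open>a \<le> r\<close> by simp
      show "\<exists>E. V.act.reducible_to P ws E f"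
        if "V.act.ideal_of P" "\<And>a. a \<in> V.S \<Longrightarrow> a - (V.T ^^ (p ^ (b - 1))) a \<in> P" "f \<in> V.S" for P f
        using that V.act_pow by (intro red) auto
    qed
    then show ?thesis using ws(1) by simp
  qed
  then have "depth (transfer_quotient s B G K) (transfer_quotient_grading s B G K)
      \<le> enat (V.dim (fixed_space {?\<tau>}))"
    unfolding depth_def by (intro SUP_least) auto
  then show ?thesis
    using V.dim_fixed_space_pow_le[OF p, of "b - 1"] unfolding GL_pow G by blast
qed

end
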